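(* Let $W$ be a Kähler complex surface with strongly pseudoconcave boundary, and let $\widetilde W$ be obtained from $W$ by holomorphically attaching a standard concave handle $H_a$ along a transverse knot in $\partial W$. Then, if $a$ is large enough, the Kähler form of $W$ can be extended over $H_a$ (so as to give a Kähler form on $\widetilde W$).
   Context: A complex surface $W$ with smooth boundary is understood to be contained as a domain in a larger complex surface $W'$ without boundary. The boundary $\partial W$, oriented as boundary of $W$, is strongly pseudoconcave if $-\partial W$ is the zero set of a smooth regular strictly plurisubharmonic function defined near $\partial W$ and is oriented as the boundary of its sublevel; then $\xi=T\partial W\cap J(T\partial W)$ is a contact structure on $\partial W$. Standard concave handle: for $a>0$, $$H_a=\left\{(z_1,z_2)\in\mathbb{C}^2 : |z_2|\le \exp\!\left(\tfrac{|z_1|^2}{a}-a\right),\ |z_1|\le 1+a^{-1}\right\}.$$ Its core is the holomorphic disk $\{z_2=0\}\cap H_a$, its attaching circle is $\{|z_1|=1,\ z_2=0\}$, and its attaching region is $\{(z_1,z_2)\in H_a: 1\le|z_1|\le 1+a^{-1}\}$. Holomorphic attaching along a transverse knot $L\subset(\partial W,\xi)$: after possibly pushing $\partial W$ slightly into $W$ near $L$ (keeping it strongly pseudoconcave; the resulting domain is still denoted $W$ and the resulting knot $L$), and replacing $L$ by a $C^\infty$-close transverse knot $\widetilde L\subset\partial W$, one has a biholomorphism $F\colon U\to V$ from an open subset $U\subset\mathbb{C}^2$ containing the attaching region of $H_a$ (for all large $a$) onto an open subset $V\subset W'$, such that $F$ maps the annulus $S^1\times\mathopen]-\epsilon,\epsilon\mathclose[\subset\mathbb{C}\times\mathbb{C}$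 (some $\epsilon>0$, $S^1=\{|z_1|=1\}$, $z_2$ real) into $\partial W$ with $F(S^1\times\{0\})=\widetilde L$, and maps the part $1<|z_1|\le 1+a^{-1}$ of the core into the interior of $W$, so that the core crosses $\partial W$ transversally along $\widetilde L$. The result is the complex surface with corners $\widetilde W=W\cup_F H_a$ obtained by gluing $H_a$ to $W$, identifying points $x\in H_a$ in the attaching region (and near it) satisfying $F(x)\in W$ with $F(x)$. *)

theory Defs
  imports "HOL-Analysis.Analysis"
begin

section \<open>Calculus on \<open>\<complex>\<^sup>2\<close>\<close>

type_synonym complex2 = "complex \<times> complex"

definition J :: "complex2 \<Rightarrow> complex2" where
  "J v = (\<i> * fst v, \<i> * snd v)"

primrec Ck_on :: "nat \<Rightarrow> 'a::real_normed_vector set \<Rightarrow> ('a \<Rightarrow> 'b::real_normed_vector) \<Rightarrow> bool" where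
  "Ck_on 0 S f \<longleftrightarrow> continuous_on S f"
| "Ck_on (Suc k) S f \<longleftrightarrow>
     (\<exists>f'. (\<forall>x\<in>S. (f has_derivative f' x) (at x)) \<and> (\<forall>v. Ck_on k S (\<lambda>x. f' x v)))"

text \<open>\<open>C\<^sup>\<infinity>\<close> functions; only meaningful for open \<open>S\<close> in a finite-dimensional space.\<close>

definition smooth_on :: "'a::real_normed_vector set \<Rightarrow> ('a \<Rightarrow> 'b::real_normed_vector) \<Rightarrow> bool" where
  "smooth_on S f \<longleftrightarrow> (\<forall>k. Ck_on k S f)"

text \<open>Real derivative commuting with \<open>J\<close>, i.e. complex linear; for open \<open>S\<close>.\<close>

definition holomorphic2_on :: "complex2 set \<Rightarrow> (complex2 \<Rightarrow> complex2) \<Rightarrow> bool" where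
  "holomorphic2_on S f \<longleftrightarrow>
     (\<forall>z\<in>S. \<exists>T. (f has_derivative T) (at z) \<and> (\<forall>v. T (J v) = J (T v)))"

definition second_deriv :: "(complex2 \<Rightarrow> real) \<Rightarrow> complex2 \<Rightarrow> complex2 \<Rightarrow> complex2 \<Rightarrow> real" where
  "second_deriv f z v w =
     frechet_derivative (\<lambda>y. frechet_derivative f (at y) v) (at z) w"

text \<open>
  The Levi form \<open>\<Sum>\<^sub>j\<^sub>k (\<partial>\<^sup>2f / \<partial>z\<^sub>j \<partial>(cnj z\<^sub>k)) v\<^sub>j (cnj v\<^sub>k)\<close>: a quarter of the Laplacian at \<open>0\<close> of
  \<open>\<zeta> \<mapsto> f (z + \<zeta> v)\<close>.
\<close>

definition levi_form :: "(complex2 \<Rightarrow> real) \<Rightarrow> complex2 \<Rightarrow> complex2 \<Rightarrow> real" where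
  "levi_form f z v = (second_deriv f z v v + second_deriv f z (J v) (J v)) / 4"

text \<open>A real 2-form, as a function of the base point and two tangent vectors.\<close>

type_synonym form2 = "complex2 \<Rightarrow> complex2 \<Rightarrow> complex2 \<Rightarrow> real"

definition smooth_2form_on :: "complex2 set \<Rightarrow> form2 \<Rightarrow> bool" where
  "smooth_2form_on S \<eta> \<longleftrightarrow>
     (\<forall>z\<in>S. bilinear (\<eta> z) \<and> (\<forall>v. \<eta> z v v = 0)) \<and>
     (\<forall>v w. smooth_on S (\<lambda>z. \<eta> z v w))"

text \<open>Invariant formula for \<open>d\<eta>\<close> on constant vector fields, whose brackets vanish.\<close>

definition ext_deriv :: "form2 \<Rightarrow> complex2 \<Rightarrow> complex2 \<Rightarrow> complex2 \<Rightarrow> complex2 \<Rightarrow> real" where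
  "ext_deriv \<eta> z u v w =
     frechet_derivative (\<lambda>y. \<eta> y v w) (at z) u
     - frechet_derivative (\<lambda>y. \<eta> y u w) (at z) v
     + frechet_derivative (\<lambda>y. \<eta> y u v) (at z) w"

text \<open>Kaehler forms on an open \<open>S\<close>: closed positive forms of type \<open>(1,1)\<close>.\<close>

definition kahler_on :: "complex2 set \<Rightarrow> form2 \<Rightarrow> bool" where
  "kahler_on S \<eta> \<longleftrightarrow>
     smooth_2form_on S \<eta> \<and>
     (\<forall>z\<in>S. \<forall>u v w. ext_deriv \<eta> z u v w = 0) \<and>
     (\<forall>z\<in>S. \<forall>v w. \<eta> z (J v) (J w) = \<eta> z v w) \<and>
     (\<forall>z\<in>S. \<forall>v. v \<noteq> 0 \<longrightarrow> \<eta> z v (J v) > 0)"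


section \<open>Complex surfaces\<close>

type_synonym 'a chart = "'a set \<times> ('a \<Rightarrow> complex2)"

text \<open>
  A topological space with an atlas. The images of the charts are open for a surface without
  boundary; for a surface with boundary and corners they are arbitrary domains with corners.
\<close>

record 'a surface =
  surf_top :: "'a topology"
  atlas :: "'a chart set"

definition complex_surface :: "'a surface \<Rightarrow> bool" where
  "complex_surface M \<longleftrightarrow>
     Hausdorff_space (surf_top M) \<and> second_countable (surf_top M) \<and>
     (\<Union>(D, \<phi>)\<in>atlas M. D) = topspace (surf_top M) \<and>
     (\<forall>(D, \<phi>)\<in>atlas M. openin (surf_top M) D \<and> open (\<phi> ` D) \<and>
        homeomorphic_map (subtopology (surf_top M) D) (top_of_set (\<phi> ` D)) \<phi>) \<and>
     (\<forall>(D, \<phi>)\<in>atlas M. \<forall>(D', \<phi>')\<in>atlas M.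
        holomorphic2_on (\<phi> ` (D \<inter> D')) (\<phi>' \<circ> inv_into D \<phi>))"

definition biholomorphic :: "'a surface \<Rightarrow> complex2 set \<Rightarrow> 'a set \<Rightarrow> (complex2 \<Rightarrow> 'a) \<Rightarrow> bool" where
  "biholomorphic M U V F \<longleftrightarrow>
     open U \<and> openin (surf_top M) V \<and>
     homeomorphic_map (top_of_set U) (subtopology (surf_top M) V) F \<and>
     (\<forall>(D, \<phi>)\<in>atlas M.
        holomorphic2_on {x \<in> U. F x \<in> D} (\<phi> \<circ> F) \<and>
        holomorphic2_on (\<phi> ` (D \<inter> V)) (inv_into U F \<circ> inv_into D \<phi>))"

text \<open>
  A 2-form on a surface is a family of local expressions, one for each chart.
  \<open>pulls_back M \<omega> f S M' \<omega>'\<close> says \<open>\<omega> = f\<^sup>*\<omega>'\<close> on \<open>S\<close>; here \<open>T\<close> is the differential of \<open>f\<close>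
  in the charts. The differential is one relative to the set where the local expression of \<open>f\<close>
  is defined, which near a point of the boundary or a corner is not open, but still
  determines the differential uniquely.
\<close>

definition pulls_back ::
  "'a surface \<Rightarrow> ('a chart \<Rightarrow> form2) \<Rightarrow> ('a \<Rightarrow> 'b) \<Rightarrow> 'a set \<Rightarrow>
   'b surface \<Rightarrow> ('b chart \<Rightarrow> form2) \<Rightarrow> bool" where
  "pulls_back M \<omega> f S M' \<omega>' \<longleftrightarrow>
     (\<forall>(D, \<phi>)\<in>atlas M. \<forall>(D', \<phi>')\<in>atlas M'. \<forall>p\<in>D \<inter> S. f p \<in> D' \<longrightarrow>
        (\<exists>T. ((\<phi>' \<circ> f \<circ> inv_into D \<phi>) has_derivative T)
               (at (\<phi> p) within \<phi> ` {q \<in> D \<inter> S. f q \<in> D'}) \<and>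
             (\<forall>v w. \<omega> (D, \<phi>) (\<phi> p) v w = \<omega>' (D', \<phi>') (\<phi>' (f p)) (T v) (T w))))"

text \<open>
  A Kaehler form over \<open>S\<close>: its local expressions extend to Kaehler forms near the part of the
  chart image lying over \<open>S\<close> (as usual for smooth objects on domains with corners), and they
  are compatible under change of charts. If \<open>S\<close> is open and \<open>M\<close> has no boundary, the first
  clause just says that they are Kaehler forms on open sets.
\<close>

definition kahler_form_on :: "'a surface \<Rightarrow> 'a set \<Rightarrow> ('a chart \<Rightarrow> form2) \<Rightarrow> bool" where
  "kahler_form_on M S \<omega> \<longleftrightarrow>
     (\<forall>(D, \<phi>)\<in>atlas M. \<exists>Q \<eta>. open Q \<and> \<phi> ` (D \<inter> S) \<subseteq> Q \<and> kahler_on Q \<eta> \<and>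
        (\<forall>z\<in>\<phi> ` (D \<inter> S). \<eta> z = \<omega> (D, \<phi>) z)) \<and>
     pulls_back M \<omega> id S M \<omega>"

definition kahler_form :: "'a surface \<Rightarrow> ('a chart \<Rightarrow> form2) \<Rightarrow> bool" where
  "kahler_form M \<omega> \<longleftrightarrow> kahler_form_on M (topspace (surf_top M)) \<omega>"

text \<open>
  A surface \<open>W\<close> with boundary is a domain in a surface \<open>M\<close> without boundary, and a Kaehler
  form of \<open>W\<close> is understood accordingly, as a Kaehler form on a neighbourhood of \<open>W\<close> in \<open>M\<close>.
\<close>

definition kahler_domain :: "'a surface \<Rightarrow> 'a set \<Rightarrow> ('a chart \<Rightarrow> form2) \<Rightarrow> bool" where
  "kahler_domain M W \<omega> \<longleftrightarrow>
     (\<exists>N. openin (surf_top M) N \<and> W \<subseteq> N \<and> kahler_form_on M N \<omega>)"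


section \<open>Strongly pseudoconcave boundaries and transverse knots\<close>

abbreviation bdry :: "'a surface \<Rightarrow> 'a set \<Rightarrow> 'a set" where
  "bdry M W \<equiv> surf_top M frontier_of W"

text \<open>
  Since \<open>-\<partial>W\<close> is oriented as boundary of the sublevel \<open>{\<rho> \<le> 0}\<close>, the domain \<open>W\<close> lies
  on the side \<open>{\<rho> \<ge> 0}\<close>.
\<close>

definition strongly_pseudoconcave :: "'a surface \<Rightarrow> 'a set \<Rightarrow> bool" where
  "strongly_pseudoconcave M W \<longleftrightarrow>
     closedin (surf_top M) W \<and>
     (\<exists>N (\<rho> :: 'a \<Rightarrow> real).
        openin (surf_top M) N \<and> bdry M W \<subseteq> N \<and>
        {p \<in> N. \<rho> p = 0} = bdry M W \<and> {p \<in> N. \<rho> p \<ge> 0} = W \<inter> N \<and>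
        (\<forall>(D, \<phi>)\<in>atlas M.
           smooth_on (\<phi> ` (D \<inter> N)) (\<rho> \<circ> inv_into D \<phi>) \<and>
           (\<forall>z\<in>\<phi> ` (D \<inter> N). \<forall>v. v \<noteq> 0 \<longrightarrow> levi_form (\<rho> \<circ> inv_into D \<phi>) z v > 0) \<and>
           (\<forall>z\<in>\<phi> ` (D \<inter> bdry M W).
              \<exists>v. frechet_derivative (\<rho> \<circ> inv_into D \<phi>) (at z) v \<noteq> 0)))"

text \<open>Velocities at \<open>z\<close> of smooth curves in \<open>S\<close>; the tangent space if \<open>S\<close> is a submanifold.\<close>

definition tangent_vectors :: "complex2 set \<Rightarrow> complex2 \<Rightarrow> complex2 set" where
  "tangent_vectors S z =
     {v. \<exists>\<gamma> \<epsilon>. (0::real) < \<epsilon> \<and> smooth_on {-\<epsilon><..<\<epsilon>} \<gamma> \<and> \<gamma> ` {-\<epsilon><..<\<epsilon>} \<subseteq> S \<and>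
               \<gamma> 0 = z \<and> (\<gamma> has_vector_derivative v) (at 0)}"

definition contact_plane :: "'a surface \<Rightarrow> 'a set \<Rightarrow> 'a chart \<Rightarrow> 'a \<Rightarrow> complex2 set" where
  "contact_plane M W c p =
     (let T = tangent_vectors (snd c ` (fst c \<inter> bdry M W)) (snd c p) in T \<inter> J ` T)"

text \<open>As \<open>0\<close> lies in the contact plane, the last clause makes \<open>\<gamma>\<close> an immersion.\<close>

definition transverse_knot :: "'a surface \<Rightarrow> 'a set \<Rightarrow> 'a set \<Rightarrow> bool" where
  "transverse_knot M W L \<longleftrightarrow>
     (\<exists>\<gamma> :: real \<Rightarrow> 'a.
        range \<gamma> = L \<and> L \<subseteq> bdry M W \<and>
        (\<forall>t. \<gamma> (t + 2 * pi) = \<gamma> t) \<and> inj_on \<gamma> {0..<2 * pi} \<and>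
        (\<forall>(D, \<phi>)\<in>atlas M.
           open {t. \<gamma> t \<in> D} \<and> smooth_on {t. \<gamma> t \<in> D} (\<phi> \<circ> \<gamma>) \<and>
           (\<forall>t. \<gamma> t \<in> D \<longrightarrow>
              vector_derivative (\<phi> \<circ> \<gamma>) (at t) \<notin> contact_plane M W (D, \<phi>) (\<gamma> t))))"


section \<open>Attaching the standard concave handle\<close>

definition concave_handle :: "real \<Rightarrow> complex2 set" where
  "concave_handle a =
     {(z1, z2). cmod z2 \<le> exp ((cmod z1)\<^sup>2 / a - a) \<and> cmod z1 \<le> 1 + 1 / a}"

definition core :: "real \<Rightarrow> complex2 set" where
  "core a = {z \<in> concave_handle a. snd z = 0}"

definition attaching_region :: "real \<Rightarrow> complex2 set" where
  "attaching_region a = {z \<in> concave_handle a. 1 \<le> cmod (fst z) \<and> cmod (fst z) \<le> 1 + 1 / a}"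

definition attaching_circle :: "complex2 set" where
  "attaching_circle = {z. cmod (fst z) = 1 \<and> snd z = 0}"

text \<open>
  Attaching data along the transverse knot \<open>L\<close> in the boundary of \<open>W\<close>. The domain \<open>W1\<close> is
  obtained by pushing the boundary of \<open>W\<close> into \<open>W\<close>, and the transverse knot \<open>L1\<close> in the
  boundary of \<open>W1\<close> is the perturbation of \<open>L\<close> along which the handle is attached. Both changes
  take place inside the neighbourhood \<open>B\<close> of \<open>L\<close>, which is an arbitrary parameter.
  The last clause is transversality of the core to the boundary, read in the coordinates \<open>F\<close>:
  \<open>\<complex> \<times> 0\<close> and the tangent space of the boundary span \<open>\<complex>\<^sup>2\<close>.
\<close>

definition holomorphic_attaching ::
  "'a surface \<Rightarrow> 'a set \<Rightarrow> 'a set \<Rightarrow> 'a set \<Rightarrow> 'a set \<Rightarrow> 'a set \<Rightarrow>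
   complex2 set \<Rightarrow> 'a set \<Rightarrow> (complex2 \<Rightarrow> 'a) \<Rightarrow> bool" where
  "holomorphic_attaching M W L B W1 L1 U V F \<longleftrightarrow>
     transverse_knot M W L \<and> openin (surf_top M) B \<and> L \<subseteq> B \<and>
     strongly_pseudoconcave M W1 \<and> W1 \<subseteq> W \<and> W - W1 \<subseteq> B \<and>
     transverse_knot M W1 L1 \<and> L1 \<subseteq> B \<and>
     biholomorphic M U V F \<and>
     (\<forall>\<^sub>F a in at_top. attaching_region a \<subseteq> U) \<and>
     (\<exists>\<epsilon>>0. \<forall>z t. cmod z = 1 \<and> \<bar>t\<bar> < \<epsilon> \<longrightarrow>
        (z, complex_of_real t) \<in> U \<and> F (z, complex_of_real t) \<in> bdry M W1) \<and>
     F ` attaching_circle = L1 \<and>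
     (\<forall>\<^sub>F a in at_top. F ` {z \<in> core a. 1 < cmod (fst z)} \<subseteq> surf_top M interior_of W1) \<and>
     (\<forall>z\<in>attaching_circle. \<forall>x. \<exists>v :: complex.
        x - (v, 0) \<in> tangent_vectors {y \<in> U. F y \<in> bdry M W1} z)"

text \<open>
  The boundary of \<open>W1\<close> need not be the hypersurface \<open>|z\<^sub>1| = 1\<close> in the coordinates \<open>F\<close>, so
  points of the handle with \<open>|z\<^sub>1|\<close> slightly below \<open>1\<close> may have to be identified as well.
  On the handle the deviation is at most of the order of \<open>e\<^sup>-\<^sup>a\<close>, so for large \<open>a\<close> the cut-off
  \<open>1 - 1/a\<close> captures exactly these points (and a slightly different cut-off would not matter).
\<close>

definition near_attaching :: "real \<Rightarrow> complex2 set \<Rightarrow> complex2 set" where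
  "near_attaching a U = {x \<in> U. 1 - 1 / a < cmod (fst x)}"

definition glue_locus :: "'a set \<Rightarrow> complex2 set \<Rightarrow> (complex2 \<Rightarrow> 'a) \<Rightarrow> real \<Rightarrow> complex2 set" where
  "glue_locus W U F a = {x \<in> concave_handle a \<inter> near_attaching a U. F x \<in> W}"

text \<open>
  Quotient map from the handle to the glued space. The quotient is represented in the disjoint
  sum by \<open>W\<close> together with the points of the handle that are not identified with points of \<open>W\<close>.
\<close>

definition handle_proj ::
  "'a set \<Rightarrow> complex2 set \<Rightarrow> (complex2 \<Rightarrow> 'a) \<Rightarrow> real \<Rightarrow> complex2 \<Rightarrow> 'a + complex2" where
  "handle_proj W U F a x = (if x \<in> glue_locus W U F a then Inl (F x) else Inr x)"

definition glued_carrier ::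
  "'a set \<Rightarrow> complex2 set \<Rightarrow> (complex2 \<Rightarrow> 'a) \<Rightarrow> real \<Rightarrow> ('a + complex2) set" where
  "glued_carrier W U F a = Inl ` W \<union> handle_proj W U F a ` concave_handle a"

definition glued_open ::
  "'a topology \<Rightarrow> 'a set \<Rightarrow> complex2 set \<Rightarrow> (complex2 \<Rightarrow> 'a) \<Rightarrow> real \<Rightarrow> ('a + complex2) set \<Rightarrow> bool" where
  "glued_open X W U F a S \<longleftrightarrow>
     S \<subseteq> glued_carrier W U F a \<and>
     openin (subtopology X W) {w \<in> topspace (subtopology X W). Inl w \<in> S} \<and>
     openin (top_of_set (concave_handle a)) {x \<in> concave_handle a. handle_proj W U F a x \<in> S}"

lemma istopology_glued_open: "istopology (glued_open X W U F a)"
proof -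
  have int: "{x \<in> A. g x \<in> S \<inter> T} = {x \<in> A. g x \<in> S} \<inter> {x \<in> A. g x \<in> T}"
    for A :: "'x set" and g :: "'x \<Rightarrow> 'y" and S T by blast
  have un: "{x \<in> A. g x \<in> \<Union>K} = (\<Union>S\<in>K. {x \<in> A. g x \<in> S})"
    for A :: "'x set" and g :: "'x \<Rightarrow> 'y" and K by blast
  show ?thesis
    unfolding istopology_def glued_open_def int un
    by (intro conjI allI impI openin_Int openin_Union) blast+
qed

text \<open>
  The charts of \<open>W \<union>\<^sub>F H\<^sub>a\<close>: the charts of \<open>W\<close> off the handle, and one chart which is the
  inclusion on the handle and the inverse of \<open>F\<close> on the part of \<open>W\<close> near the attaching region.
\<close>

definition handle_chart ::
  "'a set \<Rightarrow> complex2 set \<Rightarrow> (complex2 \<Rightarrow> 'a) \<Rightarrow> real \<Rightarrow> ('a + complex2) chart" where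
  "handle_chart W U F a =
     (Inl ` (W \<inter> F ` near_attaching a U) \<union> handle_proj W U F a ` concave_handle a,
      case_sum (inv_into U F) id)"

definition attach_handle ::
  "'a surface \<Rightarrow> 'a set \<Rightarrow> complex2 set \<Rightarrow> (complex2 \<Rightarrow> 'a) \<Rightarrow> real \<Rightarrow> ('a + complex2) surface" where
  "attach_handle M W U F a =
     \<lparr>surf_top = topology (glued_open (surf_top M) W U F a),
      atlas = insert (handle_chart W U F a)
        ((\<lambda>(D, \<phi>). (Inl ` (D \<inter> W - F ` glue_locus W U F a), \<phi> \<circ> projl)) ` atlas M)\<rparr>"

lemma topspace_attach_handle:
  assumes "W \<subseteq> topspace (surf_top M)"
  shows "topspace (surf_top (attach_handle M W U F a)) = glued_carrier W U F a"
proof -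
  let ?X = "surf_top M" and ?C = "glued_carrier W U F a"
  have W: "topspace (subtopology ?X W) = W"
    using assms by auto
  have "{w \<in> W. Inl w \<in> ?C} = W"
    by (auto simp: glued_carrier_def)
  moreover have "{x \<in> concave_handle a. handle_proj W U F a x \<in> ?C} = concave_handle a"
    by (auto simp: glued_carrier_def)
  ultimately have "glued_open ?X W U F a ?C"
    unfolding glued_open_def W by (metis W openin_topspace openin_subtopology_self subset_refl)
  moreover have "S \<subseteq> ?C" if "glued_open ?X W U F a S" for S
    using that by (simp add: glued_open_def)
  ultimately show ?thesis
    unfolding attach_handle_def topspace_def
    by (auto simp: topology_inverse'[OF istopology_glued_open])
qed

end

theory Submission
  imports Defs "HOL-Complex_Analysis.Cauchy_Integral_Formula"
begin

text \<open>
  Near the attaching circle the pulled back Kaehler form lives on a product of an annulus and a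
  small disk. There it is \<open>dx\<^sub>2 \<and> dy\<^sub>2 + dd\<^sup>cf + d\<kappa> + c dx\<^sub>1 \<and> dy\<^sub>1\<close>: a function \<open>f\<close> solving a Poisson
  equation in \<open>z\<^sub>2\<close> removes the \<open>dx\<^sub>2 \<and> dy\<^sub>2\<close> component, after which the mixed component is
  antiholomorphic in \<open>z\<^sub>2\<close> and so comes from a 1-form \<open>\<kappa> = a dx\<^sub>1 + b dy\<^sub>1\<close> with \<open>d\<kappa>\<close> of type \<open>(1,1)\<close>;
  closedness makes the remaining \<open>c\<close> a function of \<open>z\<^sub>1\<close>. Multiplying \<open>f\<close>, \<open>\<kappa>\<close> and \<open>c\<close> by a cutoff
  function of \<open>z\<^sub>1\<close> keeps the form closed and of type \<open>(1,1)\<close>, extends it over the disk, and leaves the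
  \<open>dx\<^sub>2 \<and> dy\<^sub>2\<close> component positive. Adding \<open>K h(z\<^sub>1) dx\<^sub>1 \<and> dy\<^sub>1\<close> with \<open>h \<ge> 0\<close> supported inside the unit
  circle and \<open>K\<close> large restores positivity. For large \<open>a\<close> the handle is so thin that it lies in the
  domain of this extension.
\<close>


section \<open>Smooth functions\<close>

text \<open>A potential on the whole product would serve as well, but it asks for the dbar equation
  in both variables. Equations in \<open>z\<^sub>2\<close> alone live on a disk and are solved by
  explicit integrals with \<open>z\<^sub>1\<close> as a smooth parameter, whatever the topology in
  \<open>z\<^sub>1\<close>; the price is the extra terms \<kappa> and \<open>c\<close>. Splitting
  off \<open>dx\<^sub>2 \<and> dy\<^sub>2\<close> lets the cutoff \<open>X\<close> turn the
  coefficient \<open>D\<close> into \<open>1 - X + X D\<close>, a convex combination of positive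
  numbers. The other coefficients pick up derivatives of \<open>X\<close> and may be large, but
  positivity means \<open>D > 0\<close> and \<open>P\<^sup>2 + Q\<^sup>2 < A D\<close>, so enlarging
  \<open>A\<close> is enough; this is free, since a function of \<open>z\<^sub>1\<close> times
  \<open>dx\<^sub>1 \<and> dy\<^sub>1\<close> is closed and of type (1,1). The constant
  \<open>K\<close> is found on a fixed compact product, before \<open>a\<close> is chosen. A
  separate obstacle is regularity: \<open>holomorphic2_on\<close> only grants complex
  differentiability at points, so smoothness of the pulled back form has to come from Cauchy's
  formula.\<close>

lemma Ck_on_SucI:
  "(\<And>x. x \<in> S \<Longrightarrow> (f has_derivative f' x) (at x)) \<Longrightarrow> (\<And>v. Ck_on k S (\<lambda>x. f' x v)) \<Longrightarrow> Ck_on (Suc k) S f"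
  by auto

lemma Ck_on_SucE:
  assumes "Ck_on (Suc k) S f"
  obtains f' where "\<And>x. x \<in> S \<Longrightarrow> (f has_derivative f' x) (at x)" "\<And>v. Ck_on k S (\<lambda>x. f' x v)"
  using assms by auto

lemma Ck_on_cong:
  assumes "open S" "Ck_on k S f" "\<And>x. x \<in> S \<Longrightarrow> f x = g x"
  shows "Ck_on k S g"
  using assms(2,3)
proof (induction k arbitrary: f g)
  case 0
  then show ?case by (auto cong: continuous_on_cong)
next
  case (Suc k)
  from Suc.prems obtain f' where f': "\<And>x. x \<in> S \<Longrightarrow> (f has_derivative f' x) (at x)"
    "\<And>v. Ck_on k S (\<lambda>x. f' x v)" by (elim Ck_on_SucE) blast
  have "(g has_derivative f' x) (at x)" if "x \<in> S" for x
    by (rule has_derivative_transform_within_open[OF f'(1)[OF that] assms(1) that Suc.prems(2)])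
  then show ?case using f'(2) by (rule Ck_on_SucI)
qed

lemma Ck_on_subset: "Ck_on k S f \<Longrightarrow> T \<subseteq> S \<Longrightarrow> Ck_on k T f"
proof (induction k arbitrary: f)
  case 0 then show ?case by (auto intro: continuous_on_subset)
next
  case (Suc k)
  from Suc.prems(1) obtain f' where f': "\<And>x. x \<in> S \<Longrightarrow> (f has_derivative f' x) (at x)"
    "\<And>v. Ck_on k S (\<lambda>x. f' x v)" by (elim Ck_on_SucE) blast
  show ?case
    by (rule Ck_on_SucI[where f' = f']) (use f' Suc.prems(2) Suc.IH in auto)
qed

lemma Ck_on_imp_continuous_on: "Ck_on k S f \<Longrightarrow> continuous_on S f"
proof (cases k)
  case (Suc l)
  assume "Ck_on k S f"
  then obtain f' where "\<And>x. x \<in> S \<Longrightarrow> (f has_derivative f' x) (at x)"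
    unfolding Suc by (elim Ck_on_SucE) blast
  then show ?thesis
    by (intro has_derivative_continuous_on) (rule has_derivative_at_withinI)
qed simp

lemma Ck_on_SucD: "Ck_on (Suc k) S f \<Longrightarrow> Ck_on k S f"
proof (induction k arbitrary: f)
  case 0 then show ?case using Ck_on_imp_continuous_on[OF 0] by simp
next
  case (Suc k)
  then obtain f' where f': "\<And>x. x \<in> S \<Longrightarrow> (f has_derivative f' x) (at x)"
    "\<And>v. Ck_on (Suc k) S (\<lambda>x. f' x v)" by (auto simp: Ck_on.simps(2)[of "Suc k"] simp del: Ck_on.simps)
  have "Ck_on k S (\<lambda>x. f' x v)" for v by (rule Suc.IH[OF f'(2)])
  with f'(1) show ?case by (rule Ck_on_SucI)
qed

text \<open>The derivative at a point is unique, so the existential in \<open>Ck_on\<close> can be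
  replaced by the canonical \<open>frechet_derivative\<close>. Derivatives found on different
  neighbourhoods then agree automatically, which is what makes smoothness a local property.\<close>

lemma Ck_on_Suc_iff:
  "Ck_on (Suc k) S f \<longleftrightarrow> (\<forall>x\<in>S. f differentiable at x) \<and> (\<forall>v. Ck_on k S (\<lambda>x. frechet_derivative f (at x) v))"
  if "open S"
proof
  assume "Ck_on (Suc k) S f"
  then obtain f' where f': "\<And>x. x \<in> S \<Longrightarrow> (f has_derivative f' x) (at x)"
    "\<And>v. Ck_on k S (\<lambda>x. f' x v)" by (elim Ck_on_SucE) blast
  have "f' x = frechet_derivative f (at x)" if "x \<in> S" for x
    using f'(1)[OF that] by (rule frechet_derivative_at)
  then have "Ck_on k S (\<lambda>x. frechet_derivative f (at x) v)" for v
    by (intro Ck_on_cong[OF \<open>open S\<close> f'(2)[of v]]) simp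
  then show "(\<forall>x\<in>S. f differentiable at x) \<and> (\<forall>v. Ck_on k S (\<lambda>x. frechet_derivative f (at x) v))"
    using f'(1) unfolding differentiable_def by blast
next
  assume "(\<forall>x\<in>S. f differentiable at x) \<and> (\<forall>v. Ck_on k S (\<lambda>x. frechet_derivative f (at x) v))"
  then show "Ck_on (Suc k) S f"
    using frechet_derivative_works by (intro Ck_on_SucI[where f' = "\<lambda>x. frechet_derivative f (at x)"]) blast+
qed

lemma Ck_on_local:
  assumes "\<And>x. x \<in> S \<Longrightarrow> \<exists>T. open T \<and> x \<in> T \<and> Ck_on k T f"
  shows "Ck_on k S f"
  using assms
proof (induction k arbitrary: f)
  case 0
  have "isCont f x" if "x \<in> S" for x
    using 0[OF that] by (auto simp: continuous_on_eq_continuous_at)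
  then show ?case by (simp add: continuous_at_imp_continuous_on)
next
  case (Suc k)
  have 1: "\<exists>T. open T \<and> x \<in> T \<and> (\<forall>y\<in>T. f differentiable at y) \<and>
    (\<forall>v. Ck_on k T (\<lambda>x. frechet_derivative f (at x) v))" if x: "x \<in> S" for x
    using Suc.prems[OF x] Ck_on_Suc_iff by blast
  have "Ck_on k S (\<lambda>x. frechet_derivative f (at x) v)" for v
    by (rule Suc.IH) (use 1 in blast)
  moreover have "(f has_derivative frechet_derivative f (at x)) (at x)" if "x \<in> S" for x
    using 1[OF that] frechet_derivative_works by blast
  ultimately show ?case by (rule Ck_on_SucI[rotated])
qed

lemma Ck_on_const [simp]: "Ck_on k S (\<lambda>x. c)"
proof (induction k arbitrary: c)
  case (Suc k)
  show ?case by (rule Ck_on_SucI[where f' = "\<lambda>_ _. 0"]) (use Suc in auto)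
qed simp

lemma Ck_on_bounded_linear:
  assumes "bounded_linear f"
  shows "Ck_on k S f"
proof (cases k)
  case 0
  then show ?thesis using assms by (simp add: linear_continuous_on)
next
  case (Suc l)
  show ?thesis unfolding Suc
    by (rule Ck_on_SucI[where f' = "\<lambda>_. f"]) (use assms bounded_linear_imp_has_derivative in auto)
qed

lemma Ck_on_compose_linear:
  assumes "bounded_linear L" "Ck_on k S f"
  shows "Ck_on k S (\<lambda>x. L (f x))"
  using assms(2)
proof (induction k arbitrary: f)
  case 0 then show ?case using assms(1)
    by (auto intro: continuous_on_compose2[OF linear_continuous_on[OF assms(1), of UNIV]])
next
  case (Suc k)
  then obtain f' where f': "\<And>x. x \<in> S \<Longrightarrow> (f has_derivative f' x) (at x)"
    "\<And>v. Ck_on k S (\<lambda>x. f' x v)" by (elim Ck_on_SucE) blast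
  have "((\<lambda>x. L (f x)) has_derivative (\<lambda>v. L (f' x v))) (at x)" if "x \<in> S" for x
    using bounded_linear.has_derivative[OF assms(1) f'(1)[OF that]] .
  moreover have "Ck_on k S (\<lambda>x. L (f' x v))" for v by (rule Suc.IH[OF f'(2)])
  ultimately show ?case by (rule Ck_on_SucI)
qed

lemma Ck_on_add:
  assumes "Ck_on k S f" "Ck_on k S g"
  shows "Ck_on k S (\<lambda>x. f x + g x)"
  using assms
proof (induction k arbitrary: f g)
  case 0 then show ?case by (auto intro: continuous_on_add)
next
  case (Suc k)
  from Suc.prems(1) obtain f' where f': "\<And>x. x \<in> S \<Longrightarrow> (f has_derivative f' x) (at x)"
    "\<And>v. Ck_on k S (\<lambda>x. f' x v)" by (elim Ck_on_SucE) blast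
  from Suc.prems(2) obtain g' where g': "\<And>x. x \<in> S \<Longrightarrow> (g has_derivative g' x) (at x)"
    "\<And>v. Ck_on k S (\<lambda>x. g' x v)" by (elim Ck_on_SucE) blast
  have "((\<lambda>x. f x + g x) has_derivative (\<lambda>v. f' x v + g' x v)) (at x)" if "x \<in> S" for x
    using has_derivative_add[OF f'(1)[OF that] g'(1)[OF that]] .
  moreover have "Ck_on k S (\<lambda>x. f' x v + g' x v)" for v by (rule Suc.IH[OF f'(2) g'(2)])
  ultimately show ?case by (rule Ck_on_SucI)
qed

lemma Ck_on_sum:
  assumes "\<And>i. i \<in> I \<Longrightarrow> Ck_on k S (f i)"
  shows "Ck_on k S (\<lambda>x. \<Sum>i\<in>I. f i x)"
  using assms by (induction I rule: infinite_finite_induct) (auto intro!: Ck_on_add)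

lemma Ck_on_bilinear:
  assumes B: "bounded_bilinear B" and "Ck_on k S f" "Ck_on k S g"
  shows "Ck_on k S (\<lambda>x. B (f x) (g x))"
  using assms(2,3)
proof (induction k arbitrary: f g)
  case 0 then show ?case using B by (auto intro: bounded_bilinear.continuous_on)
next
  case (Suc k)
  from Suc.prems(1) obtain f' where f': "\<And>x. x \<in> S \<Longrightarrow> (f has_derivative f' x) (at x)"
    "\<And>v. Ck_on k S (\<lambda>x. f' x v)" by (elim Ck_on_SucE) blast
  from Suc.prems(2) obtain g' where g': "\<And>x. x \<in> S \<Longrightarrow> (g has_derivative g' x) (at x)"
    "\<And>v. Ck_on k S (\<lambda>x. g' x v)" by (elim Ck_on_SucE) blast
  have "((\<lambda>x. B (f x) (g x)) has_derivative (\<lambda>v. B (f x) (g' x v) + B (f' x v) (g x))) (at x)"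
    if "x \<in> S" for x
    using bounded_bilinear.FDERIV[OF B f'(1)[OF that] g'(1)[OF that]] .
  moreover have "Ck_on k S (\<lambda>x. B (f x) (g' x v) + B (f' x v) (g x))" for v
    using Suc.prems f' g' by (intro Ck_on_add Suc.IH) (auto intro: Ck_on_SucD simp del: Ck_on.simps)
  ultimately show ?case by (rule Ck_on_SucI)
qed

lemma Ck_on_compose:
  fixes f :: "'a::real_normed_vector \<Rightarrow> 'b::euclidean_space"
  assumes "Ck_on k T g" "Ck_on k S f" "f ` S \<subseteq> T"
  shows "Ck_on k S (\<lambda>x. g (f x))"
  using assms
proof (induction k arbitrary: f g)
  case 0 then show ?case by (auto intro: continuous_on_compose2)
next
  case (Suc k)
  from Suc.prems(2) obtain f' where f': "\<And>x. x \<in> S \<Longrightarrow> (f has_derivative f' x) (at x)"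
    "\<And>v. Ck_on k S (\<lambda>x. f' x v)" by (elim Ck_on_SucE) blast
  from Suc.prems(1) obtain g' where g': "\<And>x. x \<in> T \<Longrightarrow> (g has_derivative g' x) (at x)"
    "\<And>v. Ck_on k T (\<lambda>x. g' x v)" by (elim Ck_on_SucE) blast
  \<comment> \<open>\<open>Ck_on\<close> controls \<open>g'\<close> only in directions that do not
    depend on the point, whereas the chain rule applies it to \<open>f' x v\<close>. Expanding that
    vector in \<open>Basis\<close> leaves fixed directions with varying scalar factors.\<close>
  let ?d = "\<lambda>x v. \<Sum>b\<in>Basis. (f' x v \<bullet> b) *\<^sub>R g' (f x) b"
  have "((\<lambda>x. g (f x)) has_derivative ?d x) (at x)" if x: "x \<in> S" for x
  proof -
    have fx: "f x \<in> T" using Suc.prems(3) x by auto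
    have lin: "linear (g' (f x))" using g'(1)[OF fx] has_derivative_linear by blast
    have "g' (f x) (f' x v) = ?d x v" for v
    proof -
      have "g' (f x) (f' x v) = g' (f x) (\<Sum>b\<in>Basis. (f' x v \<bullet> b) *\<^sub>R b)"
        by (simp add: euclidean_representation)
      also have "\<dots> = ?d x v" using lin by (simp add: linear_sum linear_cmul)
      finally show ?thesis .
    qed
    then show ?thesis
      using has_derivative_compose[OF f'(1)[OF x] g'(1)[OF fx]] by simp
  qed
  moreover have "Ck_on k S (\<lambda>x. ?d x v)" for v
  proof (intro Ck_on_sum Ck_on_bilinear[OF bounded_bilinear_scaleR])
    show "Ck_on k S (\<lambda>x. f' x v \<bullet> b)" for b
      by (rule Ck_on_compose_linear[OF bounded_linear_inner_left f'(2)])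
    show "Ck_on k S (\<lambda>x. g' (f x) b)" for b
      using Suc.prems by (intro Suc.IH g'(2)) (auto dest: Ck_on_SucD[of k S f] simp del: Ck_on.simps)
  qed
  ultimately show ?case by (rule Ck_on_SucI)
qed

named_theorems smooth_intros

lemma smooth_on_cong: "open S \<Longrightarrow> smooth_on S f \<Longrightarrow> (\<And>x. x \<in> S \<Longrightarrow> f x = g x) \<Longrightarrow> smooth_on S g"
  unfolding smooth_on_def using Ck_on_cong by blast

lemma smooth_on_subset: "smooth_on S f \<Longrightarrow> T \<subseteq> S \<Longrightarrow> smooth_on T f"
  unfolding smooth_on_def using Ck_on_subset by blast

lemma smooth_on_local:
  "(\<And>x. x \<in> S \<Longrightarrow> \<exists>T. open T \<and> x \<in> T \<and> smooth_on T f) \<Longrightarrow> smooth_on S f"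
  unfolding smooth_on_def by (meson Ck_on_local)

lemma smooth_on_imp_continuous_on: "smooth_on S f \<Longrightarrow> continuous_on S f"
  unfolding smooth_on_def using Ck_on_imp_continuous_on by blast

lemma smooth_on_const [smooth_intros]: "smooth_on S (\<lambda>x. c)"
  by (simp add: smooth_on_def)

lemma smooth_on_bounded_linear: "bounded_linear f \<Longrightarrow> smooth_on S f"
  by (simp add: smooth_on_def Ck_on_bounded_linear)

lemmas smooth_on_id [smooth_intros] = smooth_on_bounded_linear[OF bounded_linear_ident]

lemma smooth_on_compose_linear:
  "bounded_linear L \<Longrightarrow> smooth_on S f \<Longrightarrow> smooth_on S (\<lambda>x. L (f x))"
  by (simp add: smooth_on_def Ck_on_compose_linear)

lemmas smooth_on_fst [smooth_intros] = smooth_on_compose_linear[OF bounded_linear_fst]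
lemmas smooth_on_snd [smooth_intros] = smooth_on_compose_linear[OF bounded_linear_snd]
lemmas smooth_on_Re [smooth_intros] = smooth_on_compose_linear[OF bounded_linear_Re]
lemmas smooth_on_Im [smooth_intros] = smooth_on_compose_linear[OF bounded_linear_Im]
lemmas smooth_on_cnj [smooth_intros] = smooth_on_compose_linear[OF bounded_linear_cnj]
lemmas smooth_on_of_real [smooth_intros] = smooth_on_compose_linear[OF bounded_linear_of_real]
lemmas smooth_on_minus [smooth_intros] =
  smooth_on_compose_linear[OF bounded_linear_minus[OF bounded_linear_ident]]

lemma smooth_on_add [smooth_intros]:
  "smooth_on S f \<Longrightarrow> smooth_on S g \<Longrightarrow> smooth_on S (\<lambda>x. f x + g x)"
  by (simp add: smooth_on_def Ck_on_add)

lemma smooth_on_diff [smooth_intros]: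
  "smooth_on S f \<Longrightarrow> smooth_on S g \<Longrightarrow> smooth_on S (\<lambda>x. f x - g x)"
  using smooth_on_add[OF _ smooth_on_minus] by fastforce

lemma smooth_on_bilinear:
  "bounded_bilinear B \<Longrightarrow> smooth_on S f \<Longrightarrow> smooth_on S g \<Longrightarrow> smooth_on S (\<lambda>x. B (f x) (g x))"
  by (simp add: smooth_on_def Ck_on_bilinear)

lemmas smooth_on_mult [smooth_intros] = smooth_on_bilinear[OF bounded_bilinear_mult]

lemma smooth_on_compose:
  fixes f :: "'a::real_normed_vector \<Rightarrow> 'b::euclidean_space"
  shows "smooth_on T g \<Longrightarrow> smooth_on S f \<Longrightarrow> f ` S \<subseteq> T \<Longrightarrow> smooth_on S (\<lambda>x. g (f x))"
  unfolding smooth_on_def using Ck_on_compose by blast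

lemma smooth_on_Pair [smooth_intros]:
  assumes "smooth_on S f" "smooth_on S g"
  shows "smooth_on S (\<lambda>x. (f x, g x))"
proof -
  have "smooth_on S (\<lambda>x. (f x, 0) + (0, g x))"
    by (intro smooth_on_add smooth_on_compose_linear[OF _ assms(1)] smooth_on_compose_linear[OF _ assms(2)]
        bounded_linear_Pair bounded_linear_ident bounded_linear_zero)
  then show ?thesis by simp
qed

lemma smooth_on_frechet_derivative:
  "open S \<Longrightarrow> smooth_on S f \<Longrightarrow> smooth_on S (\<lambda>x. frechet_derivative f (at x) v)"
  unfolding smooth_on_def using Ck_on_Suc_iff by blast

lemma smooth_on_has_derivative:
  assumes "open S" "smooth_on S f" "x \<in> S"
  shows "(f has_derivative frechet_derivative f (at x)) (at x)"
proof -
  have "Ck_on (Suc 0) S f" using assms(2) by (simp only: smooth_on_def)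
  then show ?thesis
    using Ck_on_Suc_iff[OF assms(1)] assms(3) frechet_derivative_works by blast
qed

lemma smooth_on_cis [smooth_intros]: "smooth_on S cis"
proof -
  have "Ck_on k S cis" for k
  proof (induction k)
    case 0 then show ?case by (simp add: continuous_on_cis)
  next
    case (Suc k)
    have "(cis has_derivative (\<lambda>v. v *\<^sub>R (\<i> * cis x))) (at x)" for x
      by (rule has_derivative_eq_rhs[OF has_derivative_cis[OF has_derivative_ident]]) (simp add: fun_eq_iff scaleR_conv_of_real)
    moreover have "Ck_on k S (\<lambda>x. v *\<^sub>R (\<i> * cis x))" for v
      by (intro Ck_on_compose_linear[OF bounded_linear_compose[OF bounded_linear_scaleR_right bounded_linear_mult_right] Suc])
    ultimately show ?case by (intro Ck_on_SucI) auto
  qed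
  then show ?thesis by (simp add: smooth_on_def)
qed

lemma smooth_on_inverse:
  fixes f :: "'a::real_normed_vector \<Rightarrow> real"
  assumes "smooth_on S f" "\<And>x. x \<in> S \<Longrightarrow> f x \<noteq> 0"
  shows "smooth_on S (\<lambda>x. inverse (f x))"
proof (rule smooth_on_compose[OF _ assms(1), where T = "- {0}"])
  have "Ck_on k (- {0}) (inverse :: real \<Rightarrow> real)" for k
  proof (induction k)
    case 0 then show ?case by (auto intro!: continuous_on_inverse continuous_on_id)
  next
    case (Suc k)
    show ?case
    proof (rule Ck_on_SucI)
      show "(inverse has_derivative (\<lambda>v. - (inverse x * v * inverse x))) (at x)" if "x \<in> - {0}" for x :: real
        using has_derivative_inverse'[of x UNIV] that by auto
      show "Ck_on k (- {0}) (\<lambda>x. - (inverse x * v * inverse x))" for v :: real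
        by (intro Ck_on_compose_linear[OF bounded_linear_minus[OF bounded_linear_ident]]
          Ck_on_bilinear[OF bounded_bilinear_mult] Suc Ck_on_const)
    qed
  qed
  then show "smooth_on (- {0}) (inverse :: real \<Rightarrow> real)" by (simp add: smooth_on_def)
qed (use assms(2) in auto)

lemma smooth_on_Un:
  "open S \<Longrightarrow> open T \<Longrightarrow> smooth_on S f \<Longrightarrow> smooth_on T f \<Longrightarrow> smooth_on (S \<union> T) f"
  by (rule smooth_on_local) blast

section \<open>Directional derivatives and their symmetry\<close>

definition pd :: "'a::real_normed_vector \<Rightarrow> ('a \<Rightarrow> 'b::real_normed_vector) \<Rightarrow> 'a \<Rightarrow> 'b" where
  "pd v f = (\<lambda>z. frechet_derivative f (at z) v)"

lemma pd_eqI: "(f has_derivative f') (at z) \<Longrightarrow> pd v f z = f' v"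
  unfolding pd_def using frechet_derivative_at by metis

lemma has_derivative_pd:
  "open S \<Longrightarrow> smooth_on S f \<Longrightarrow> z \<in> S \<Longrightarrow> (f has_derivative (\<lambda>v. pd v f z)) (at z)"
  unfolding pd_def using smooth_on_has_derivative by blast

lemma smooth_on_pd [smooth_intros]: "open S \<Longrightarrow> smooth_on S f \<Longrightarrow> smooth_on S (pd v f)"
  unfolding pd_def by (rule smooth_on_frechet_derivative)

lemma pd_cong:
  assumes "open S" "z \<in> S" "\<And>x. x \<in> S \<Longrightarrow> f x = g x"
  shows "pd v f z = pd v g z"
proof -
  have "(f has_derivative f') (at z) \<longleftrightarrow> (g has_derivative f') (at z)" for f'
    using has_derivative_transform_within_open[OF _ assms(1,2), of f f' UNIV g]
      has_derivative_transform_within_open[OF _ assms(1,2), of g f' UNIV f] assms(3) by auto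
  then show ?thesis by (simp add: pd_def frechet_derivative_def)
qed

lemma pd_add:
  "open S \<Longrightarrow> smooth_on S f \<Longrightarrow> smooth_on S g \<Longrightarrow> z \<in> S \<Longrightarrow> pd v (\<lambda>x. f x + g x) z = pd v f z + pd v g z"
  by (rule pd_eqI, rule has_derivative_add; rule has_derivative_pd)

lemma pd_diff:
  "open S \<Longrightarrow> smooth_on S f \<Longrightarrow> smooth_on S g \<Longrightarrow> z \<in> S \<Longrightarrow> pd v (\<lambda>x. f x - g x) z = pd v f z - pd v g z"
  by (rule pd_eqI, rule has_derivative_diff; rule has_derivative_pd)

lemma pd_linear_image:
  assumes "bounded_linear L" "open S" "smooth_on S f" "z \<in> S"
  shows "pd v (\<lambda>x. L (f x)) z = L (pd v f z)"
  by (rule pd_eqI, rule bounded_linear.has_derivative[OF assms(1)], rule has_derivative_pd[OF assms(2-)])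

lemma pd_bilinear:
  assumes "bounded_bilinear B" "open S" "smooth_on S f" "smooth_on S g" "z \<in> S"
  shows "pd v (\<lambda>x. B (f x) (g x)) z = B (f z) (pd v g z) + B (pd v f z) (g z)"
  by (rule pd_eqI, rule bounded_bilinear.FDERIV[OF assms(1)]; rule has_derivative_pd) (use assms in auto)

lemmas pd_mult = pd_bilinear[OF bounded_bilinear_mult]
lemmas pd_uminus = pd_linear_image[OF bounded_linear_minus[OF bounded_linear_ident]]

lemma pd_const [simp]: "pd v (\<lambda>x. c) z = 0"
  by (rule pd_eqI) simp

lemma linear_pd: "open S \<Longrightarrow> smooth_on S f \<Longrightarrow> z \<in> S \<Longrightarrow> linear (\<lambda>v. pd v f z)"
  using has_derivative_pd has_derivative_linear by blast

lemma pd_along_line: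
  assumes "open S" "smooth_on S f" "c + s *\<^sub>R u \<in> S"
  shows "((\<lambda>s. f (c + s *\<^sub>R u)) has_vector_derivative pd u f (c + s *\<^sub>R u)) (at s within X)"
proof -
  have "((\<lambda>s. c + s *\<^sub>R u) has_derivative (\<lambda>t. t *\<^sub>R u)) (at s)"
    by (auto intro!: derivative_eq_intros)
  from has_derivative_compose[OF this has_derivative_pd[OF assms]]
  have "((\<lambda>s. f (c + s *\<^sub>R u)) has_derivative (\<lambda>t. t *\<^sub>R pd u f (c + s *\<^sub>R u))) (at s)"
    using linear_cmul[OF linear_pd[OF assms]] by simp
  then show ?thesis
    by (simp add: has_vector_derivative_def has_derivative_at_withinI)
qed

text \<open>The increment of \<open>f\<close> along \<open>v\<close> is the integral of
  \<open>pd v f\<close> over a segment. Differentiating it along \<open>u\<close> under the integral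
  sign, and then in the length of the segment, produces both iterated derivatives.\<close>

lemma pd_commute:
  fixes f :: "'a::real_normed_vector \<Rightarrow> 'b::banach"
  assumes S: "open S" and f: "smooth_on S f" and z: "z \<in> S"
  shows "pd u (pd v f) z = pd v (pd u f) z"
proof -
  obtain r where r: "r > 0" "ball z r \<subseteq> S" using S z openE by blast
  \<comment> \<open>Keeps the parallelogram with sides along \<open>u\<close> and \<open>v\<close>
    inside the ball; the summand 1 covers the case that both vectors vanish.\<close>
  define e where "e = r / (2 * (norm u + norm v + 1))"
  have e: "e > 0" using r by (simp add: e_def add_nonneg_pos)
  have in_S: "z + s *\<^sub>R u + t *\<^sub>R v \<in> S" if "\<bar>s\<bar> \<le> e" "\<bar>t\<bar> \<le> e" for s t
  proof -
    have "norm (s *\<^sub>R u + t *\<^sub>R v) \<le> \<bar>s\<bar> * norm u + \<bar>t\<bar> * norm v"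
      using norm_triangle_ineq[of "s *\<^sub>R u" "t *\<^sub>R v"] by simp
    also have "\<dots> \<le> e * norm u + e * norm v" using that by (intro add_mono mult_right_mono) auto
    also have "\<dots> \<le> e * (norm u + norm v + 1)" using e by (simp add: algebra_simps)
    also have "\<dots> = r / 2"
    proof -
      have "norm u + norm v + 1 \<noteq> 0" by (smt (verit) norm_ge_zero)
      then show ?thesis unfolding e_def by (simp del: distrib_left_numeral)
    qed
    also have "\<dots> < r" using r by simp
    finally have "z + s *\<^sub>R u + t *\<^sub>R v \<in> ball z r" by (simp add: dist_norm norm_minus_commute algebra_simps)
    then show ?thesis using r by blast
  qed
  have fv: "smooth_on S (pd v f)" and fu: "smooth_on S (pd u f)" and fuv: "smooth_on S (pd u (pd v f))"
    using S f by (auto intro: smooth_on_pd)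
  have in0: "z + t *\<^sub>R v \<in> S" if "\<bar>t\<bar> \<le> e" for t using in_S[of 0 t] that e by simp
  have int: "f (z + s *\<^sub>R u + t *\<^sub>R v) - f (z + s *\<^sub>R u)
     = integral (cbox 0 t) (\<lambda>y. pd v f (z + s *\<^sub>R u + y *\<^sub>R v))" if "\<bar>s\<bar> \<le> e" "0 \<le> t" "t \<le> e" for s t
  proof -
    have "((\<lambda>y. pd v f (z + s *\<^sub>R u + y *\<^sub>R v)) has_integral
        f (z + s *\<^sub>R u + t *\<^sub>R v) - f (z + s *\<^sub>R u + 0 *\<^sub>R v)) {0..t}"
      using that by (intro fundamental_theorem_of_calculus pd_along_line[OF S f] in_S) auto
    then show ?thesis by (simp add: integral_unique)
  qed
  have key: "pd u f (z + t *\<^sub>R v) - pd u f z = integral {0..t} (\<lambda>y. pd u (pd v f) (z + y *\<^sub>R v))"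
    if t: "0 \<le> t" "t \<le> e" for t
  proof -
    let ?U = "{-e<..<e}"
    have "((\<lambda>s. integral (cbox 0 t) (\<lambda>y. pd v f (z + s *\<^sub>R u + y *\<^sub>R v))) has_vector_derivative
        integral (cbox 0 t) (\<lambda>y. pd u (pd v f) (z + 0 *\<^sub>R u + y *\<^sub>R v))) (at 0 within ?U)"
    proof (rule leibniz_rule_vector_derivative)
      show "((\<lambda>s. pd v f (z + s *\<^sub>R u + y *\<^sub>R v)) has_vector_derivative
          pd u (pd v f) (z + s *\<^sub>R u + y *\<^sub>R v)) (at s within ?U)" if "s \<in> ?U" "y \<in> cbox 0 t" for s y
      proof -
        have "z + s *\<^sub>R u + y *\<^sub>R v \<in> S" using that t by (intro in_S) auto
        then show ?thesis
          using pd_along_line[OF S fv, of "z + y *\<^sub>R v" s u ?U] by (simp add: algebra_simps)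
      qed
      have cont: "continuous_on (?U \<times> cbox 0 t) (\<lambda>p. g (z + fst p *\<^sub>R u + snd p *\<^sub>R v))"
        if "smooth_on S g" for g :: "'a \<Rightarrow> 'b"
        by (rule continuous_on_compose2[OF smooth_on_imp_continuous_on[OF that]])
           (use in_S t in \<open>auto intro!: continuous_intros\<close>)
      show "continuous_on (?U \<times> cbox 0 t) (\<lambda>(s, y). pd u (pd v f) (z + s *\<^sub>R u + y *\<^sub>R v))"
        using cont[OF fuv] by (simp add: case_prod_beta)
      show "(\<lambda>y. pd v f (z + s *\<^sub>R u + y *\<^sub>R v)) integrable_on cbox 0 t" if "s \<in> ?U" for s
        by (intro integrable_continuous continuous_on_compose2[OF smooth_on_imp_continuous_on[OF fv]])
           (use in_S t that in \<open>auto intro!: continuous_intros\<close>)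
    qed (use e in auto)
    then have 1: "((\<lambda>s. integral (cbox 0 t) (\<lambda>y. pd v f (z + s *\<^sub>R u + y *\<^sub>R v))) has_vector_derivative
        integral {0..t} (\<lambda>y. pd u (pd v f) (z + y *\<^sub>R v))) (at 0)"
      using e at_within_open[of 0 ?U] by simp
    have 2: "((\<lambda>s. integral (cbox 0 t) (\<lambda>y. pd v f (z + s *\<^sub>R u + y *\<^sub>R v))) has_vector_derivative
        pd u f (z + t *\<^sub>R v) - pd u f z) (at 0)"
    proof (rule has_vector_derivative_transform_within_open)
      have "((\<lambda>s. f ((z + t *\<^sub>R v) + s *\<^sub>R u) - f (z + s *\<^sub>R u)) has_vector_derivative
          pd u f ((z + t *\<^sub>R v) + 0 *\<^sub>R u) - pd u f (z + 0 *\<^sub>R u)) (at 0)"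
        using in0[of t] z t by (intro has_vector_derivative_diff pd_along_line[OF S f]) auto
      then show "((\<lambda>s. f (z + s *\<^sub>R u + t *\<^sub>R v) - f (z + s *\<^sub>R u)) has_vector_derivative
          pd u f (z + t *\<^sub>R v) - pd u f z) (at 0)" by (simp add: algebra_simps)
      show "open ?U" "0 \<in> ?U" using e by auto
      show "f (z + s *\<^sub>R u + t *\<^sub>R v) - f (z + s *\<^sub>R u)
         = integral (cbox 0 t) (\<lambda>y. pd v f (z + s *\<^sub>R u + y *\<^sub>R v))" if "s \<in> ?U" for s
        using that t by (intro int) auto
    qed
    show ?thesis using vector_derivative_unique_at[OF 2 1] .
  qed
  \<comment> \<open>\<open>key\<close> is available for nonnegative \<open>t\<close> only, so both
    of its sides are differentiated at 0 within \<open>{0..e}\<close>.\<close>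
  have "((\<lambda>t. integral {0..t} (\<lambda>y. pd u (pd v f) (z + y *\<^sub>R v))) has_vector_derivative
      pd u (pd v f) (z + 0 *\<^sub>R v)) (at 0 within {0..e})"
    by (rule integral_has_vector_derivative)
       (use e in0 in \<open>auto intro!: continuous_on_compose2[OF smooth_on_imp_continuous_on[OF fuv]] continuous_intros\<close>)
  then have 1: "((\<lambda>t. pd u f (z + t *\<^sub>R v) - pd u f z) has_vector_derivative
      pd u (pd v f) (z + 0 *\<^sub>R v)) (at 0 within {0..e})"
    by (rule has_vector_derivative_transform[rotated 2]) (use e key in auto)
  have "((\<lambda>t. pd u f (z + t *\<^sub>R v) - pd u f z) has_vector_derivative
      pd v (pd u f) (z + 0 *\<^sub>R v) - 0) (at 0 within {0..e})"
    using z by (intro has_vector_derivative_diff pd_along_line[OF S fu] has_vector_derivative_const) auto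
  with 1 show ?thesis
    using vector_derivative_unique_within_closed_interval[of 0 e 0] e by fastforce
qed

section \<open>Integrals depending smoothly on a parameter\<close>

lemma Ck_on_one_has_derivative_integral:
  fixes H :: "'a::euclidean_space \<times> 'b::euclidean_space \<Rightarrow> 'c::banach"
  assumes "open S" "open G" and G: "S \<times> cbox a b \<subseteq> G" and H: "Ck_on (Suc 0) G H" and x: "x \<in> S"
  shows "((\<lambda>x. integral (cbox a b) (\<lambda>s. H (x, s))) has_derivative
    (\<lambda>v. integral (cbox a b) (\<lambda>s. pd (v, 0) H (x, s)))) (at x)"
proof -
  obtain r where r: "r > 0" "ball x r \<subseteq> S" using assms openE by blast
  let ?U = "ball x r"
  have G': "(y, s) \<in> G" if "y \<in> ?U" "s \<in> cbox a b" for y s using r G that by auto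
  \<comment> \<open>Only first derivatives of \<open>H\<close> and their continuity enter. The
    result can therefore be applied to the Cauchy integral of a map that is not yet known to be
    smooth.\<close>
  have der: "(H has_derivative (\<lambda>w. pd w H p)) (at p)" if "p \<in> G" for p
    using Ck_on_Suc_iff[OF \<open>open G\<close>, THEN iffD1, OF H] that
    unfolding pd_def frechet_derivative_works by simp
  have cont: "continuous_on G (pd w H)" for w
    using Ck_on_Suc_iff[OF \<open>open G\<close>, THEN iffD1, OF H] unfolding pd_def Ck_on.simps by blast
  \<comment> \<open>\<open>leibniz_rule\<close> takes the derivative as a continuous map into the
    bounded linear functions; in finite dimension its continuity can be checked on basis
    vectors.\<close>
  define H' where "H' y s = Blinfun (\<lambda>v. pd (v, 0) H (y, s))" for y s
  have dery: "((\<lambda>y. H (y, s)) has_derivative (\<lambda>v. pd (v, 0) H (y, s))) (at y)"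
    if "y \<in> ?U" "s \<in> cbox a b" for y s
  proof -
    have "((\<lambda>y. (y, s)) has_derivative (\<lambda>v. (v, 0))) (at y)"
      by (intro has_derivative_Pair has_derivative_ident has_derivative_const)
    from has_derivative_compose[OF this, of H "\<lambda>w. pd w H (y, s)"] der[OF G'[OF that]]
    show ?thesis by simp
  qed
  have H': "blinfun_apply (H' y s) = (\<lambda>v. pd (v, 0) H (y, s))" if "y \<in> ?U" "s \<in> cbox a b" for y s
    unfolding H'_def using has_derivative_bounded_linear[OF dery[OF that]]
    by (simp add: bounded_linear_Blinfun_apply)
  have cH': "continuous_on (?U \<times> cbox a b) (\<lambda>(y, s). H' y s)"
  proof (rule continuous_on_blinfun_componentwise)
    fix i :: 'a
    have "continuous_on (?U \<times> cbox a b) (\<lambda>p. pd (i, 0) H p)"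
      using G' by (intro continuous_on_subset[OF cont]) auto
    then show "continuous_on (?U \<times> cbox a b) (\<lambda>p. blinfun_apply (case p of (y, s) \<Rightarrow> H' y s) i)"
      by (rule continuous_on_eq) (auto simp: H')
  qed
  have "((\<lambda>x. integral (cbox a b) (\<lambda>s. H (x, s))) has_derivative integral (cbox a b) (H' x)) (at x within ?U)"
  proof (rule leibniz_rule[OF _ _ cH'])
    show "((\<lambda>y. H (y, s)) has_derivative blinfun_apply (H' y s)) (at y within ?U)"
      if "y \<in> ?U" "s \<in> cbox a b" for y s
      using dery[OF that] H'[OF that] by (simp add: has_derivative_at_withinI)
    show "(\<lambda>s. H (y, s)) integrable_on cbox a b" if "y \<in> ?U" for y
      using G' that
      by (intro integrable_continuous continuous_on_compose2[OF Ck_on_imp_continuous_on[OF H]] continuous_intros) auto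
  qed (use r in auto)
  moreover have "blinfun_apply (integral (cbox a b) (H' x)) = (\<lambda>v. integral (cbox a b) (\<lambda>s. pd (v, 0) H (x, s)))"
  proof
    fix v
    have "H' x integrable_on cbox a b"
    proof (intro integrable_continuous)
      have "continuous_on (cbox a b) (\<lambda>s. (\<lambda>(y, s). H' y s) (x, s))"
        by (rule continuous_on_compose2[OF cH']) (use r in \<open>auto intro!: continuous_on_Pair continuous_on_const continuous_on_id\<close>)
      then show "continuous_on (cbox a b) (H' x)" by simp
    qed
    then have "blinfun_apply (integral (cbox a b) (H' x)) v = integral (cbox a b) (\<lambda>s. H' x s v)"
      by (rule blinfun_apply_integral)
    also have "\<dots> = integral (cbox a b) (\<lambda>s. pd (v, 0) H (x, s))"
      using r by (intro integral_cong) (simp add: H')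
    finally show "blinfun_apply (integral (cbox a b) (H' x)) v = integral (cbox a b) (\<lambda>s. pd (v, 0) H (x, s))" .
  qed
  ultimately show ?thesis
    using r at_within_open[of x ?U] by simp
qed

lemma has_derivative_integral:
  fixes H :: "'a::euclidean_space \<times> 'b::euclidean_space \<Rightarrow> 'c::banach"
  assumes "open S" "open G" "S \<times> cbox a b \<subseteq> G" "smooth_on G H" "x \<in> S"
  shows "((\<lambda>x. integral (cbox a b) (\<lambda>s. H (x, s))) has_derivative
    (\<lambda>v. integral (cbox a b) (\<lambda>s. pd (v, 0) H (x, s)))) (at x)"
  using assms by (intro Ck_on_one_has_derivative_integral) (auto simp only: smooth_on_def intro: spec)

lemma smooth_on_integral:
  fixes H :: "'a::euclidean_space \<times> 'b::euclidean_space \<Rightarrow> 'c::banach"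
  assumes "open S" "open G" "S \<times> cbox a b \<subseteq> G" "smooth_on G H"
  shows "smooth_on S (\<lambda>x. integral (cbox a b) (\<lambda>s. H (x, s)))"
proof -
  have "Ck_on k S (\<lambda>x. integral (cbox a b) (\<lambda>s. H (x, s)))" for k
    using assms(4)
  proof (induction k arbitrary: H)
    case 0
    show ?case unfolding Ck_on.simps
      by (rule has_derivative_continuous_on, rule has_derivative_at_withinI,
          rule has_derivative_integral[OF assms(1-3) 0])
  next
    case (Suc k)
    show ?case
      by (rule Ck_on_SucI, rule has_derivative_integral[OF assms(1-3) Suc.prems], assumption)
         (intro Suc.IH smooth_on_pd assms Suc.prems)
  qed
  then show ?thesis by (simp add: smooth_on_def)
qed

section \<open>A smooth cutoff function\<close>

text \<open>The exponent \<open>n\<close> makes this a family closed under differentiation.\<close>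

definition flat :: "nat \<Rightarrow> real \<Rightarrow> real" where
  "flat n x = (if x > 0 then exp (- inverse x) * inverse x ^ n else 0)"

lemma flat_tendsto_0: "(flat n \<longlongrightarrow> 0) (at 0)"
proof -
  have "((\<lambda>x::real. x ^ n / exp x) \<longlongrightarrow> 0) at_top" by (rule tendsto_power_div_exp_0)
  then have "((\<lambda>x::real. inverse x ^ n / exp (inverse x)) \<longlongrightarrow> 0) (at_right 0)"
    using filterlim_compose filterlim_inverse_at_top_right by blast
  moreover have "\<forall>\<^sub>F x in at_right 0. inverse x ^ n / exp (inverse x) = flat n x"
    by (auto simp: eventually_at_right_field flat_def exp_minus divide_inverse intro!: exI[of _ 1])
  ultimately have "(flat n \<longlongrightarrow> 0) (at_right 0)"
    using tendsto_cong by fast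
  moreover have "\<forall>\<^sub>F x in at_left 0. 0 = flat n x"
    by (auto simp: eventually_at_left_field flat_def intro!: exI[of _ "-1"])
  then have "(flat n \<longlongrightarrow> 0) (at_left 0)"
    using tendsto_cong[of "\<lambda>_. 0" "flat n" "at_left 0" 0] by auto
  ultimately show ?thesis by (simp add: filterlim_split_at)
qed

lemma flat_has_derivative:
  "(flat n has_real_derivative flat (n + 2) x - real n * flat (n + 1) x) (at x)"
proof (cases x "0 :: real" rule: linorder_cases)
  case less
  have "((\<lambda>x. 0) has_real_derivative 0) (at x)" by simp
  then have "(flat n has_real_derivative 0) (at x)"
    by (rule has_field_derivative_transform_within_open[where S = "{..<0}"]) (use less in \<open>auto simp: flat_def\<close>)
  then show ?thesis using less by (simp add: flat_def)
next
  case equal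
  \<comment> \<open>The difference quotient at 0 is \<open>flat (n + 1)\<close> itself.\<close>
  have "((\<lambda>y. (flat n y - flat n 0) / (y - 0)) \<longlongrightarrow> 0) (at 0)"
    by (rule Lim_transform_eventually[OF flat_tendsto_0[of "n + 1"]])
       (auto simp: flat_def eventually_at_filter divide_inverse)
  then show ?thesis using equal by (simp add: has_field_derivative_iff flat_def)
next
  case greater
  have "((\<lambda>x. exp (- inverse x) * inverse x ^ n) has_real_derivative
      exp (- inverse x) * (inverse x)\<^sup>2 * inverse x ^ n
      + exp (- inverse x) * (real n * inverse x ^ (n - 1) * (- (inverse x)\<^sup>2))) (at x)"
    using greater by (auto intro!: derivative_eq_intros simp: power2_eq_square)
  then have "(flat n has_real_derivative
      exp (- inverse x) * (inverse x)\<^sup>2 * inverse x ^ n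
      + exp (- inverse x) * (real n * inverse x ^ (n - 1) * (- (inverse x)\<^sup>2))) (at x)"
    by (rule has_field_derivative_transform_within_open[where S = "{0<..}"]) (use greater in \<open>auto simp: flat_def\<close>)
  moreover have "exp (- inverse x) * (inverse x)\<^sup>2 * inverse x ^ n
      + exp (- inverse x) * (real n * inverse x ^ (n - 1) * (- (inverse x)\<^sup>2))
    = flat (n + 2) x - real n * flat (n + 1) x"
    using greater by (cases n) (auto simp: flat_def power2_eq_square)
  ultimately show ?thesis by simp
qed

lemma smooth_on_flat: "smooth_on S (flat n)"
proof -
  have "Ck_on k UNIV (flat n)" for k
  proof (induction k arbitrary: n)
    case 0
    then show ?case using DERIV_isCont[OF flat_has_derivative] by (simp add: continuous_at_imp_continuous_on)
  next
    case (Suc k)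
    show ?case
    proof (rule Ck_on_SucI)
      show "(flat n has_derivative (\<lambda>v. (flat (n + 2) x - real n * flat (n + 1) x) * v)) (at x)" for x
        using flat_has_derivative by (simp add: has_field_derivative_def)
      have "Ck_on k UNIV (\<lambda>x. v * flat (n + 2) x + (- (v * real n)) * flat (n + 1) x)" for v
        by (intro Ck_on_add Ck_on_bilinear[OF bounded_bilinear_mult] Ck_on_const Suc)
      then show "Ck_on k UNIV (\<lambda>x. (flat (n + 2) x - real n * flat (n + 1) x) * v)" for v
        by (simp add: algebra_simps)
    qed
  qed
  then have "smooth_on UNIV (flat n)" by (simp add: smooth_on_def)
  then show ?thesis by (rule smooth_on_subset) simp
qed

lemma smooth_cutoff_exists:
  fixes a b :: real
  assumes "a < b"
  obtains \<theta> :: "real \<Rightarrow> real" where "smooth_on UNIV \<theta>" "\<And>x. x \<le> a \<Longrightarrow> \<theta> x = 0"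
    "\<And>x. b \<le> x \<Longrightarrow> \<theta> x = 1" "\<And>x. 0 \<le> \<theta> x" "\<And>x. \<theta> x \<le> 1"
proof -
  \<comment> \<open>As \<open>a < b\<close>, every \<open>x\<close> satisfies \<open>x > a\<close>
    or \<open>x < b\<close>, so \<open>?p + ?q\<close> never vanishes and
    \<open>?p / (?p + ?q)\<close> is smooth.\<close>
  let ?p = "\<lambda>x. flat 0 (x - a)" and ?q = "\<lambda>x. flat 0 (b - x)"
  have nn: "0 \<le> flat 0 x" and pos: "0 < flat 0 x \<longleftrightarrow> 0 < x" for x by (auto simp: flat_def)
  have s: "0 < ?p x + ?q x" for x
    using nn[of "x - a"] nn[of "b - x"] pos[of "x - a"] pos[of "b - x"] assms by linarith
  have p: "smooth_on UNIV ?p" and q: "smooth_on UNIV ?q"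
    by (intro smooth_on_compose[OF smooth_on_flat[of UNIV]] smooth_intros; simp)+
  show thesis
  proof
    show "smooth_on UNIV (\<lambda>x. ?p x * inverse (?p x + ?q x))"
      using s by (intro smooth_on_mult smooth_on_inverse smooth_on_add p q) (simp add: less_imp_neq[symmetric])
    show "?p x * inverse (?p x + ?q x) = 0" if "x \<le> a" for x using that by (simp add: flat_def)
    show "?p x * inverse (?p x + ?q x) = 1" if "b \<le> x" for x
      using that s[of x] by (simp add: flat_def split: if_splits)
    show "0 \<le> ?p x * inverse (?p x + ?q x)" for x using s[of x] nn by simp
    show "?p x * inverse (?p x + ?q x) \<le> 1" for x
      using s[of x] nn[of "b - x"] by (simp add: field_simps)
  qed
qed


section \<open>Forms of type (1,1)\<close>

abbreviation Dx1 :: "(complex2 \<Rightarrow> 'b::real_normed_vector) \<Rightarrow> complex2 \<Rightarrow> 'b" where "Dx1 \<equiv> pd (1, 0)"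
abbreviation Dy1 :: "(complex2 \<Rightarrow> 'b::real_normed_vector) \<Rightarrow> complex2 \<Rightarrow> 'b" where "Dy1 \<equiv> pd (\<i>, 0)"
abbreviation Dx2 :: "(complex2 \<Rightarrow> 'b::real_normed_vector) \<Rightarrow> complex2 \<Rightarrow> 'b" where "Dx2 \<equiv> pd (0, 1)"
abbreviation Dy2 :: "(complex2 \<Rightarrow> 'b::real_normed_vector) \<Rightarrow> complex2 \<Rightarrow> 'b" where "Dy2 \<equiv> pd (0, \<i>)"

text \<open>
  A \<open>J\<close>-invariant 2-form \<open>\<eta>\<close> is determined by \<open>A = \<eta>(e\<^sub>1, Je\<^sub>1)\<close>, \<open>D = \<eta>(e\<^sub>2, Je\<^sub>2)\<close>,
  \<open>P = \<eta>(e\<^sub>1, e\<^sub>2)\<close> and \<open>Q = \<eta>(e\<^sub>1, Je\<^sub>2)\<close>.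
\<close>

definition form11 :: "real \<Rightarrow> real \<Rightarrow> real \<Rightarrow> real \<Rightarrow> complex2 \<Rightarrow> complex2 \<Rightarrow> real" where
  "form11 A D P Q v w =
     A * Im (cnj (fst v) * fst w) + D * Im (cnj (snd v) * snd w)
     + P * (Re (cnj (fst v) * snd w) - Re (cnj (fst w) * snd v))
     + Q * (Im (cnj (fst v) * snd w) - Im (cnj (fst w) * snd v))"

text \<open>The four equations express that the exterior derivative vanishes on the triples
  \<open>(e1, e2, Je2)\<close>, \<open>(Je1, e2, Je2)\<close>, \<open>(e1, Je1, e2)\<close> and
  \<open>(e1, Je1, Je2)\<close>, in this order.\<close>

definition closed11 ::
  "complex2 set \<Rightarrow> (complex2 \<Rightarrow> real) \<Rightarrow> (complex2 \<Rightarrow> real) \<Rightarrow> (complex2 \<Rightarrow> real) \<Rightarrow> (complex2 \<Rightarrow> real) \<Rightarrow> bool" where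
  "closed11 S A D P Q \<longleftrightarrow> (\<forall>z\<in>S.
     Dx1 D z = Dx2 Q z - Dy2 P z \<and> Dy1 D z = Dx2 P z + Dy2 Q z \<and>
     Dx2 A z = Dx1 Q z + Dy1 P z \<and> Dy2 A z = Dy1 Q z - Dx1 P z)"

text \<open>The last clause is Sylvester's criterion for a Hermitian 2x2 matrix with diagonal
  \<open>A\<close>, \<open>D\<close> and an off-diagonal entry of squared modulus
  \<open>P\<^sup>2 + Q\<^sup>2\<close>. Starting from \<open>D\<close> gives a condition that
  survives any increase of \<open>A\<close>.\<close>

definition kahler_coeffs ::
  "complex2 set \<Rightarrow> (complex2 \<Rightarrow> real) \<Rightarrow> (complex2 \<Rightarrow> real) \<Rightarrow> (complex2 \<Rightarrow> real) \<Rightarrow> (complex2 \<Rightarrow> real) \<Rightarrow> bool" where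
  "kahler_coeffs S A D P Q \<longleftrightarrow>
     smooth_on S A \<and> smooth_on S D \<and> smooth_on S P \<and> smooth_on S Q \<and> closed11 S A D P Q \<and>
     (\<forall>z\<in>S. 0 < D z \<and> (P z)\<^sup>2 + (Q z)\<^sup>2 < A z * D z)"

lemma pd_scaleR_direction:
  "open S \<Longrightarrow> smooth_on S f \<Longrightarrow> z \<in> S \<Longrightarrow> pd (c *\<^sub>R v) f z = c *\<^sub>R pd v f z"
  using linear_cmul[OF linear_pd] .

lemma pd_add_direction:
  "open S \<Longrightarrow> smooth_on S f \<Longrightarrow> z \<in> S \<Longrightarrow> pd (u + v) f z = pd u f z + pd v f z"
  using linear_add[OF linear_pd] .

lemma complex2_decompose:
  "v = Re (fst v) *\<^sub>R (1, 0) + Im (fst v) *\<^sub>R (\<i>, 0) + Re (snd v) *\<^sub>R (0, 1) + Im (snd v) *\<^sub>R (0, \<i>)" for v :: complex2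
  by (simp add: prod_eq_iff complex_eq_iff)

lemma pd_decompose:
  fixes f :: "complex2 \<Rightarrow> 'b::real_normed_vector"
  assumes "open S" "smooth_on S f" "z \<in> S"
  shows "pd v f z = Re (fst v) *\<^sub>R Dx1 f z + Im (fst v) *\<^sub>R Dy1 f z + Re (snd v) *\<^sub>R Dx2 f z + Im (snd v) *\<^sub>R Dy2 f z"
  by (subst complex2_decompose) (simp only: pd_add_direction[OF assms] pd_scaleR_direction[OF assms])

lemma form11_J_self:
  "form11 A D P Q v (J v) = A * (cmod (fst v))\<^sup>2 + D * (cmod (snd v))\<^sup>2
     + 2 * Q * Re (cnj (fst v) * snd v) - 2 * P * Im (cnj (fst v) * snd v)"
  unfolding cmod_power2 by (simp add: form11_def J_def algebra_simps power2_eq_square)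

lemma form11_J_pos:
  assumes "0 < D" "P\<^sup>2 + Q\<^sup>2 < A * D" "v \<noteq> 0"
  shows "0 < form11 A D P Q v (J v)"
proof -
  obtain a b c d where v: "v = (Complex a b, Complex c d)"
    by (metis complex_surj prod.collapse)
  \<comment> \<open>Completing the square in the second component of \<open>v\<close>; the first
    component keeps the determinant as its coefficient.\<close>
  have eq: "D * form11 A D P Q v (J v)
    = (A * D - P\<^sup>2 - Q\<^sup>2) * (a\<^sup>2 + b\<^sup>2) + ((D * c + Q * a + P * b)\<^sup>2 + (D * d + Q * b - P * a)\<^sup>2)"
    unfolding form11_J_self v cmod_power2 by (simp add: power2_eq_square algebra_simps)
  have "0 < D * form11 A D P Q v (J v)"
  proof (cases "a = 0 \<and> b = 0")
    case True
    then have "c \<noteq> 0 \<or> d \<noteq> 0" using assms(3) by (auto simp: v zero_prod_def complex_eq_iff)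
    then show ?thesis unfolding eq using True assms(1) by (simp add: sum_power2_gt_zero_iff)
  next
    case False
    then have "0 < (A * D - P\<^sup>2 - Q\<^sup>2) * (a\<^sup>2 + b\<^sup>2)"
      using assms(2) by (intro mult_pos_pos) (auto simp: sum_power2_gt_zero_iff)
    then show ?thesis unfolding eq using sum_power2_ge_zero by (intro add_pos_nonneg) auto
  qed
  then show ?thesis using assms(1) by (simp add: zero_less_mult_iff)
qed

section \<open>Kaehler forms and their coefficients\<close>

lemma kahler_onD:
  assumes "kahler_on S \<eta>"
  shows "smooth_on S (\<lambda>z. \<eta> z v w)" "z \<in> S \<Longrightarrow> bilinear (\<eta> z)" "z \<in> S \<Longrightarrow> \<eta> z v v = 0"
    "z \<in> S \<Longrightarrow> ext_deriv \<eta> z u v w = 0" "z \<in> S \<Longrightarrow> \<eta> z (J v) (J w) = \<eta> z v w"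
    "z \<in> S \<Longrightarrow> v \<noteq> 0 \<Longrightarrow> \<eta> z v (J v) > 0"
  using assms unfolding kahler_on_def smooth_2form_on_def by blast+

lemma kahler_onI:
  assumes "\<And>v w. smooth_on S (\<lambda>z. \<eta> z v w)" "\<And>z. z \<in> S \<Longrightarrow> bilinear (\<eta> z)"
    "\<And>z v. z \<in> S \<Longrightarrow> \<eta> z v v = 0"
    "\<And>z u v w. z \<in> S \<Longrightarrow> ext_deriv \<eta> z u v w = 0"
    "\<And>z v w. z \<in> S \<Longrightarrow> \<eta> z (J v) (J w) = \<eta> z v w"
    "\<And>z v. z \<in> S \<Longrightarrow> v \<noteq> 0 \<Longrightarrow> \<eta> z v (J v) > 0"
  shows "kahler_on S \<eta>"
  using assms unfolding kahler_on_def smooth_2form_on_def by blast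

text \<open>This is closedness as a pointwise identity in three arbitrary vectors. In this shape it
  can also be applied to the images of vectors under a differential, as needed for
  pullbacks.\<close>

lemma form11_cocycle:
  assumes S: "open S" and k: "kahler_coeffs S A D P Q" and z: "z \<in> S"
  shows "form11 (pd u A z) (pd u D z) (pd u P z) (pd u Q z) v w
    - form11 (pd v A z) (pd v D z) (pd v P z) (pd v Q z) u w
    + form11 (pd w A z) (pd w D z) (pd w P z) (pd w Q z) u v = 0"
proof -
  have s: "smooth_on S A" "smooth_on S D" "smooth_on S P" "smooth_on S Q"
    and c: "Dx1 D z = Dx2 Q z - Dy2 P z" "Dy1 D z = Dx2 P z + Dy2 Q z"
     "Dx2 A z = Dx1 Q z + Dy1 P z" "Dy2 A z = Dy1 Q z - Dx1 P z"
    using k z unfolding kahler_coeffs_def closed11_def by blast+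
  show ?thesis
    unfolding pd_decompose[OF S s(1) z, of u] pd_decompose[OF S s(1) z, of v] pd_decompose[OF S s(1) z, of w]
      pd_decompose[OF S s(2) z, of u] pd_decompose[OF S s(2) z, of v] pd_decompose[OF S s(2) z, of w]
      pd_decompose[OF S s(3) z, of u] pd_decompose[OF S s(3) z, of v] pd_decompose[OF S s(3) z, of w]
      pd_decompose[OF S s(4) z, of u] pd_decompose[OF S s(4) z, of v] pd_decompose[OF S s(4) z, of w]
      c form11_def
    by (simp add: algebra_simps)
qed

lemma kahler_on_form11:
  assumes S: "open S" and k: "kahler_coeffs S A D P Q"
  shows "kahler_on S (\<lambda>z. form11 (A z) (D z) (P z) (Q z))"
proof -
  note sm = k[unfolded kahler_coeffs_def]
  have s: "smooth_on S A" "smooth_on S D" "smooth_on S P" "smooth_on S Q" using sm by auto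
  have pdf: "frechet_derivative (\<lambda>y. form11 (A y) (D y) (P y) (Q y) v w) (at z) u
     = form11 (pd u A z) (pd u D z) (pd u P z) (pd u Q z) v w" if z: "z \<in> S" for z u v w
  proof -
    have "((\<lambda>y. form11 (A y) (D y) (P y) (Q y) v w) has_derivative
       (\<lambda>u. form11 (pd u A z) (pd u D z) (pd u P z) (pd u Q z) v w)) (at z)"
      unfolding form11_def
      by (intro has_derivative_add has_derivative_mult_left has_derivative_pd[OF S _ z] s)
    then show ?thesis by (rule pd_eqI[unfolded pd_def])
  qed
  show ?thesis
  proof (rule kahler_onI)
    fix z u v w assume z: "z \<in> S"
    show "ext_deriv (\<lambda>z. form11 (A z) (D z) (P z) (Q z)) z u v w = 0"
      using form11_cocycle[OF S k z] by (simp only: ext_deriv_def pdf[OF z])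
  next
    show "bilinear (form11 (A z) (D z) (P z) (Q z))" for z
      unfolding bilinear_def form11_def
      by (auto intro!: linearI simp: algebra_simps)
    show "form11 (A z) (D z) (P z) (Q z) v v = 0" for z v
      by (simp add: form11_def algebra_simps)
    show "smooth_on S (\<lambda>z. form11 (A z) (D z) (P z) (Q z) v w)" for v w
      unfolding form11_def by (intro smooth_intros s)
    show "form11 (A z) (D z) (P z) (Q z) (J v) (J w) = form11 (A z) (D z) (P z) (Q z) v w" for z v w
      by (simp add: form11_def J_def algebra_simps)
    show "0 < form11 (A z) (D z) (P z) (Q z) v (J v)" if "z \<in> S" "v \<noteq> 0" for z v
      using sm that by (intro form11_J_pos) auto
  qed
qed

lemma form11_of_J_invariant:
  assumes b: "bilinear \<eta>" and alt: "\<And>v. \<eta> v v = 0" and J: "\<And>v w. \<eta> (J v) (J w) = \<eta> v w"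
  shows "\<eta> = form11 (\<eta> (1, 0) (\<i>, 0)) (\<eta> (0, 1) (0, \<i>)) (\<eta> (1, 0) (0, 1)) (\<eta> (1, 0) (0, \<i>))"
proof (intro ext)
  fix v w :: complex2
  have anti: "\<eta> v w = - \<eta> w v" for v w
    using alt[of "v + w"] alt[of v] alt[of w] b by (simp add: bilinear_ladd bilinear_radd)
  have neg: "\<eta> v (- w) = - \<eta> v w" for v w using b by (simp add: bilinear_rneg)
  have t1: "\<eta> (\<i>, 0) (0, \<i>) = \<eta> (1, 0) (0, 1)" using J[of "(1, 0)" "(0, 1)"] by (simp add: J_def)
  have t2: "\<eta> (\<i>, 0) (0, 1) = - \<eta> (1, 0) (0, \<i>)"
    using J[of "(1, 0)" "(0, \<i>)"] neg[of "(\<i>, 0)" "(0, 1)"] by (simp add: J_def)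
  note t = t1 t2 anti[of "(\<i>, 0)" "(1, 0)"] anti[of "(0, \<i>)" "(0, 1)"] anti[of "(0, 1)" "(1, 0)"]
    anti[of "(0, \<i>)" "(1, 0)"] anti[of "(0, 1)" "(\<i>, 0)"] anti[of "(0, \<i>)" "(\<i>, 0)"]
  have "\<eta> v w = \<eta> (Re (fst v) *\<^sub>R (1, 0) + Im (fst v) *\<^sub>R (\<i>, 0) + Re (snd v) *\<^sub>R (0, 1) + Im (snd v) *\<^sub>R (0, \<i>))
    (Re (fst w) *\<^sub>R (1, 0) + Im (fst w) *\<^sub>R (\<i>, 0) + Re (snd w) *\<^sub>R (0, 1) + Im (snd w) *\<^sub>R (0, \<i>))"
    using complex2_decompose by metis
  also have "\<dots> = form11 (\<eta> (1, 0) (\<i>, 0)) (\<eta> (0, 1) (0, \<i>)) (\<eta> (1, 0) (0, 1)) (\<eta> (1, 0) (0, \<i>)) v w"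
    by (simp only: bilinear_ladd[OF b] bilinear_radd[OF b] bilinear_lmul[OF b] bilinear_rmul[OF b] alt t)
      (simp add: form11_def algebra_simps)
  finally show "\<eta> v w = form11 (\<eta> (1, 0) (\<i>, 0)) (\<eta> (0, 1) (0, \<i>)) (\<eta> (1, 0) (0, 1)) (\<eta> (1, 0) (0, \<i>)) v w" .
qed

lemma kahler_on_coeffs:
  assumes S: "open S" and k: "kahler_on S \<eta>"
  obtains A D P Q where "kahler_coeffs S A D P Q" "\<And>z. z \<in> S \<Longrightarrow> \<eta> z = form11 (A z) (D z) (P z) (Q z)"
proof -
  define A where "A z = \<eta> z (1, 0) (\<i>, 0)" for z
  define D where "D z = \<eta> z (0, 1) (0, \<i>)" for z
  define P where "P z = \<eta> z (1, 0) (0, 1)" for z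
  define Q where "Q z = \<eta> z (1, 0) (0, \<i>)" for z
  have eq: "\<eta> z = form11 (A z) (D z) (P z) (Q z)" if "z \<in> S" for z
    unfolding A_def D_def P_def Q_def
    by (rule form11_of_J_invariant; use kahler_onD[OF k] that in blast)
  have s: "smooth_on S A" "smooth_on S D" "smooth_on S P" "smooth_on S Q"
    unfolding A_def D_def P_def Q_def by (rule kahler_onD[OF k])+
  have pdf: "frechet_derivative (\<lambda>y. \<eta> y v w) (at z) u
     = form11 (pd u A z) (pd u D z) (pd u P z) (pd u Q z) v w" if z: "z \<in> S" for z u v w
  proof -
    have "((\<lambda>y. form11 (A y) (D y) (P y) (Q y) v w) has_derivative
       (\<lambda>u. form11 (pd u A z) (pd u D z) (pd u P z) (pd u Q z) v w)) (at z)"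
      unfolding form11_def
      by (intro has_derivative_add has_derivative_mult_left has_derivative_pd[OF S _ z] s)
    then have "((\<lambda>y. \<eta> y v w) has_derivative
       (\<lambda>u. form11 (pd u A z) (pd u D z) (pd u P z) (pd u Q z) v w)) (at z)"
      by (rule has_derivative_transform_within_open[OF _ S z]) (simp add: eq)
    then show ?thesis by (rule pd_eqI[unfolded pd_def])
  qed
  have "closed11 S A D P Q"
    unfolding closed11_def
  proof (intro ballI)
    fix z assume z: "z \<in> S"
    have ext: "form11 (pd u A z) (pd u D z) (pd u P z) (pd u Q z) v w
      - form11 (pd v A z) (pd v D z) (pd v P z) (pd v Q z) u w
      + form11 (pd w A z) (pd w D z) (pd w P z) (pd w Q z) u v = 0" for u v w
      using k z unfolding kahler_on_def ext_deriv_def pdf[OF z, symmetric] by blast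
    show "Dx1 D z = Dx2 Q z - Dy2 P z \<and> Dy1 D z = Dx2 P z + Dy2 Q z \<and>
     Dx2 A z = Dx1 Q z + Dy1 P z \<and> Dy2 A z = Dy1 Q z - Dx1 P z"
      using ext[of "(1, 0)" "(0, 1)" "(0, \<i>)"] ext[of "(\<i>, 0)" "(0, 1)" "(0, \<i>)"]
        ext[of "(1, 0)" "(\<i>, 0)" "(0, 1)"] ext[of "(1, 0)" "(\<i>, 0)" "(0, \<i>)"]
      by (simp add: form11_def)
  qed
  moreover have "0 < D z \<and> (P z)\<^sup>2 + (Q z)\<^sup>2 < A z * D z" if z: "z \<in> S" for z
  proof -
    have pos: "0 < form11 (A z) (D z) (P z) (Q z) v (J v)" if "v \<noteq> 0" for v
      using kahler_onD(6)[OF k z that] by (simp only: eq[OF z])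
    have D: "0 < D z" using pos[of "(0, 1)"] by (simp add: form11_def J_def zero_prod_def)
    \<comment> \<open>The vector at which both squares of the completed form in
      \<open>form11_J_pos\<close> vanish, so that only the determinant is left.\<close>
    let ?v = "(Complex (D z) 0, Complex (- Q z) (P z))"
    have "form11 (A z) (D z) (P z) (Q z) ?v (J ?v) = D z * (A z * D z - ((P z)\<^sup>2 + (Q z)\<^sup>2))"
      by (simp add: form11_def J_def algebra_simps power2_eq_square)
    moreover have "?v \<noteq> 0" using D by (simp add: zero_prod_def complex_eq_iff)
    ultimately have "0 < D z * (A z * D z - ((P z)\<^sup>2 + (Q z)\<^sup>2))" using pos by metis
    then show ?thesis using D by (simp add: zero_less_mult_iff)
  qed
  ultimately have "kahler_coeffs S A D P Q" using s by (simp add: kahler_coeffs_def)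
  then show thesis using that eq by blast
qed

section \<open>Locality of the Kaehler condition\<close>

lemma kahler_on_cong:
  assumes S: "open S" and k: "kahler_on S \<eta>" and eq: "\<And>z. z \<in> S \<Longrightarrow> \<eta> z = \<eta>' z"
  shows "kahler_on S \<eta>'"
proof -
  have fd: "frechet_derivative (\<lambda>y. \<eta> y v w) (at z) u = frechet_derivative (\<lambda>y. \<eta>' y v w) (at z) u"
    if "z \<in> S" for z u v w
    using pd_cong[OF S that, of "\<lambda>y. \<eta> y v w" "\<lambda>y. \<eta>' y v w" u] eq by (simp add: pd_def)
  show ?thesis
  proof (rule kahler_onI)
    show "smooth_on S (\<lambda>z. \<eta>' z v w)" for v w
      by (rule smooth_on_cong[OF S kahler_onD(1)[OF k, of v w]]) (simp add: eq)
    show "ext_deriv \<eta>' z u v w = 0" if "z \<in> S" for z u v w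
      using kahler_onD(4)[OF k that, of u v w] by (simp add: ext_deriv_def fd[OF that])
  qed (use kahler_onD[OF k] eq in auto)
qed

lemma kahler_on_local:
  assumes "\<And>x. x \<in> S \<Longrightarrow> \<exists>T. open T \<and> x \<in> T \<and> kahler_on T \<eta>"
  shows "kahler_on S \<eta>"
proof (rule kahler_onI)
  show "smooth_on S (\<lambda>z. \<eta> z v w)" for v w
  proof (rule smooth_on_local)
    fix x assume "x \<in> S"
    then obtain T where "open T" "x \<in> T" "kahler_on T \<eta>" using assms by blast
    then show "\<exists>T. open T \<and> x \<in> T \<and> smooth_on T (\<lambda>z. \<eta> z v w)"
      using kahler_onD(1) by blast
  qed
next
  fix z v w u assume "z \<in> S"
  then obtain T where T: "z \<in> T" "kahler_on T \<eta>" using assms by blast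
  show "bilinear (\<eta> z)" "\<eta> z v v = 0" "ext_deriv \<eta> z u v w = 0" "\<eta> z (J v) (J w) = \<eta> z v w"
    by (rule kahler_onD[OF T(2)], rule T(1))+
  show "\<eta> z v (J v) > 0" if "v \<noteq> 0"
    by (rule kahler_onD[OF T(2)]) (fact T(1) that)+
qed

lemma kahler_on_Un: "open S \<Longrightarrow> open T \<Longrightarrow> kahler_on S \<eta> \<Longrightarrow> kahler_on T \<eta> \<Longrightarrow> kahler_on (S \<union> T) \<eta>"
  by (rule kahler_on_local) blast


section \<open>Equations in the second variable\<close>

lemma smooth_on_cis_compose [smooth_intros]: "smooth_on S f \<Longrightarrow> smooth_on S (\<lambda>x. cis (f x))"
  by (rule smooth_on_compose[OF smooth_on_cis[of UNIV]]) auto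

lemma pd_Pair_zero:
  assumes "open G" "smooth_on G H" "(z, s) \<in> G"
  shows "pd (v, 0) H (z, s) = pd v (\<lambda>y. H (y, s)) z"
proof -
  have "((\<lambda>y. (y, s)) has_derivative (\<lambda>v. (v, 0))) (at z)"
    by (intro has_derivative_Pair has_derivative_ident has_derivative_const)
  from has_derivative_compose[OF this has_derivative_pd[OF assms]]
  show ?thesis using pd_eqI by fastforce
qed

lemma pd_translate:
  assumes "open S" "smooth_on S g" "z + w \<in> S"
  shows "pd v (\<lambda>y. g (y + w)) z = pd v g (z + w)"
proof -
  have "((\<lambda>y. y + w) has_derivative (\<lambda>v. v)) (at z)"
    by (auto intro!: derivative_eq_intros)
  from has_derivative_compose[OF this has_derivative_pd[OF assms]]
  show ?thesis by (rule pd_eqI)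
qed

lemma pd_snd_decompose:
  fixes f :: "complex2 \<Rightarrow> 'b::real_normed_vector"
  assumes "open S" "smooth_on S f" "z \<in> S"
  shows "pd (0, c) f z = Re c *\<^sub>R pd (0, 1) f z + Im c *\<^sub>R pd (0, \<i>) f z"
  using pd_decompose[OF assms, of "(0, c)"] by simp

text \<open>
  In polar coordinates around \<open>z\<^sub>2\<close> the Cauchy kernel cancels the Jacobian, so the Cauchy transform
  becomes the integral of a smooth function over a rectangle.
\<close>

lemma dbar_snd_solution_exists:
  fixes g :: "complex2 \<Rightarrow> complex"
  assumes A: "open A" and d: "0 < d" and g: "smooth_on (A \<times> UNIV) g"
    and g0: "\<And>z. fst z \<in> A \<Longrightarrow> d \<le> cmod (snd z) \<Longrightarrow> g z = 0"
  obtains u where "smooth_on (A \<times> UNIV) u"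
    "\<And>z. fst z \<in> A \<Longrightarrow> cmod (snd z) < d \<Longrightarrow> pd (0, 1) u z + \<i> * pd (0, \<i>) u z = g z"
proof -
  let ?S = "A \<times> (UNIV :: complex set)"
  \<comment> \<open>For \<open>cmod (snd z) < d\<close>, a step of length \<open>2 * d\<close> in
    any direction leads to a point where \<open>g\<close> vanishes, so radii up to
    \<open>2 * d\<close> suffice.\<close>
  let ?K = "cbox (0, 0) (2 * d, 2 * pi) :: (real \<times> real) set"
  define w :: "real \<times> real \<Rightarrow> complex2" where "w s = (0, - (of_real (fst s) * cis (snd s)))" for s
  define H where "H = (\<lambda>p. cis (- snd (snd p)) * g (fst p + w (snd p)))"
  have S: "open ?S" using A by (simp add: open_Times)
  have G: "open (?S \<times> (UNIV :: (real \<times> real) set))" using S by (simp add: open_Times)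
  have [simp]: "z + w s \<in> ?S \<longleftrightarrow> z \<in> ?S" for z s by (cases z) (simp add: w_def)
  have w: "smooth_on X (\<lambda>p. w (f p))" if "smooth_on X f" for X and f :: "'z::real_normed_vector \<Rightarrow> _"
    unfolding w_def by (intro smooth_intros that)
  have H: "smooth_on (?S \<times> UNIV) H"
    unfolding H_def
    by (intro smooth_on_mult smooth_on_cis_compose smooth_on_minus smooth_on_snd smooth_on_id
        smooth_on_compose[OF g] smooth_on_add smooth_on_fst w) (auto simp: w_def)
  \<comment> \<open>The factor is \<open>2 * pi\<close> rather than pi because
    \<open>pd (0, 1) + \<i> * pd (0, \<i>)\<close> is twice the dbar operator in
    \<open>z\<^sub>2\<close>.\<close>
  define u where "u z = integral ?K (\<lambda>s. H (z, s)) / (2 * pi)" for z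
  have u: "smooth_on ?S u"
    unfolding u_def
    by (intro smooth_on_compose_linear[OF bounded_linear_divide] smooth_on_integral[OF S G] H) auto
  show thesis
  proof (rule that[OF u])
    fix z :: complex2 assume z: "fst z \<in> A" "cmod (snd z) < d"
    then have zS: "z \<in> ?S" by (cases z) auto
    have pdH: "pd (v, 0) H (z, s) = cis (- snd s) * pd v g (z + w s)" for v s
    proof -
      have "pd (v, 0) H (z, s) = pd v (\<lambda>y. cis (- snd s) * g (y + w s)) z"
        using pd_Pair_zero[OF G H, of z s v] zS by (simp add: H_def)
      also have "\<dots> = cis (- snd s) * pd v (\<lambda>y. g (y + w s)) z"
        by (rule pd_linear_image[OF bounded_linear_mult_right S _ zS])
           (intro smooth_on_compose[OF g] smooth_intros, auto simp: w_def)
      also have "pd v (\<lambda>y. g (y + w s)) z = pd v g (z + w s)"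
        by (rule pd_translate[OF S g]) (use zS in simp)
      finally show ?thesis .
    qed
    have pdu: "pd v u z = integral ?K (\<lambda>s. cis (- snd s) * pd v g (z + w s)) / (2 * pi)" for v
    proof -
      have "(u has_derivative (\<lambda>v. integral ?K (\<lambda>s. pd (v, 0) H (z, s)) / (2 * pi))) (at z)"
        unfolding u_def
        by (rule bounded_linear.has_derivative[OF bounded_linear_divide], rule has_derivative_integral[OF S G _ H zS]) auto
      then have "pd v u z = integral ?K (\<lambda>s. pd (v, 0) H (z, s)) / (2 * pi)" by (rule pd_eqI)
      then show ?thesis by (simp only: pdH)
    qed
    have smw: "smooth_on UNIV (\<lambda>s. f (z + w s))" if "smooth_on ?S f" for f :: "complex2 \<Rightarrow> complex"
      by (intro smooth_on_compose[OF that] smooth_on_add smooth_on_const w smooth_on_id) (use zS in \<open>auto simp: w_def\<close>)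
    have gs: "smooth_on ?S (pd v g)" for v by (rule smooth_on_pd[OF S g])
    \<comment> \<open>In polar coordinates around the point, \<open>pr\<close> is the radial
      derivative of \<open>g\<close> and \<open>q\<close> the angular derivative divided by the
      radius. The rotated dbar operator splits into these two.\<close>
    define pr where "pr s = pd (0, - cis (snd s)) g (z + w s)" for s
    define q where "q s = pd (0, - (\<i> * cis (snd s))) g (z + w s)" for s
    have pr: "pr s = - (cos (snd s) *\<^sub>R pd (0, 1) g (z + w s) + sin (snd s) *\<^sub>R pd (0, \<i>) g (z + w s))"
     and q: "q s = sin (snd s) *\<^sub>R pd (0, 1) g (z + w s) - cos (snd s) *\<^sub>R pd (0, \<i>) g (z + w s)" for s
      unfolding pr_def q_def using zS by (subst pd_snd_decompose[OF S g]; simp)+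
    have cont: "continuous_on X pr" "continuous_on X q" for X
      unfolding pr q
      by (intro continuous_intros smooth_on_imp_continuous_on smooth_on_subset[OF smw[OF gs]] subset_UNIV)+
    have "pd (0, 1) u z + \<i> * pd (0, \<i>) u z
       = (integral ?K (\<lambda>s. cis (- snd s) * pd (0, 1) g (z + w s))
         + \<i> * integral ?K (\<lambda>s. cis (- snd s) * pd (0, \<i>) g (z + w s))) / (2 * pi)"
      by (simp add: pdu add_divide_distrib)
    also have "\<dots> = integral ?K (\<lambda>s. cis (- snd s) * pd (0, 1) g (z + w s)
        + \<i> * (cis (- snd s) * pd (0, \<i>) g (z + w s))) / (2 * pi)"
    proof -
      have "(\<lambda>s. cis (- snd s) * pd v g (z + w s)) integrable_on ?K" for v
        by (intro integrable_continuous smooth_on_imp_continuous_on smooth_on_mult smooth_on_cis_compose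
            smooth_on_minus smooth_on_snd smooth_on_id smooth_on_subset[OF smw[OF gs]]) simp
      then show ?thesis by (subst integral_add) (simp_all add: integrable_on_mult_right)
    qed
    also have "(\<lambda>s. cis (- snd s) * pd (0, 1) g (z + w s) + \<i> * (cis (- snd s) * pd (0, \<i>) g (z + w s)))
        = (\<lambda>s. - pr s - \<i> * q s)"
      unfolding pr q by (rule ext) (auto simp: complex_eq_iff algebra_simps)
    also have "integral ?K \<dots> = - integral ?K pr - \<i> * integral ?K q"
      by (subst integral_diff) (auto intro!: integrable_continuous continuous_intros cont)
    \<comment> \<open>Over a circle, \<open>q\<close> times the radius is the derivative of a
      periodic function and integrates to 0; dividing by the radius excludes only
      \<open>r = 0\<close>, a null set.\<close>
    also have "integral ?K q = 0"
    proof -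
      have "integral (cbox 0 (2 * pi)) (\<lambda>t. q (r, t)) = 0" if "r \<noteq> 0" for r
      proof -
        have "((\<lambda>t. g (z + w (r, t))) has_vector_derivative r *\<^sub>R q (r, t)) (at t within {0..2 * pi})" for t
        proof -
          have "((\<lambda>t. z + w (r, t)) has_derivative (\<lambda>h. h *\<^sub>R (0, - (of_real r * (\<i> * cis t))))) (at t within {0..2 * pi})"
            unfolding w_def by (auto intro!: derivative_eq_intros simp: scaleR_conv_of_real fun_eq_iff)
          from has_derivative_compose[OF this has_derivative_pd[OF S g]] zS
          have "((\<lambda>t. g (z + w (r, t))) has_derivative (\<lambda>h. pd (h *\<^sub>R (0, - (of_real r * (\<i> * cis t)))) g (z + w (r, t)))) (at t within {0..2 * pi})"
            by simp
          moreover have "pd (h *\<^sub>R (0, - (of_real r * (\<i> * cis t)))) g (z + w (r, t)) = h *\<^sub>R r *\<^sub>R q (r, t)" for h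
          proof -
            have "h *\<^sub>R (0, - (of_real r * (\<i> * cis t))) = h *\<^sub>R r *\<^sub>R (0 :: complex, - (\<i> * cis t))"
              by (simp add: scaleR_conv_of_real)
            then show ?thesis
              using pd_scaleR_direction[OF S g, of "z + w (r, t)"] zS
              by (simp add: q_def del: scaleR_Pair)
          qed
          ultimately show ?thesis by (simp add: has_vector_derivative_def)
        qed
        then have "((\<lambda>t. r *\<^sub>R q (r, t)) has_integral g (z + w (r, 2 * pi)) - g (z + w (r, 0))) {0..2 * pi}"
          by (intro fundamental_theorem_of_calculus) auto
        then have "((\<lambda>t. r *\<^sub>R q (r, t)) has_integral 0) {0..2 * pi}"
          by (simp add: w_def)
        from integral_unique[OF this] show ?thesis using that by simp
      qed
      then have "integral (cbox 0 (2 * d)) (\<lambda>r. integral (cbox 0 (2 * pi)) (\<lambda>t. q (r, t))) = integral (cbox 0 (2 * d)) (\<lambda>r. 0)"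
        by (intro integral_spike[of "{0}"]) auto
      then show ?thesis by (subst integral_prod_continuous) (auto intro: cont)
    qed
    \<comment> \<open>Along each ray the radial derivative integrates to the value of
      \<open>g\<close> at radius \<open>2 * d\<close>, which is 0, minus its value at the centre,
      whatever the angle.\<close>
    also have "integral ?K pr = - (2 * pi * g z)"
    proof -
      have "integral (cbox 0 (2 * d)) (\<lambda>r. pr (r, t)) = - g z" for t
      proof -
        have "((\<lambda>r. g (z + w (r, t))) has_vector_derivative pr (r, t)) (at r within {0..2 * d})" for r
          using pd_along_line[OF S g, of z r "(0, - cis t)" "{0..2 * d}"] zS
          by (cases z) (simp add: w_def pr_def scaleR_conv_of_real)
        then have "((\<lambda>r. pr (r, t)) has_integral g (z + w (2 * d, t)) - g (z + w (0, t))) {0..2 * d}"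
          using d by (intro fundamental_theorem_of_calculus) auto
        moreover have "g (z + w (2 * d, t)) = 0"
        proof (rule g0)
          show "fst (z + w (2 * d, t)) \<in> A" using z by (simp add: w_def)
          have "2 * d = cmod (of_real (2 * d) * cis t)" using d by (simp add: norm_mult)
          also have "\<dots> \<le> cmod (of_real (2 * d) * cis t - snd z) + cmod (snd z)" by norm
          finally show "d \<le> cmod (snd (z + w (2 * d, t)))"
            using z by (simp add: w_def norm_minus_commute)
        qed
        moreover have "z + w (0, t) = z" by (simp add: w_def zero_prod_def[symmetric])
        ultimately show ?thesis by (simp add: integral_unique)
      qed
      then show ?thesis
        by (subst integral_prod_continuous, simp add: cont, subst integral_swap_continuous)
           (auto intro: cont simp: scaleR_conv_of_real)
    qed
    finally show "pd (0, 1) u z + \<i> * pd (0, \<i>) u z = g z" by simp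
  qed
qed

text \<open>The Laplacian in \<open>z\<^sub>2\<close> is the product of
  \<open>Dx2 + \<i> Dy2\<close> and its conjugate, so two dbar equations are solved in succession,
  the second one after conjugation. Cutting off the right-hand sides makes them vanish outside a
  disk, as the dbar solution demands; the equation then holds only on the smaller disk.\<close>

lemma poisson_snd_solution_exists:
  fixes h :: "complex2 \<Rightarrow> real"
  assumes A: "open A" and d: "0 < d'" "d' < d" and h: "smooth_on (A \<times> ball 0 d) h"
  obtains f where "smooth_on (A \<times> UNIV) f"
    "\<And>z. z \<in> A \<times> ball 0 d' \<Longrightarrow> pd (0, 1) (pd (0, 1) f) z + pd (0, \<i>) (pd (0, \<i>) f) z = h z"
proof -
  let ?S = "A \<times> (UNIV :: complex set)"
  \<comment> \<open>The cutoff drops from 1 to 0 between \<open>d'\<close> and \<open>e\<close>. The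
    gap between \<open>e\<close> and \<open>d\<close> makes the extension by 0 smooth.\<close>
  obtain e where e: "d' < e" "e < d" using d dense by blast
  have "d'\<^sup>2 < e\<^sup>2" using d e by (intro power_strict_mono) auto
  then obtain \<theta> :: "real \<Rightarrow> real" where \<theta>: "smooth_on UNIV \<theta>" "\<And>x. x \<le> d'\<^sup>2 \<Longrightarrow> \<theta> x = 0"
    "\<And>x. e\<^sup>2 \<le> x \<Longrightarrow> \<theta> x = 1"
    using smooth_cutoff_exists by metis
  define \<kappa> where "\<kappa> z = 1 - \<theta> ((Re (snd z))\<^sup>2 + (Im (snd z))\<^sup>2)" for z :: complex2
  have \<kappa>: "smooth_on X \<kappa>" for X
    unfolding \<kappa>_def power2_eq_square
    by (intro smooth_on_diff smooth_on_const smooth_on_compose[OF \<theta>(1)] smooth_intros) auto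
  have \<kappa>1: "\<kappa> z = 1" if "cmod (snd z) \<le> d'" for z
    using that \<theta>(2) by (simp add: \<kappa>_def cmod_power2[symmetric] power_mono)
  have \<kappa>0: "\<kappa> z = 0" if "e \<le> cmod (snd z)" for z
    using that \<theta>(3) d e by (simp add: \<kappa>_def cmod_power2[symmetric] power_mono)
  have S: "open ?S" using A by (simp add: open_Times)
  define g where "g z = (if cmod (snd z) < d then complex_of_real (\<kappa> z * h z) else 0)" for z
  have "smooth_on (A \<times> ball 0 d \<union> A \<times> - cball 0 e) g"
  proof (rule smooth_on_Un)
    show "smooth_on (A \<times> ball 0 d) g"
      by (rule smooth_on_cong[where f = "\<lambda>z. complex_of_real (\<kappa> z * h z)"])
         (auto simp: g_def A open_Times intro!: smooth_intros \<kappa> h)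
    show "smooth_on (A \<times> - cball 0 e) g"
      by (rule smooth_on_cong[where f = "\<lambda>z. 0"])
         (auto simp: g_def A open_Times open_Compl \<kappa>0 intro!: smooth_intros)
  qed (auto simp: A open_Times open_Compl)
  also have "A \<times> ball 0 d \<union> A \<times> - cball 0 e = ?S" using e by auto
  finally have g: "smooth_on ?S g" .
  obtain v where v: "smooth_on ?S v" "\<And>z. fst z \<in> A \<Longrightarrow> cmod (snd z) < d \<Longrightarrow> pd (0, 1) v z + \<i> * pd (0, \<i>) v z = g z"
    by (rule dbar_snd_solution_exists[OF A, of d g]) (use d g in \<open>auto simp: g_def\<close>)
  \<comment> \<open>The solution \<open>v\<close> need not vanish anywhere, so it is cut off again
    before the second equation; on the disk of radius \<open>d'\<close> this changes
    nothing.\<close>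
  define k where "k z = cnj (complex_of_real (\<kappa> z) * v z)" for z
  have k: "smooth_on ?S k" unfolding k_def by (intro smooth_intros \<kappa> v)
  obtain w where w: "smooth_on ?S w" "\<And>z. fst z \<in> A \<Longrightarrow> cmod (snd z) < d \<Longrightarrow> pd (0, 1) w z + \<i> * pd (0, \<i>) w z = k z"
    by (rule dbar_snd_solution_exists[OF A, of d k]) (use d e k in \<open>auto simp: k_def \<kappa>0\<close>)
  define W where "W z = cnj (w z)" for z
  have W: "smooth_on ?S W" unfolding W_def by (intro smooth_intros w)
  let ?B = "A \<times> ball (0::complex) d'"
  have B: "open ?B" "?B \<subseteq> ?S" using A by (auto simp: open_Times)
  have pdW: "pd x W z = cnj (pd x w z)" if "z \<in> ?S" for x z
    unfolding W_def by (rule pd_linear_image[OF bounded_linear_cnj S w(1) that])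
  have WB: "pd (0, 1) W z - \<i> * pd (0, \<i>) W z = v z" if z: "z \<in> ?B" for z
  proof -
    have zS: "z \<in> ?S" using z B(2) by blast
    have "pd (0, 1) W z - \<i> * pd (0, \<i>) W z = cnj (pd (0, 1) w z + \<i> * pd (0, \<i>) w z)"
      by (simp add: pdW[OF zS])
    also have "\<dots> = cnj (k z)" using z d by (subst w(2)) auto
    also have "\<dots> = v z" using z \<kappa>1[of z] by (auto simp: k_def)
    finally show ?thesis .
  qed
  note sB = smooth_on_subset[OF _ B(2)]
  have pWB: "pd x (pd (0, 1) W) z - \<i> * pd x (pd (0, \<i>) W) z = pd x v z" if "z \<in> ?B" for x z
  proof -
    have 1: "smooth_on ?B (pd y W)" for y by (intro sB smooth_on_pd S W)
    have "pd x v z = pd x (\<lambda>z. pd (0, 1) W z - \<i> * pd (0, \<i>) W z) z"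
      using WB by (intro pd_cong[OF B(1) that]) auto
    also have "\<dots> = pd x (pd (0, 1) W) z - pd x (\<lambda>z. \<i> * pd (0, \<i>) W z) z"
      by (intro pd_diff[OF B(1) _ _ that] 1 smooth_intros)
    also have "pd x (\<lambda>z. \<i> * pd (0, \<i>) W z) z = \<i> * pd x (pd (0, \<i>) W) z"
      by (rule pd_linear_image[OF bounded_linear_mult_right B(1) 1 that])
    finally show ?thesis by simp
  qed
  show thesis
  proof
    \<comment> \<open>Both the Laplacian and \<open>h\<close> are real, so the real part of a
      complex solution is a solution.\<close>
    show "smooth_on ?S (\<lambda>z. Re (W z))" by (intro smooth_intros W)
    fix z assume z: "z \<in> ?B"
    then have zS: "z \<in> ?S" using B by auto
    have "pd y (\<lambda>z. Re (W z)) x = Re (pd y W x)" if "x \<in> ?S" for y x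
      by (rule pd_linear_image[OF bounded_linear_Re S W that])
    then have "pd y (pd y (\<lambda>z. Re (W z))) z = pd y (\<lambda>x. Re (pd y W x)) z" for y
      by (intro pd_cong[OF S zS])
    also have "pd y (\<lambda>x. Re (pd y W x)) z = Re (pd y (pd y W) z)" for y
      by (rule pd_linear_image[OF bounded_linear_Re S smooth_on_pd[OF S W] zS])
    finally have Re: "pd y (pd y (\<lambda>z. Re (W z))) z = Re (pd y (pd y W) z)" for y .
    have "pd (0, 1) v z + \<i> * pd (0, \<i>) v z = pd (0, 1) (pd (0, 1) W) z + pd (0, \<i>) (pd (0, \<i>) W) z"
      using pd_commute[OF S W zS, of "(0, 1)" "(0, \<i>)"]
      by (simp add: pWB[OF z, symmetric] algebra_simps)
    moreover have "pd (0, 1) v z + \<i> * pd (0, \<i>) v z = h z"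
      using v(2)[of z] z d \<kappa>1[of z] by (auto simp: g_def)
    ultimately show "pd (0, 1) (pd (0, 1) (\<lambda>z. Re (W z))) z + pd (0, \<i>) (pd (0, \<i>) (\<lambda>z. Re (W z))) z = h z"
      unfolding Re by (metis Re_complex_of_real plus_complex.sel(1))
  qed
qed

text \<open>The Poincare lemma on the disk, with \<open>z\<^sub>1\<close> as a parameter: the
  primitive integrates \<open>X dx\<^sub>2 + Y dy\<^sub>2\<close> along the segment from
  \<open>(z\<^sub>1, 0)\<close> to \<open>(z\<^sub>1, z\<^sub>2)\<close>, and so depends smoothly on
  \<open>z\<^sub>1\<close> as well.\<close>

lemma closed_snd_primitive_exists:
  fixes X Y :: "complex2 \<Rightarrow> real"
  assumes A: "open A" and X: "smooth_on (A \<times> ball 0 d) X" and Y: "smooth_on (A \<times> ball 0 d) Y"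
    and closed: "\<And>z. z \<in> A \<times> ball 0 d \<Longrightarrow> pd (0, \<i>) X z = pd (0, 1) Y z"
  obtains a where "smooth_on (A \<times> ball 0 d) a"
    "\<And>z. z \<in> A \<times> ball 0 d \<Longrightarrow> pd (0, 1) a z = X z"
    "\<And>z. z \<in> A \<times> ball 0 d \<Longrightarrow> pd (0, \<i>) a z = Y z"
proof -
  let ?S = "A \<times> ball (0 :: complex) d"
  have S: "open ?S" using A by (simp add: open_Times)
  define m where "m p = (fst (fst p), of_real (snd p) * snd (fst p))" for p :: "complex2 \<times> real"
  define G where "G = {p. m p \<in> ?S}"
  have m: "smooth_on UNIV m" unfolding m_def by (intro smooth_intros)
  have G: "open G"
    unfolding G_def using open_vimage[OF S] smooth_on_imp_continuous_on[OF m] by (simp add: vimage_def)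
  have SG: "?S \<times> cbox 0 1 \<subseteq> G"
  proof
    fix p assume "p \<in> ?S \<times> cbox 0 (1::real)"
    then have p: "fst (fst p) \<in> A" "cmod (snd (fst p)) < d" "0 \<le> snd p" "snd p \<le> 1" by auto
    have "snd p * cmod (snd (fst p)) \<le> 1 * cmod (snd (fst p))" using p by (intro mult_right_mono) auto
    then show "p \<in> G" using p by (auto simp: G_def m_def norm_mult)
  qed
  have mG: "smooth_on G (\<lambda>p. f (m p))" if "smooth_on ?S f" for f :: "complex2 \<Rightarrow> real"
    by (rule smooth_on_compose[OF that smooth_on_subset[OF m]]) (auto simp: G_def)
  define H where "H p = Re (snd (fst p)) * X (m p) + Im (snd (fst p)) * Y (m p)" for p
  have H: "smooth_on G H"
    unfolding H_def by (intro smooth_intros mG X Y)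
  define a where "a z = integral (cbox 0 1) (\<lambda>t. H (z, t))" for z
  have a: "smooth_on ?S a" unfolding a_def by (rule smooth_on_integral[OF S G SG H])
  have key: "pd (0, c) a z = Re c * X z + Im c * Y z" if z: "z \<in> ?S" for c z
  proof -
    have "pd (0, c) a z = integral (cbox 0 1) (\<lambda>t. pd ((0, c), 0) H (z, t))"
      unfolding a_def by (rule pd_eqI, rule has_derivative_integral[OF S G SG H z])
    also have "\<dots> = Re c * X z + Im c * Y z"
    proof -
      \<comment> \<open>Closedness turns the derivative of the integrand into the total
        \<open>t\<close>-derivative of \<open>t * (Re c * X + Im c * Y)\<close> along the
        segment.\<close>
      have "((\<lambda>t. t *\<^sub>R (Re c * X (m (z, t)) + Im c * Y (m (z, t)))) has_vector_derivative pd ((0, c), 0) H (z, t)) (at t within {0..1})"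
        if t: "t \<in> {0..1}" for t
      proof -
        have mS: "m (z, t) \<in> ?S" proof -
          have "(z, t) \<in> ?S \<times> cbox 0 1" using z t by auto
          then show ?thesis using SG unfolding G_def by blast
        qed
        have 1: "((\<lambda>y. f (m (y, t))) has_derivative (\<lambda>v. pd (fst v, of_real t * snd v) f (m (z, t)))) (at z)"
          if f: "smooth_on ?S f" for f :: "complex2 \<Rightarrow> real"
        proof -
          have "((\<lambda>y. m (y, t)) has_derivative (\<lambda>v. (fst v, of_real t * snd v))) (at z)"
            unfolding m_def by (auto intro!: derivative_eq_intros)
          from has_derivative_compose[OF this has_derivative_pd[OF S f mS]] show ?thesis .
        qed
        have dH: "((\<lambda>y. H (y, t)) has_derivative (\<lambda>v.
            (Re (snd z) * pd (fst v, of_real t * snd v) X (m (z, t)) + Re (snd v) * X (m (z, t)))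
          + (Im (snd z) * pd (fst v, of_real t * snd v) Y (m (z, t)) + Im (snd v) * Y (m (z, t))))) (at z)"
          unfolding H_def by (auto intro!: derivative_eq_intros 1 X Y)
        have pdH: "pd ((0, c), 0) H (z, t) =
           (Re (snd z) * pd (0, of_real t * c) X (m (z, t)) + Re c * X (m (z, t)))
          + (Im (snd z) * pd (0, of_real t * c) Y (m (z, t)) + Im c * Y (m (z, t)))"
          proof -
          have "(z, t) \<in> G" using mS by (simp add: G_def)
          from pd_Pair_zero[OF G H this] pd_eqI[OF dH] show ?thesis by simp
        qed
        have 2: "((\<lambda>t. f (m (z, t))) has_vector_derivative pd (0, snd z) f (m (z, t))) (at t within {0..1})"
          if f: "smooth_on ?S f" for f :: "complex2 \<Rightarrow> real"
          using pd_along_line[OF S f, of "(fst z, 0)" t "(0, snd z)" "{0..1}"] mS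
          by (simp add: m_def scaleR_conv_of_real)
        have "((\<lambda>t. t *\<^sub>R (Re c * X (m (z, t)) + Im c * Y (m (z, t)))) has_vector_derivative
           t *\<^sub>R (Re c * pd (0, snd z) X (m (z, t)) + Im c * pd (0, snd z) Y (m (z, t)))
           + 1 *\<^sub>R (Re c * X (m (z, t)) + Im c * Y (m (z, t)))) (at t within {0..1})"
          by (intro has_vector_derivative_scaleR has_vector_derivative_add
              has_vector_derivative_mult_right 2 X Y DERIV_ident)
        also have "t *\<^sub>R (Re c * pd (0, snd z) X (m (z, t)) + Im c * pd (0, snd z) Y (m (z, t)))
           + 1 *\<^sub>R (Re c * X (m (z, t)) + Im c * Y (m (z, t))) = pd ((0, c), 0) H (z, t)"
          unfolding pdH
          using pd_snd_decompose[OF S X mS, of "of_real t * c"] pd_snd_decompose[OF S Y mS, of "of_real t * c"]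
            pd_snd_decompose[OF S X mS, of "snd z"] pd_snd_decompose[OF S Y mS, of "snd z"] closed[OF mS]
          by (simp add: algebra_simps)
        finally show ?thesis .
      qed
      then have "((\<lambda>t. pd ((0, c), 0) H (z, t)) has_integral
        1 *\<^sub>R (Re c * X (m (z, 1)) + Im c * Y (m (z, 1))) - 0 *\<^sub>R (Re c * X (m (z, 0)) + Im c * Y (m (z, 0)))) {0..1}"
        by (intro fundamental_theorem_of_calculus) auto
      then show ?thesis by (simp add: integral_unique m_def)
    qed
    finally show ?thesis .
  qed
  show thesis by (rule that[OF a]) (simp_all add: key)
qed


section \<open>Extension from an annulus to a disk\<close>

text \<open>
  The coefficients of \<open>dx\<^sub>2 \<and> dy\<^sub>2 + dd\<^sup>cg + d(a dx\<^sub>1 + b dy\<^sub>1) + c dx\<^sub>1 \<and> dy\<^sub>1\<close>.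
\<close>

definition coeff_A ::
  "(complex2 \<Rightarrow> real) \<Rightarrow> (complex2 \<Rightarrow> real) \<Rightarrow> (complex2 \<Rightarrow> real) \<Rightarrow> (complex2 \<Rightarrow> real) \<Rightarrow> complex2 \<Rightarrow> real" where
  "coeff_A g a b c = (\<lambda>z. Dx1 (Dx1 g) z + Dy1 (Dy1 g) z + Dx1 b z - Dy1 a z + c z)"

definition coeff_D :: "(complex2 \<Rightarrow> real) \<Rightarrow> complex2 \<Rightarrow> real" where
  "coeff_D g = (\<lambda>z. 1 + Dx2 (Dx2 g) z + Dy2 (Dy2 g) z)"

definition coeff_P :: "(complex2 \<Rightarrow> real) \<Rightarrow> (complex2 \<Rightarrow> real) \<Rightarrow> complex2 \<Rightarrow> real" where
  "coeff_P g a = (\<lambda>z. Dx2 (Dy1 g) z - Dy2 (Dx1 g) z - Dx2 a z)"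

definition coeff_Q :: "(complex2 \<Rightarrow> real) \<Rightarrow> (complex2 \<Rightarrow> real) \<Rightarrow> complex2 \<Rightarrow> real" where
  "coeff_Q g a = (\<lambda>z. Dx2 (Dx1 g) z + Dy2 (Dy1 g) z - Dy2 a z)"

lemmas coeff_defs = coeff_A_def coeff_D_def coeff_P_def coeff_Q_def

lemma pd_commute3:
  fixes f :: "'a::real_normed_vector \<Rightarrow> 'b::banach"
  assumes "open S" "smooth_on S f" "z \<in> S"
  shows "pd u (pd v (pd w f)) z = pd v (pd w (pd u f)) z"
proof -
  have "pd u (pd v (pd w f)) z = pd v (pd u (pd w f)) z"
    by (rule pd_commute[OF assms(1) smooth_on_pd[OF assms(1,2)] assms(3)])
  also have "\<dots> = pd v (pd w (pd u f)) z"
    by (rule pd_cong[OF assms(1,3)], rule pd_commute[OF assms(1,2)])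
  finally show ?thesis .
qed

lemma smooth_on_coeffs:
  assumes "open S" "smooth_on S g" "smooth_on S a" "smooth_on S b" "smooth_on S c"
  shows "smooth_on S (coeff_A g a b c)" "smooth_on S (coeff_D g)"
    "smooth_on S (coeff_P g a)" "smooth_on S (coeff_Q g a)"
  unfolding coeff_defs by (intro smooth_intros assms)+

lemma coeffs_cong:
  assumes S: "open S" "z \<in> S" and "\<And>x. x \<in> S \<Longrightarrow> g x = g' x" "\<And>x. x \<in> S \<Longrightarrow> a x = a' x"
    "\<And>x. x \<in> S \<Longrightarrow> b x = b' x" "\<And>x. x \<in> S \<Longrightarrow> c x = c' x"
  shows "coeff_A g a b c z = coeff_A g' a' b' c' z" "coeff_D g z = coeff_D g' z"
    "coeff_P g a z = coeff_P g' a' z" "coeff_Q g a z = coeff_Q g' a' z"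
proof -
  have 1: "pd u g x = pd u g' x" "pd u a x = pd u a' x" "pd u b x = pd u b' x" if "x \<in> S" for u x
    by (rule pd_cong[OF S(1) that]; fact assms)+
  have 2: "pd v (pd u g) z = pd v (pd u g') z" for u v
    by (rule pd_cong[OF S], rule 1)
  show "coeff_A g a b c z = coeff_A g' a' b' c' z" "coeff_D g z = coeff_D g' z"
    "coeff_P g a z = coeff_P g' a' z" "coeff_Q g a z = coeff_Q g' a' z"
    unfolding coeff_defs 1[OF S(2)] 2 assms(6)[OF S(2)] by (rule refl)+
qed

text \<open>
  The equations for \<open>a\<close> and \<open>b\<close> say that \<open>d(a dx\<^sub>1 + b dy\<^sub>1)\<close> is of type \<open>(1,1)\<close>.
\<close>

lemma closed11_coeffs:
  assumes S: "open S" and s: "smooth_on S g" "smooth_on S a" "smooth_on S b" "smooth_on S c"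
    and ab: "\<And>z. z \<in> S \<Longrightarrow> Dy2 b z = Dx2 a z" "\<And>z. z \<in> S \<Longrightarrow> Dx2 b z = - Dy2 a z"
    and c: "\<And>z. z \<in> S \<Longrightarrow> Dx2 c z = 0" "\<And>z. z \<in> S \<Longrightarrow> Dy2 c z = 0"
  shows "closed11 S (coeff_A g a b c) (coeff_D g) (coeff_P g a) (coeff_Q g a)"
  unfolding closed11_def
proof (intro ballI conjI)
  fix z assume z: "z \<in> S"
  note sp = s s[THEN smooth_on_pd[OF S]] s(1)[THEN smooth_on_pd[OF S], THEN smooth_on_pd[OF S]]
  note sm = smooth_on_add smooth_on_diff smooth_on_const sp
  note pds = coeff_defs pd_add[OF S _ _ z] pd_diff[OF S _ _ z] sm pd_const
  note g3 = pd_commute3[OF S s(1) z]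
  note g2 = pd_commute[OF S smooth_on_pd[OF S s(1)] z]
  note a2 = pd_commute[OF S s(2) z] and b2 = pd_commute[OF S s(3) z]
  have yb: "pd u (Dy2 b) z = pd u (Dx2 a) z" for u by (rule pd_cong[OF S z ab(1)])
  have xb: "pd u (Dx2 b) z = - pd u (Dy2 a) z" for u
  proof -
    have "pd u (Dx2 b) z = pd u (\<lambda>x. - Dy2 a x) z" by (rule pd_cong[OF S z ab(2)])
    then show ?thesis by (simp only: pd_uminus[OF S smooth_on_pd[OF S s(2)] z])
  qed
  \<comment> \<open>In all four equations the terms in \<open>g\<close> cancel by symmetry of third
    derivatives, and those in \<open>a\<close> and \<open>b\<close> by symmetry of second
    derivatives together with the differentiated hypotheses \<open>xb\<close> and \<open>yb\<close>.
    The term \<open>c\<close> enters the last two only, through its vanishing derivatives in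
    \<open>z\<^sub>2\<close>.\<close>
  show "Dx1 (coeff_D g) z = Dx2 (coeff_Q g a) z - Dy2 (coeff_P g a) z"
    using g3[of "(1, 0)" "(0, 1)" "(0, 1)"] g3[of "(1, 0)" "(0, \<i>)" "(0, \<i>)"]
      g2[of "(0, 1)" "(0, \<i>)" "(\<i>, 0)"] a2[of "(0, 1)" "(0, \<i>)"]
    by (simp_all only: pds)
  show "Dy1 (coeff_D g) z = Dx2 (coeff_P g a) z + Dy2 (coeff_Q g a) z"
    using g3[of "(\<i>, 0)" "(0, 1)" "(0, 1)"] g3[of "(\<i>, 0)" "(0, \<i>)" "(0, \<i>)"]
      g2[of "(0, 1)" "(0, \<i>)" "(1, 0)"] b2[of "(0, 1)" "(0, \<i>)"] yb[of "(0, 1)"] xb[of "(0, \<i>)"]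
    by (simp_all only: pds)
  show "Dx2 (coeff_A g a b c) z = Dx1 (coeff_Q g a) z + Dy1 (coeff_P g a) z"
    using g2[of "(0, 1)" "(1, 0)" "(1, 0)"] g2[of "(0, 1)" "(\<i>, 0)" "(\<i>, 0)"]
      g3[of "(1, 0)" "(0, \<i>)" "(\<i>, 0)"] g2[of "(\<i>, 0)" "(0, \<i>)" "(1, 0)"]
      b2[of "(0, 1)" "(1, 0)"] xb[of "(1, 0)"] a2[of "(0, 1)" "(\<i>, 0)"] c(1)[OF z]
    by (simp_all only: pds)
  show "Dy2 (coeff_A g a b c) z = Dy1 (coeff_Q g a) z - Dx1 (coeff_P g a) z"
    using g2[of "(0, \<i>)" "(1, 0)" "(1, 0)"] g2[of "(0, \<i>)" "(\<i>, 0)" "(\<i>, 0)"]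
      g3[of "(1, 0)" "(0, 1)" "(\<i>, 0)"] g2[of "(\<i>, 0)" "(0, 1)" "(1, 0)"]
      b2[of "(0, \<i>)" "(1, 0)"] yb[of "(1, 0)"] a2[of "(0, \<i>)" "(\<i>, 0)"] c(2)[OF z]
    by (simp_all only: pds)
qed

lemma pd_zero_if_constant_along_line:
  assumes "open S" "smooth_on S f" "z \<in> S" "\<And>t. f (z + t *\<^sub>R u) = f z"
  shows "pd u f z = 0"
proof -
  have "((\<lambda>t. f (z + t *\<^sub>R u)) has_vector_derivative pd u f (z + 0 *\<^sub>R u)) (at 0)"
    by (rule pd_along_line[OF assms(1,2)]) (use assms(3) in simp)
  then have "((\<lambda>t. f z) has_vector_derivative pd u f z) (at 0)" by (simp add: assms(4))
  then show ?thesis using vector_derivative_unique_at[OF _ has_vector_derivative_const] by metis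
qed

text \<open>The unknowns are found in the order \<open>f\<close>, then \<open>a\<close> and
  \<open>b\<close>, then \<open>c\<close>; at each stage closedness of the given form and of the
  part already matched is the integrability condition for the next. Only the Poisson equation costs
  a part of the disk.\<close>

lemma kahler_coeffs_annulus_potential:
  assumes R: "open R" and d: "0 < d" and k: "kahler_coeffs (R \<times> ball 0 d) A D P Q"
  obtains f a b c where "smooth_on (R \<times> ball 0 (d / 2)) f" "smooth_on (R \<times> ball 0 (d / 2)) a"
    "smooth_on (R \<times> ball 0 (d / 2)) b" "smooth_on (R \<times> ball 0 (d / 2)) c"
    "\<And>z. z \<in> R \<times> ball 0 (d / 2) \<Longrightarrow> Dy2 b z = Dx2 a z \<and> Dx2 b z = - Dy2 a z \<and> Dx2 c z = 0 \<and> Dy2 c z = 0"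
    "\<And>z. z \<in> R \<times> ball 0 (d / 2) \<Longrightarrow>
      A z = coeff_A f a b c z \<and> D z = coeff_D f z \<and> P z = coeff_P f a z \<and> Q z = coeff_Q f a z"
proof -
  let ?S = "R \<times> ball (0 :: complex) (d / 2)"
  have S: "open ?S" using R by (simp add: open_Times)
  have sub: "?S \<subseteq> R \<times> ball 0 d" using d by auto
  have s: "smooth_on ?S A" "smooth_on ?S D" "smooth_on ?S P" "smooth_on ?S Q"
    using k smooth_on_subset[OF _ sub] by (auto simp: kahler_coeffs_def)
  have cl: "Dx1 D z = Dx2 Q z - Dy2 P z" "Dy1 D z = Dx2 P z + Dy2 Q z"
     "Dx2 A z = Dx1 Q z + Dy1 P z" "Dy2 A z = Dy1 Q z - Dx1 P z" if "z \<in> ?S" for z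
    using k sub that unfolding kahler_coeffs_def closed11_def by blast+
  obtain f where f: "smooth_on (R \<times> UNIV) f" "\<And>z. z \<in> ?S \<Longrightarrow> Dx2 (Dx2 f) z + Dy2 (Dy2 f) z = D z - 1"
  proof (rule poisson_snd_solution_exists[OF R, of "d / 2" d "\<lambda>z. D z - 1"])
    show "smooth_on (R \<times> ball 0 d) (\<lambda>z. D z - 1)"
      using k by (intro smooth_intros) (auto simp: kahler_coeffs_def)
  qed (use d in auto)
  have fS: "smooth_on ?S f" by (rule smooth_on_subset[OF f(1)]) auto
  let ?o = "\<lambda>z :: complex2. 0 :: real"
  note o = smooth_on_const[of ?S "0 :: real"]
  have D: "D z = coeff_D f z" if "z \<in> ?S" for z using f(2)[OF that] by (simp add: coeff_D_def)
  have pdD: "pd u D z = pd u (coeff_D f) z" if "z \<in> ?S" for u z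
    by (rule pd_cong[OF S that D])
  have cl0: "closed11 ?S (coeff_A f ?o ?o ?o) (coeff_D f) (coeff_P f ?o) (coeff_Q f ?o)"
    by (rule closed11_coeffs[OF S fS o o o]) simp_all
  define P1 where "P1 z = P z - coeff_P f ?o z" for z
  define Q1 where "Q1 z = Q z - coeff_Q f ?o z" for z
  note sc = smooth_on_coeffs[OF S fS o o o]
  have s1: "smooth_on ?S P1" "smooth_on ?S Q1"
    unfolding P1_def Q1_def by (intro smooth_intros s sc)+
  have pdP1: "pd u P1 z = pd u P z - pd u (coeff_P f ?o) z" and pdQ1: "pd u Q1 z = pd u Q z - pd u (coeff_Q f ?o) z"
    if "z \<in> ?S" for u z
    unfolding P1_def Q1_def by (intro pd_diff[OF S _ _ that] s sc)+
  \<comment> \<open>The given form and the \<open>f\<close> part are closed with the same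
    \<open>D\<close>, so subtracting the closedness equations leaves the Cauchy-Riemann equations in
    \<open>z\<^sub>2\<close> for \<open>Q1 + \<i> P1\<close>.\<close>
  have cr: "Dx2 Q1 z = Dy2 P1 z" "Dx2 P1 z = - Dy2 Q1 z" if z: "z \<in> ?S" for z
  proof -
    have "Dx1 (coeff_D f) z = Dx2 (coeff_Q f ?o) z - Dy2 (coeff_P f ?o) z"
      "Dy1 (coeff_D f) z = Dx2 (coeff_P f ?o) z + Dy2 (coeff_Q f ?o) z"
      using cl0 z unfolding closed11_def by blast+
    then show "Dx2 Q1 z = Dy2 P1 z" "Dx2 P1 z = - Dy2 Q1 z"
      using cl(1,2)[OF z] pdD[OF z] unfolding pdP1[OF z] pdQ1[OF z] by simp_all
  qed
  have pdm: "pd u (\<lambda>z. - F z) z = - pd u F z" if "z \<in> ?S" "smooth_on ?S F" for u z and F :: "complex2 \<Rightarrow> real"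
    by (rule pd_uminus[OF S that(2,1)])
  \<comment> \<open>The signs are dictated by \<open>coeff_P\<close> and \<open>coeff_Q\<close>. The
    function \<open>b\<close> below is the conjugate harmonic function: \<open>a + \<i> b\<close> is
    holomorphic in \<open>z\<^sub>2\<close>.\<close>
  obtain a where a: "smooth_on ?S a" "\<And>z. z \<in> ?S \<Longrightarrow> Dx2 a z = - P1 z" "\<And>z. z \<in> ?S \<Longrightarrow> Dy2 a z = - Q1 z"
    by (rule closed_snd_primitive_exists[OF R, of "d / 2" "\<lambda>z. - P1 z" "\<lambda>z. - Q1 z"])
       (simp_all add: pdm s1 cr smooth_on_minus)
  obtain b where b: "smooth_on ?S b" "\<And>z. z \<in> ?S \<Longrightarrow> Dx2 b z = Q1 z" "\<And>z. z \<in> ?S \<Longrightarrow> Dy2 b z = - P1 z"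
    by (rule closed_snd_primitive_exists[OF R, of "d / 2" "Q1" "\<lambda>z. - P1 z"])
       (simp_all add: pdm s1 cr smooth_on_minus)
  have P: "P z = coeff_P f a z" and Q: "Q z = coeff_Q f a z" if z: "z \<in> ?S" for z
    using a(2,3)[OF z] by (simp_all add: coeff_P_def coeff_Q_def P1_def Q1_def)
  have pdP: "pd u P z = pd u (coeff_P f a) z" and pdQ: "pd u Q z = pd u (coeff_Q f a) z"
    if "z \<in> ?S" for u z
    by (rule pd_cong[OF S that P], assumption, rule pd_cong[OF S that Q])
  have cl1: "closed11 ?S (coeff_A f a b ?o) (coeff_D f) (coeff_P f a) (coeff_Q f a)"
    by (rule closed11_coeffs[OF S fS a(1) b(1) o]) (simp_all add: a b)
  \<comment> \<open>What remains of \<open>A\<close> once \<open>D\<close>, \<open>P\<close> and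
    \<open>Q\<close> are matched. Two closed forms with these three coefficients in common have the
    same \<open>z\<^sub>2\<close>-derivatives of \<open>A\<close>.\<close>
  define c where "c z = A z - coeff_A f a b ?o z" for z
  note sA = smooth_on_coeffs(1)[OF S fS a(1) b(1) o]
  have pdc: "pd u c z = pd u A z - pd u (coeff_A f a b ?o) z" if "z \<in> ?S" for u z
    unfolding c_def by (intro pd_diff[OF S _ _ that] s sA)
  have "Dx2 c z = 0" "Dy2 c z = 0" if z: "z \<in> ?S" for z
  proof -
    have "Dx2 (coeff_A f a b ?o) z = Dx1 (coeff_Q f a) z + Dy1 (coeff_P f a) z"
      "Dy2 (coeff_A f a b ?o) z = Dy1 (coeff_Q f a) z - Dx1 (coeff_P f a) z"
      using cl1 z unfolding closed11_def by blast+
    then show "Dx2 c z = 0" "Dy2 c z = 0"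
      unfolding pdc[OF z] cl(3,4)[OF z] pdP[OF z] pdQ[OF z] by simp_all
  qed
  moreover have "A z = coeff_A f a b c z" for z by (simp add: c_def coeff_A_def)
  moreover have "smooth_on ?S c" unfolding c_def by (intro smooth_intros s sA)
  ultimately show thesis
    using that[OF fS a(1) b(1)] a b D P Q by simp
qed


section \<open>Cutting off in the first variable\<close>

definition cut_extend :: "complex set \<Rightarrow> (complex2 \<Rightarrow> real) \<Rightarrow> (complex2 \<Rightarrow> real) \<Rightarrow> complex2 \<Rightarrow> real" where
  "cut_extend R X f = (\<lambda>z. if fst z \<in> R then X z * f z else 0)"

text \<open>The disk in \<open>z\<^sub>2\<close> shrinks twice: to radius \<open>d / 2\<close> for
  the potentials, and to \<open>d / 4\<close> so that the bound \<open>K\<close> can be taken on a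
  compact set inside the domain.\<close>

lemma kahler_coeffs_extend:
  fixes d :: real
  defines "R \<equiv> {w. 1 - d < cmod w \<and> cmod w < 1}"
  assumes d: "0 < d" "d < 1" and k: "kahler_coeffs (R \<times> ball 0 d) A D P Q"
  obtains \<rho> \<epsilon> A' D' P' Q' where "1 - d < \<rho>" "\<rho> < 1" "0 < \<epsilon>" "\<epsilon> < d" "kahler_coeffs (ball 0 1 \<times> ball 0 \<epsilon>) A' D' P' Q'"
    "\<And>z. \<rho> < cmod (fst z) \<Longrightarrow> cmod (fst z) < 1 \<Longrightarrow> cmod (snd z) < \<epsilon> \<Longrightarrow>
       A' z = A z \<and> D' z = D z \<and> P' z = P z \<and> Q' z = Q z"
proof -
  have R: "open R"
    unfolding R_def by (intro open_Collect_conj open_Collect_less continuous_intros)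
  let ?e = "d / 2"
  define S where "S = R \<times> ball (0::complex) ?e"
  define S' where "S' = ball (0::complex) 1 \<times> ball (0::complex) ?e"
  have S: "open S" "open S'" using R by (auto simp: S_def S'_def open_Times)
  obtain f a b c where s: "smooth_on S f" "smooth_on S a" "smooth_on S b" "smooth_on S c"
    and abc: "\<And>z. z \<in> S \<Longrightarrow> Dy2 b z = Dx2 a z \<and> Dx2 b z = - Dy2 a z \<and> Dx2 c z = 0 \<and> Dy2 c z = 0"
    and eq: "\<And>z. z \<in> S \<Longrightarrow> A z = coeff_A f a b c z \<and> D z = coeff_D f z \<and> P z = coeff_P f a z \<and> Q z = coeff_Q f a z"
    using kahler_coeffs_annulus_potential[OF R d(1) k] unfolding S_def by blast
  \<comment> \<open>Four radii dividing the interval from \<open>1 - d\<close> to 1 into fifths: the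
    cutoff \<open>X\<close> rises between \<open>\<rho> 1\<close> and \<open>\<rho> 2\<close>, the
    compact set reaches to \<open>\<rho> 3\<close>, and \<open>h\<close> vanishes from
    \<open>\<rho> 4\<close> on.\<close>
  define \<rho> where "\<rho> i = 1 - d * (1 - real i / 5)" for i
  have \<rho>: "1 - d < \<rho> 1" "\<rho> 1 < \<rho> 2" "\<rho> 2 < \<rho> 3" "\<rho> 3 < \<rho> 4" "\<rho> 4 < 1" "0 < \<rho> 1"
    using d by (auto simp: \<rho>_def)
  have "(\<rho> 1)\<^sup>2 < (\<rho> 2)\<^sup>2" using \<rho> by (intro power_strict_mono) auto
  then obtain \<theta> :: "real \<Rightarrow> real" where \<theta>: "smooth_on UNIV \<theta>" "\<And>x. x \<le> (\<rho> 1)\<^sup>2 \<Longrightarrow> \<theta> x = 0"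
    "\<And>x. (\<rho> 2)\<^sup>2 \<le> x \<Longrightarrow> \<theta> x = 1" "\<And>x. 0 \<le> \<theta> x" "\<And>x. \<theta> x \<le> 1"
    using smooth_cutoff_exists by metis
  \<comment> \<open>Squared moduli are used because the modulus itself is not smooth at 0.\<close>
  define X where "X z = \<theta> ((Re (fst z))\<^sup>2 + (Im (fst z))\<^sup>2)" for z :: complex2
  define h where "h z = flat 0 ((\<rho> 4)\<^sup>2 - ((Re (fst z))\<^sup>2 + (Im (fst z))\<^sup>2))" for z :: complex2
  have X: "smooth_on T X" for T
    unfolding X_def power2_eq_square by (intro smooth_on_compose[OF \<theta>(1)] smooth_intros) auto
  have h: "smooth_on T h" for T
    unfolding h_def power2_eq_square by (intro smooth_on_compose[OF smooth_on_flat[of UNIV]] smooth_intros) auto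
  have X0: "X z = 0" if "cmod (fst z) \<le> \<rho> 1" for z
    using that \<theta>(2) by (simp add: X_def cmod_power2[symmetric] power_mono)
  have X1: "X z = 1" if "\<rho> 2 \<le> cmod (fst z)" for z
    using that \<theta>(3) \<rho> by (simp add: X_def cmod_power2[symmetric] power_mono)
  have h_pos: "0 < h z" if "cmod (fst z) < \<rho> 4" for z
    using power_strict_mono[OF that, of 2] by (simp add: h_def flat_def cmod_power2[symmetric])
  have h0: "h z = 0" if "\<rho> 4 \<le> cmod (fst z)" for z
  proof -
    have "0 \<le> \<rho> 4" using \<rho> by linarith
    from power_mono[OF that this, of 2] show ?thesis
      by (simp add: h_def flat_def cmod_power2[symmetric])
  qed
  have h_nonneg: "0 \<le> h z" for z by (simp add: h_def flat_def)
  have pdX: "pd (0, v) X z = 0" and pdh: "pd (0, v) h z = 0" for v z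
    by (rule pd_zero_if_constant_along_line[OF open_UNIV]; (intro X h)?; simp add: X_def h_def)+
  \<comment> \<open>The functions to be cut off are controlled over \<open>R\<close> only. Since
    \<open>X\<close> vanishes for moduli up to \<open>\<rho> 1\<close>, the extension by 0 is smooth
    across the inner edge of the annulus, and it commutes with derivatives in
    \<open>z\<^sub>2\<close>.\<close>
  let ?E = "cut_extend R X"
  define S0 where "S0 = ball (0::complex) (\<rho> 1) \<times> ball (0::complex) ?e"
  have S0: "open S0" by (simp add: S0_def open_Times)
  have S'_eq: "S' = S \<union> S0"
    using \<rho> by (auto simp: S'_def S_def S0_def R_def)
  have E_S: "?E F z = X z * F z" if "z \<in> S" for F z using that by (auto simp: cut_extend_def S_def)
  have E_S0: "?E F z = 0" if "z \<in> S0" for F z using that X0[of z] by (auto simp: cut_extend_def S0_def)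
  have smE: "smooth_on S' (?E F)" if "smooth_on S F" for F
    unfolding S'_eq
  proof (rule smooth_on_Un[OF S(1) S0])
    show "smooth_on S (?E F)"
      by (rule smooth_on_cong[OF S(1), of "\<lambda>z. X z * F z"]) (auto simp: E_S intro!: smooth_intros X that)
    show "smooth_on S0 (?E F)"
      by (rule smooth_on_cong[OF S0, of "\<lambda>z. 0"]) (auto simp: E_S0 intro!: smooth_intros)
  qed
  have pdE: "pd (0, v) (?E F) z = ?E (pd (0, v) F) z" if F: "smooth_on S F" and z: "z \<in> S'" for v F z
  proof (cases "z \<in> S")
    case True
    have "pd (0, v) (?E F) z = pd (0, v) (\<lambda>z. X z * F z) z" by (rule pd_cong[OF S(1) True E_S])
    also have "\<dots> = X z * pd (0, v) F z"
      by (subst pd_mult[OF S(1) X F True]) (simp add: pdX)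
    finally show ?thesis using E_S[OF True] by simp
  next
    case False
    then have z0: "z \<in> S0" using z S'_eq by blast
    have "pd (0, v) (?E F) z = pd (0, v) (\<lambda>z. 0) z" by (rule pd_cong[OF S0 z0 E_S0])
    then show ?thesis using E_S0[OF z0] by simp
  qed
  have E_cong: "?E F z = ?E F' z" if "\<And>z. z \<in> S \<Longrightarrow> F z = F' z" "z \<in> S'" for F F' z
    using that E_S E_S0 S'_eq by (metis UnE)
  have pdE2: "pd (0, v) (pd (0, u) (?E F)) z = ?E (pd (0, v) (pd (0, u) F)) z" if F: "smooth_on S F" and z: "z \<in> S'" for u v F z
  proof -
    have "pd (0, v) (pd (0, u) (?E F)) z = pd (0, v) (?E (pd (0, u) F)) z"
      by (rule pd_cong[OF S(2) z pdE[OF F]])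
    then show ?thesis using pdE[OF smooth_on_pd[OF S(1) F] z] by simp
  qed
  define A0 where "A0 = coeff_A (?E f) (?E a) (?E b) (?E c)"
  define D' where "D' = coeff_D (?E f)"
  define P' where "P' = coeff_P (?E f) (?E a)"
  define Q' where "Q' = coeff_Q (?E f) (?E a)"
  have sm': "smooth_on S' A0" "smooth_on S' D'" "smooth_on S' P'" "smooth_on S' Q'"
    unfolding A0_def D'_def P'_def Q'_def
    by (fact smooth_on_coeffs[OF S(2) smE[OF s(1)] smE[OF s(2)] smE[OF s(3)] smE[OF s(4)]])+
  have D'_pos: "0 < D' z" if z: "z \<in> S'" for z
  proof (cases "z \<in> S")
    case True
    \<comment> \<open>Derivatives in \<open>z\<^sub>2\<close> pass through the cutoff, so
      \<open>D'\<close> is the convex combination of 1 and \<open>D\<close> with weight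
      \<open>X\<close>.\<close>
    have "D' z = 1 + (X z * Dx2 (Dx2 f) z + X z * Dy2 (Dy2 f) z)"
      by (simp add: D'_def coeff_D_def pdE2[OF s(1) z] E_S[OF True])
    also have "\<dots> = (1 - X z) + X z * D z"
      using eq[OF True] by (simp add: coeff_D_def algebra_simps)
    finally have eqD: "D' z = (1 - X z) + X z * D z" .
    have "z \<in> R \<times> ball 0 d" using True d by (auto simp: S_def)
    then have "0 < D z" using k by (auto simp: kahler_coeffs_def)
    moreover have "0 \<le> X z" "X z \<le> 1" using \<theta> by (auto simp: X_def)
    ultimately show ?thesis unfolding eqD
      by (cases "X z = 0") (auto intro: add_nonneg_pos)
  next
    case False
    then have "z \<in> S0" using z S'_eq by blast
    then show ?thesis by (simp add: D'_def coeff_D_def pdE2[OF s(1) z] E_S0)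
  qed
  define S3 where "S3 = {w. \<rho> 2 < cmod w \<and> cmod w < 1} \<times> ball (0::complex) ?e"
  have S3: "open S3"
    unfolding S3_def by (intro open_Times open_Collect_conj open_Collect_less continuous_intros open_ball)
  have S3_sub: "S3 \<subseteq> S" using \<rho> by (auto simp: S3_def S_def R_def)
  have E3: "?E F z = F z" if "z \<in> S3" for F z
    using E_S[of z F] that S3_sub X1[of z] by (auto simp: S3_def)
  have eq3: "A0 z = A z" "D' z = D z" "P' z = P z" "Q' z = Q z" if "z \<in> S3" for z
  proof -
    have "z \<in> S" using that S3_sub by blast
    note eqz = eq[OF this]
    note cc = coeffs_cong[OF S3 that, of "?E f" f "?E a" a "?E b" b "?E c" c]
    show "A0 z = A z" "D' z = D z" "P' z = P z" "Q' z = Q z"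
      unfolding A0_def D'_def P'_def Q'_def using cc[OF E3 E3 E3 E3] eqz by simp_all
  qed
  define C where "C = cball (0::complex) (\<rho> 3) \<times> cball (0::complex) (d / 4)"
  have C: "compact C" by (simp add: C_def compact_Times)
  have C_sub: "C \<subseteq> S'" using \<rho> d by (auto simp: C_def S'_def)
  \<comment> \<open>The multiple of \<open>h\<close> that has to be added to \<open>A0\<close> for
    equality in the determinant condition; any \<open>K\<close> above it makes the inequality
    strict.\<close>
  define \<psi> where "\<psi> z = (((P' z)\<^sup>2 + (Q' z)\<^sup>2) / D' z - A0 z) / h z" for z
  have nz: "D' z \<noteq> 0" "h z \<noteq> 0" if "z \<in> C" for z
  proof -
    show "D' z \<noteq> 0" using D'_pos[of z] C_sub that by fastforce
    have "cmod (fst z) < \<rho> 4" using that \<rho>(4) by (cases z) (simp add: C_def)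
    then show "h z \<noteq> 0" using h_pos[of z] by simp
  qed
  note sC = sm'[THEN smooth_on_subset, OF C_sub, THEN smooth_on_imp_continuous_on]
  have "continuous_on C \<psi>"
    unfolding \<psi>_def
    by (intro continuous_on_divide continuous_on_diff continuous_on_add continuous_on_power sC
        smooth_on_imp_continuous_on[OF h] ballI nz)
  then have "bounded (\<psi> ` C)" using C compact_continuous_image compact_imp_bounded by blast
  then obtain K where K: "0 < K" "\<And>z. z \<in> C \<Longrightarrow> \<bar>\<psi> z\<bar> < K"
    unfolding bounded_pos_less by auto
  \<comment> \<open>The correction is absorbed into the term \<open>c\<close>: being a function of
    \<open>z\<^sub>1\<close> alone it satisfies the same equations, so
    \<open>closed11_coeffs\<close> applies unchanged.\<close>
  define A' where "A' = coeff_A (?E f) (?E a) (?E b) (\<lambda>z. ?E c z + K * h z)"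
  have A': "A' z = A0 z + K * h z" for z by (simp add: A'_def A0_def coeff_A_def)
  have sc: "smooth_on S' (\<lambda>z. ?E c z + K * h z)" by (intro smooth_intros smE s h)
  have pdc: "pd (0, v) (\<lambda>z. ?E c z + K * h z) z = ?E (pd (0, v) c) z" if z: "z \<in> S'" for v z
  proof -
    have "pd (0, v) (\<lambda>z. ?E c z + K * h z) z = pd (0, v) (?E c) z + pd (0, v) (\<lambda>z. K * h z) z"
      by (rule pd_add[OF S(2) _ _ z]) (intro smooth_intros smE s h)+
    also have "pd (0, v) (\<lambda>z. K * h z) z = K * pd (0, v) h z"
      by (rule pd_linear_image[OF bounded_linear_mult_right S(2) h z])
    finally show ?thesis using pdE[OF s(4) z] by (simp add: pdh)
  qed
  have Em: "?E (\<lambda>z. - F z) z = - ?E F z" and E0: "?E (\<lambda>z. 0) z = 0" for F z by (auto simp: cut_extend_def)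
  have cl: "closed11 S' A' D' P' Q'"
    unfolding A'_def D'_def P'_def Q'_def
  proof (rule closed11_coeffs[OF S(2)])
    fix z assume z: "z \<in> S'"
    show "Dy2 (?E b) z = Dx2 (?E a) z"
      unfolding pdE[OF s(3) z] pdE[OF s(2) z] by (rule E_cong[OF _ z]) (simp add: abc)
    have "?E (Dx2 b) z = ?E (\<lambda>z. - Dy2 a z) z" by (rule E_cong[OF _ z]) (simp add: abc)
    then show "Dx2 (?E b) z = - Dy2 (?E a) z"
      unfolding pdE[OF s(3) z] pdE[OF s(2) z] Em .
    have "?E (Dx2 c) z = ?E (\<lambda>z. 0) z" "?E (Dy2 c) z = ?E (\<lambda>z. 0) z"
      by (rule E_cong[OF _ z], simp add: abc)+
    then show "Dx2 (\<lambda>z. ?E c z + K * h z) z = 0" "Dy2 (\<lambda>z. ?E c z + K * h z) z = 0"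
      unfolding pdc[OF z] E0 .
  qed (intro smE s sc)+
  let ?T = "ball (0::complex) 1 \<times> ball (0::complex) (d / 4)"
  have T: "?T \<subseteq> S'" using d by (auto simp: S'_def)
  \<comment> \<open>Up to \<open>\<rho> 3\<close> the choice of \<open>K\<close> gives positivity.
    Beyond it the cutoff equals 1, so the coefficients are the original ones except that
    \<open>A\<close> has not decreased.\<close>
  have pos: "(P' z)\<^sup>2 + (Q' z)\<^sup>2 < A' z * D' z" if z: "z \<in> ?T" for z
  proof (cases "cmod (fst z) \<le> \<rho> 3")
    case True
    then have zC: "z \<in> C" using z by (cases z) (auto simp: C_def)
    have hz: "0 < h z" using True \<rho> by (intro h_pos) auto
    have Dz: "0 < D' z" using D'_pos z T by blast
    have "\<psi> z < K" using K(2)[OF zC] by simp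
    then have "((P' z)\<^sup>2 + (Q' z)\<^sup>2) / D' z < A' z"
      unfolding \<psi>_def A' using hz by (simp add: pos_divide_less_eq)
    then show ?thesis using Dz by (simp add: pos_divide_less_eq)
  next
    case False
    then have z3: "z \<in> S3" using z \<rho> d by (cases z) (auto simp: S3_def)
    have "z \<in> R \<times> ball 0 d" using z3 S3_sub d by (auto simp: S_def)
    then have kz: "0 < D z" "(P z)\<^sup>2 + (Q z)\<^sup>2 < A z * D z" using k by (auto simp: kahler_coeffs_def)
    have "A z * D z \<le> A' z * D' z"
      unfolding A' eq3[OF z3] using kz(1) K(1) h_nonneg[of z] by (intro mult_right_mono) auto
    then show ?thesis using kz(2) unfolding eq3[OF z3] by linarith
  qed
  show thesis
  proof (rule that[of "\<rho> 4" "d / 4" A' D' P' Q'])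
    have "smooth_on S' A'" unfolding A' [abs_def] by (intro smooth_intros sm' h)
    then show "kahler_coeffs ?T A' D' P' Q'"
      unfolding kahler_coeffs_def
      using sm' smooth_on_subset[OF _ T] cl T D'_pos pos unfolding closed11_def by blast
    show "A' z = A z \<and> D' z = D z \<and> P' z = P z \<and> Q' z = Q z"
      if "\<rho> 4 < cmod (fst z)" "cmod (fst z) < 1" "cmod (snd z) < d / 4" for z
    proof -
      have "z \<in> S3" using that \<rho> d by (cases z) (auto simp: S3_def)
      from eq3[OF this] show ?thesis using h0[of z] that by (simp add: A')
    qed
  qed (use \<rho> d in auto)
qed

lemma kahler_on_subset:
  assumes "kahler_on S \<eta>" "T \<subseteq> S"
  shows "kahler_on T \<eta>"
proof (rule kahler_onI)
  show "smooth_on T (\<lambda>z. \<eta> z v w)" for v w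
    using smooth_on_subset[OF kahler_onD(1)[OF assms(1)] assms(2)] .
next
  fix z u v w assume "z \<in> T"
  then have z: "z \<in> S" using assms(2) by blast
  show "bilinear (\<eta> z)" "\<eta> z v v = 0" "ext_deriv \<eta> z u v w = 0" "\<eta> z (J v) (J w) = \<eta> z v w"
    by (rule kahler_onD[OF assms(1)], rule z)+
  show "\<eta> z v (J v) > 0" if "v \<noteq> 0"
    by (rule kahler_onD[OF assms(1)]) (fact z that)+
qed

section \<open>From a tube around the attaching circle to the whole handle\<close>

lemma tube_around_attaching_circle:
  assumes "open G" "attaching_circle \<subseteq> G"
  obtains d where "0 < d" "d < 1" "\<And>z. 1 - d < cmod (fst z) \<Longrightarrow> cmod (fst z) < 1 + d \<Longrightarrow> cmod (snd z) < d \<Longrightarrow> z \<in> G"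
proof -
  have "attaching_circle = sphere 0 1 \<times> {0}"
    by (auto simp: attaching_circle_def)
  moreover have "compact (sphere (0::complex) 1 \<times> {0::complex})" by (intro compact_Times) auto
  ultimately have "compact attaching_circle" by simp
  then obtain e where e: "e > 0" "(\<Union>x\<in>attaching_circle. ball x e) \<subseteq> G"
    using compact_subset_open_imp_ball_epsilon_subset assms by metis
  define d where "d = min (e / 2) (1 / 2)"
  show thesis
  proof (rule that[of d])
    fix z assume z: "1 - d < cmod (fst z)" "cmod (fst z) < 1 + d" "cmod (snd z) < d"
    \<comment> \<open>The radial projection to the circle; both components of the difference are
      smaller than \<open>d\<close>, which is at most \<open>e / 2\<close>. The bound
      \<open>d \<le> 1 / 2\<close> keeps \<open>fst z\<close> away from 0.\<close>
    let ?p = "(sgn (fst z), 0 :: complex)"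
    have nz: "fst z \<noteq> 0" using z(1) by (auto simp: d_def)
    have "fst z - sgn (fst z) = (cmod (fst z) - 1) *\<^sub>R sgn (fst z)"
      using nz by (simp add: sgn_div_norm algebra_simps)
    then have "cmod (fst z - sgn (fst z)) = \<bar>cmod (fst z) - 1\<bar>"
      using nz by (simp add: norm_sgn)
    then have "norm (z - ?p) < d + d"
      using norm_Pair_le[of "fst (z - ?p)" "snd (z - ?p)"] z by (simp add: minus_prod_def)
    also have "\<dots> \<le> e" by (simp add: d_def)
    finally have "z \<in> ball ?p e" by (simp add: dist_norm norm_minus_commute)
    moreover have "?p \<in> attaching_circle" using nz by (simp add: attaching_circle_def norm_sgn)
    ultimately show "z \<in> G" using e(2) by blast
  qed (use e in \<open>auto simp: d_def\<close>)
qed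

lemma kahler_extend_over_handle:
  assumes G: "open G" "attaching_circle \<subseteq> G" and k: "kahler_on G \<eta>"
  shows "\<forall>\<^sub>F a in at_top. 1 \<le> a \<and> (\<exists>Q \<Omega>. open Q \<and> concave_handle a \<subseteq> Q \<and> {x \<in> G. 1 - 1 / a < cmod (fst x)} \<subseteq> Q \<and>
     kahler_on Q \<Omega> \<and> (\<forall>x\<in>G. 1 - 1 / a < cmod (fst x) \<longrightarrow> \<Omega> x = \<eta> x))"
proof -
  obtain d where d: "0 < d" "d < 1"
    and tube: "\<And>z. 1 - d < cmod (fst z) \<Longrightarrow> cmod (fst z) < 1 + d \<Longrightarrow> cmod (snd z) < d \<Longrightarrow> z \<in> G"
    using tube_around_attaching_circle[OF G] by blast
  let ?R = "{w. 1 - d < cmod w \<and> cmod w < 1}"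
  have "open ?R"
    by (intro open_Collect_conj open_Collect_less continuous_intros)
  then have R: "open (?R \<times> ball (0::complex) d)" by (intro open_Times open_ball)
  have "?R \<times> ball 0 d \<subseteq> G" using tube d by auto
  then have "kahler_on (?R \<times> ball 0 d) \<eta>" using k kahler_on_subset by blast
  then obtain A D P Q where kc: "kahler_coeffs (?R \<times> ball 0 d) A D P Q"
    and eq: "\<And>z. z \<in> ?R \<times> ball 0 d \<Longrightarrow> \<eta> z = form11 (A z) (D z) (P z) (Q z)"
    using kahler_on_coeffs[OF R] by blast
  obtain \<rho> \<epsilon> A' D' P' Q' where \<rho>: "1 - d < \<rho>" "\<rho> < 1" and \<epsilon>: "0 < \<epsilon>" "\<epsilon> < d"
    and k': "kahler_coeffs (ball 0 1 \<times> ball 0 \<epsilon>) A' D' P' Q'"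
    and eq': "\<And>z. \<rho> < cmod (fst z) \<Longrightarrow> cmod (fst z) < 1 \<Longrightarrow> cmod (snd z) < \<epsilon> \<Longrightarrow>
       A' z = A z \<and> D' z = D z \<and> P' z = P z \<and> Q' z = Q z"
    using kahler_coeffs_extend[OF d kc] by blast
  \<comment> \<open>On \<open>Q1\<close> the given form is kept; on \<open>Q2\<close> the extended
    one is used. They overlap only where \<rho> is less than \<open>cmod (fst z)\<close> and this is
    less than 1, and there the coefficients agree.\<close>
  define Q1 where "Q1 = G \<inter> {z. \<rho> < cmod (fst z)}"
  define Q2 where "Q2 = ball (0::complex) 1 \<times> ball (0::complex) \<epsilon>"
  have "open Q1" unfolding Q1_def by (intro open_Int G(1) open_Collect_less continuous_intros)
  moreover have "open Q2" by (simp add: Q2_def open_Times)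
  ultimately have op: "open Q1" "open Q2" .
  define \<Omega> where "\<Omega> z = (if z \<in> Q1 then \<eta> z else form11 (A' z) (D' z) (P' z) (Q' z))" for z
  have "kahler_on Q1 \<Omega>"
    by (rule kahler_on_cong[OF op(1), of \<eta>]) (use k kahler_on_subset in \<open>auto simp: Q1_def \<Omega>_def\<close>)
  moreover have "kahler_on Q2 \<Omega>"
  proof (rule kahler_on_cong[OF op(2) kahler_on_form11[OF op(2)]])
    show "kahler_coeffs Q2 A' D' P' Q'" using k' by (simp add: Q2_def)
    fix z assume z: "z \<in> Q2"
    show "form11 (A' z) (D' z) (P' z) (Q' z) = \<Omega> z"
    proof (cases "z \<in> Q1")
      case True
      then have "\<rho> < cmod (fst z)" "cmod (fst z) < 1" "cmod (snd z) < \<epsilon>" "z \<in> ?R \<times> ball 0 d"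
        using z \<rho> \<epsilon> by (auto simp: Q1_def Q2_def)
      then show ?thesis using eq[of z] eq'[of z] True by (simp add: \<Omega>_def)
    qed (simp add: \<Omega>_def)
  qed
  ultimately have k\<Omega>: "kahler_on (Q1 \<union> Q2) \<Omega>" using kahler_on_Un[OF op] by blast
  \<comment> \<open>The bound 4 makes \<open>cmod (fst z)\<close> at most 2 on the handle and its
    square divided by \<open>a\<close> at most 1. With \<open>2 - ln \<epsilon>\<close> the handle
    is then thinner than \<epsilon>. From \<open>1 / d + 1\<close> comes the strict
    \<open>1 / a < d\<close>, so the part of the handle over moduli at least 1 lies in the tube, and
    \<open>1 / (1 - \<rho>)\<close> moves the gluing zone beyond \<rho>.\<close>
  have "\<forall>\<^sub>F a in at_top. max (max 4 (2 - ln \<epsilon>)) (max (1 / d + 1) (1 / (1 - \<rho>))) \<le> a"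
    by (rule eventually_ge_at_top)
  then show ?thesis
  proof (rule eventually_mono)
    fix a assume "max (max 4 (2 - ln \<epsilon>)) (max (1 / d + 1) (1 / (1 - \<rho>))) \<le> a"
    then have a: "4 \<le> a" "2 - ln \<epsilon> \<le> a" "1 / d < a" "1 / (1 - \<rho>) \<le> a" by auto
    have a_d: "1 / a < d" using a(1,3) d by (simp add: field_simps)
    have a_\<rho>: "\<rho> \<le> 1 - 1 / a"
    proof -
      have "1 \<le> a * (1 - \<rho>)" using a(4) \<rho> by (simp add: pos_divide_le_eq)
      then have "1 / a \<le> 1 - \<rho>" using a(1) by (simp add: pos_divide_le_eq mult.commute)
      then show ?thesis by simp
    qed
    have "concave_handle a \<subseteq> Q1 \<union> Q2"
    proof
      fix z assume z: "z \<in> concave_handle a"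
      then have z1: "cmod (fst z) \<le> 1 + 1 / a" and z2: "cmod (snd z) \<le> exp ((cmod (fst z))\<^sup>2 / a - a)"
        by (auto simp: concave_handle_def)
      have "1 / a \<le> 1" using a(1) by simp
      then have "cmod (fst z) \<le> 2" using z1 by simp
      then have "(cmod (fst z))\<^sup>2 \<le> 2\<^sup>2" by (intro power_mono) auto
      then have "(cmod (fst z))\<^sup>2 / a \<le> 1" using a(1) by (simp add: pos_divide_le_eq)
      then have "(cmod (fst z))\<^sup>2 / a - a < ln \<epsilon>" using a(2) by simp
      then have "exp ((cmod (fst z))\<^sup>2 / a - a) < \<epsilon>" using \<epsilon>(1) by (metis exp_less_mono exp_ln)
      then have z2: "cmod (snd z) < \<epsilon>" using z2 by simp
      show "z \<in> Q1 \<union> Q2"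
      proof (cases "cmod (fst z) < 1")
        case True
        then show ?thesis using z2 by (cases z) (auto simp: Q2_def)
      next
        case False
        then have "z \<in> G" using z1 z2 a_d \<epsilon> d by (intro tube) auto
        then show ?thesis using False \<rho> by (auto simp: Q1_def)
      qed
    qed
    moreover have "{x \<in> G. 1 - 1 / a < cmod (fst x)} \<subseteq> Q1" using a_\<rho> by (auto simp: Q1_def)
    ultimately show "1 \<le> a \<and> (\<exists>Q \<Omega>. open Q \<and> concave_handle a \<subseteq> Q \<and> {x \<in> G. 1 - 1 / a < cmod (fst x)} \<subseteq> Q \<and>
       kahler_on Q \<Omega> \<and> (\<forall>x\<in>G. 1 - 1 / a < cmod (fst x) \<longrightarrow> \<Omega> x = \<eta> x))"
      using op k\<Omega> a(1)
      by (intro conjI exI[of _ "Q1 \<union> Q2"] exI[of _ \<Omega>]) (auto simp: \<Omega>_def)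
  qed
qed


section \<open>Holomorphic maps\<close>

text \<open>Complex scalar multiplication; as a bounded bilinear map over the reals it fits the
  calculus above.\<close>

definition cscale :: "complex \<Rightarrow> complex2 \<Rightarrow> complex2" where
  "cscale c v = (c * fst v, c * snd v)"

lemma J_eq_cscale: "J = cscale \<i>"
  by (simp add: J_def cscale_def fun_eq_iff)

lemma norm_cscale: "norm (cscale c v) = cmod c * norm v"
  by (simp add: cscale_def norm_Pair norm_mult power_mult_distrib real_sqrt_mult
      flip: distrib_left) (simp add: norm_prod_def)

lemma bounded_bilinear_cscale: "bounded_bilinear cscale"
proof
  show "\<exists>K. \<forall>c v. norm (cscale c v) \<le> norm c * norm v * K"
    by (intro exI[of _ 1]) (simp add: norm_cscale)
qed (simp_all add: cscale_def algebra_simps plus_prod_def scaleR_prod_def)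

lemma complex_linear_cscale:
  assumes "linear T" "\<And>v. T (J v) = J (T v)"
  shows "T (cscale c v) = cscale c (T v)"
proof -
  have eq: "cscale c v = Re c *\<^sub>R v + Im c *\<^sub>R J v" for v
    by (simp add: cscale_def J_def prod_eq_iff complex_eq_iff)
  show ?thesis unfolding eq by (simp only: linear_add[OF assms(1)] linear_cmul[OF assms(1)] assms(2))
qed

lemma holomorphic2_onD:
  assumes "holomorphic2_on S f" "z \<in> S"
  shows "(f has_derivative (\<lambda>v. pd v f z)) (at z)" "pd (cscale c v) f z = cscale c (pd v f z)"
proof -
  obtain T where T: "(f has_derivative T) (at z)" "\<And>v. T (J v) = J (T v)"
    using assms unfolding holomorphic2_on_def by blast
  have eq: "pd v f z = T v" for v by (rule pd_eqI[OF T(1)])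
  show "(f has_derivative (\<lambda>v. pd v f z)) (at z)" unfolding eq using T(1) by simp
  show "pd (cscale c v) f z = cscale c (pd v f z)"
    unfolding eq using complex_linear_cscale[OF has_derivative_linear[OF T(1)] T(2)] .
qed

lemma holomorphic2_on_subset: "holomorphic2_on S f \<Longrightarrow> T \<subseteq> S \<Longrightarrow> holomorphic2_on T f"
  unfolding holomorphic2_on_def by blast

lemma holomorphic2_on_imp_continuous_on: "holomorphic2_on S f \<Longrightarrow> continuous_on S f"
  by (rule has_derivative_continuous_on, rule has_derivative_at_withinI, rule holomorphic2_onD)

section \<open>Cauchy's formula on complex lines and smoothness of holomorphic maps\<close>

lemma cauchy_formula_component:
  fixes L :: "complex2 \<Rightarrow> complex"
  assumes L: "bounded_linear L" "\<And>c v. L (cscale c v) = c * L v"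
    and f: "holomorphic2_on S f" and r: "0 < r"
    and S: "\<And>c. cmod c \<le> r \<Longrightarrow> z + cscale c v \<in> S"
  shows "L (pd v f z) = integral (cbox 0 1)
    (\<lambda>t. L (cscale (cis (- (2 * pi * t)) / r) (f (z + cscale (r * cis (2 * pi * t)) v))))"
proof -
  \<comment> \<open>A component of \<open>f\<close> on the complex line through \<open>z\<close> in
    direction \<open>v\<close>. It is a holomorphic function of one variable, whose derivative at 0
    is given by the classical formula on the circle of radius \<open>r\<close>.\<close>
  define g where "g c = L (f (z + cscale c v))" for c
  have dg: "(g has_field_derivative L (pd v f (z + cscale c v))) (at c)" if "cmod c \<le> r" for c
  proof -
    have "((\<lambda>c. z + cscale c v) has_derivative (\<lambda>h. cscale h v)) (at c)"
      using has_derivative_add[OF has_derivative_const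
          bounded_linear_imp_has_derivative[OF bounded_bilinear.bounded_linear_left[OF bounded_bilinear_cscale]]]
      by simp
    from has_derivative_compose[OF this holomorphic2_onD(1)[OF f S[OF that]]]
    have "(g has_derivative (\<lambda>h. L (pd (cscale h v) f (z + cscale c v)))) (at c)"
      unfolding g_def by (rule bounded_linear.has_derivative[OF L(1)])
    then show ?thesis
      by (simp add: has_field_derivative_def holomorphic2_onD(2)[OF f S[OF that]] L(2) mult.commute[of _ "L _"])
  qed
  have "g holomorphic_on cball 0 r"
    unfolding holomorphic_on_def field_differentiable_def
    by (intro ballI exI, rule has_field_derivative_at_within, rule dg) simp
  then have "(g has_field_derivative (1 / (2 * of_real pi * \<i>) * contour_integral (circlepath 0 r) (\<lambda>u. g u / (u - 0)\<^sup>2))) (at 0)"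
    using r by (intro Cauchy_derivative_integral_circlepath(2))
      (auto intro: holomorphic_on_imp_continuous_on holomorphic_on_subset)
  from DERIV_unique[OF this dg[of 0]] r
  have "L (pd v f z) = 1 / (2 * of_real pi * \<i>) * contour_integral (circlepath 0 r) (\<lambda>u. g u / (u - 0)\<^sup>2)"
    by (simp add: cscale_def zero_prod_def[symmetric])
  also have "\<dots> = 1 / (2 * of_real pi * \<i>) * integral {0..1} (\<lambda>t. (2 * of_real pi * \<i>) *
      L (cscale (cis (- (2 * pi * t)) / r) (f (z + cscale (r * cis (2 * pi * t)) v))))"
  proof -
    have e: "exp (2 * of_real pi * \<i> * of_real t) = cis (2 * pi * t)" for t
      by (simp add: cis_conv_exp mult_ac)
    have ci: "cis (- x) = inverse (cis x)" for x by (simp add: cis_inverse)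
    have "g (circlepath 0 r t) / (circlepath 0 r t - 0)\<^sup>2 * vector_derivative (circlepath 0 r) (at t)
      = (2 * of_real pi * \<i>) * L (cscale (cis (- (2 * pi * t)) / r) (f (z + cscale (r * cis (2 * pi * t)) v)))" for t
    proof -
      have cp: "circlepath 0 r t = of_real r * cis (2 * pi * t)" by (simp add: circlepath e)
      have vd: "vector_derivative (circlepath 0 r) (at t) = 2 * of_real pi * \<i> * of_real r * cis (2 * pi * t)"
        by (simp add: vector_derivative_circlepath e)
      have alg: "x / (of_real r * c)\<^sup>2 * (2 * of_real pi * \<i> * of_real r * c)
          = (2 * of_real pi * \<i>) * (inverse c / of_real r * x)" if "c \<noteq> 0" for x c :: complex
        using r that by (simp add: power2_eq_square field_simps)
      show ?thesis
        by (simp only: cp vd ci L(2) g_def diff_zero alg[OF cis_neq_zero])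
    qed
    then show ?thesis unfolding contour_integral_integral by simp
  qed
  also have "\<dots> = integral (cbox 0 1) (\<lambda>t. L (cscale (cis (- (2 * pi * t)) / r) (f (z + cscale (r * cis (2 * pi * t)) v))))"
    by simp
  finally show ?thesis .
qed

lemma cauchy_formula:
  assumes f: "holomorphic2_on S f" and r: "0 < r"
    and S: "\<And>c. cmod c \<le> r \<Longrightarrow> z + cscale c v \<in> S"
  shows "pd v f z = integral (cbox 0 1)
    (\<lambda>t. cscale (cis (- (2 * pi * t)) / r) (f (z + cscale (r * cis (2 * pi * t)) v)))" (is "_ = integral _ ?I")
proof -
  note cont_cs = bounded_bilinear.continuous_on[OF bounded_bilinear_cscale]
  have "continuous_on (cbox 0 1) ?I"
  proof (intro cont_cs continuous_on_compose2[OF holomorphic2_on_imp_continuous_on[OF f]] continuous_intros)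
    show "(\<lambda>t. z + cscale (r * cis (2 * pi * t)) v) ` cbox 0 1 \<subseteq> S"
      using r by (auto intro!: S simp: norm_mult)
  qed (use r in auto)
  then have I: "?I integrable_on cbox 0 1" by (rule integrable_continuous)
  have "fst (pd v f z) = fst (integral (cbox 0 1) ?I)" "snd (pd v f z) = snd (integral (cbox 0 1) ?I)"
    using cauchy_formula_component[OF bounded_linear_fst _ f r S] integral_linear[OF I bounded_linear_fst]
      cauchy_formula_component[OF bounded_linear_snd _ f r S] integral_linear[OF I bounded_linear_snd]
    by (simp_all add: cscale_def o_def)
  then show ?thesis by (simp add: prod_eq_iff)
qed

text \<open>One radius serves all centres near \<open>z\<close>, so that Cauchy's formula can be
  treated as an integral with the centre as a parameter.\<close>

lemma cauchy_radius:
  assumes "open S" "z \<in> S"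
  obtains e r where "0 < e" "0 < r" "\<And>x c. x \<in> ball z e \<Longrightarrow> cmod c \<le> r \<Longrightarrow> x + cscale c v \<in> S"
proof -
  obtain d where d: "d > 0" "ball z d \<subseteq> S" using assms openE by blast
  define r where "r = d / (2 * (norm v + 1))"
  have n: "0 < norm v + 1" by (simp add: add_nonneg_pos)
  have r: "0 < r" unfolding r_def using d n by simp
  show thesis
  proof (rule that[of "d / 2" r])
    fix x c assume x: "x \<in> ball z (d / 2)" and c: "cmod c \<le> r"
    have "norm (cscale c v) = cmod c * norm v" by (rule norm_cscale)
    also have "\<dots> \<le> r * (norm v + 1)" using c r by (intro mult_mono) auto
    also have "\<dots> = d / 2" using n by (simp add: r_def field_simps)
    finally have "norm (cscale c v) \<le> d / 2" .
    moreover have "dist z (x + cscale c v) \<le> dist z x + norm (cscale c v)"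
      by (metis add_diff_cancel_left' dist_norm dist_triangle norm_minus_commute)
    ultimately show "x + cscale c v \<in> S" using x d(2) by auto
  qed (use d r in auto)
qed

text \<open>Cauchy's formula expresses the derivative through values of \<open>f\<close> on a
  circle, and these depend continuously on the centre. This continuity is what permits
  differentiating under the integral afterwards.\<close>

lemma holomorphic2_on_Ck_1:
  assumes S: "open S" and f: "holomorphic2_on S f"
  shows "Ck_on (Suc 0) S f"
proof (rule Ck_on_SucI)
  show "(f has_derivative (\<lambda>v. pd v f x)) (at x)" if "x \<in> S" for x by (rule holomorphic2_onD[OF f that])
  show "Ck_on 0 S (\<lambda>x. pd v f x)" for v
  proof (rule Ck_on_local)
    fix z assume "z \<in> S"
    then obtain e r where er: "0 < e" "0 < r" and in_S: "\<And>x c. x \<in> ball z e \<Longrightarrow> cmod c \<le> r \<Longrightarrow> x + cscale c v \<in> S"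
      using cauchy_radius[OF S] by blast
    note cont_cs = bounded_bilinear.continuous_on[OF bounded_bilinear_cscale]
    have "continuous_on (ball z e) (\<lambda>x. integral (cbox 0 1)
      (\<lambda>t. cscale (cis (- (2 * pi * t)) / r) (f (x + cscale (r * cis (2 * pi * t)) v))))"
    proof (rule integral_continuous_on_param, unfold case_prod_beta,
        intro cont_cs continuous_on_compose2[OF holomorphic2_on_imp_continuous_on[OF f]] continuous_intros)
      show "(\<lambda>p. fst p + cscale (r * cis (2 * pi * snd p)) v) ` (ball z e \<times> cbox 0 1) \<subseteq> S"
        using er by (auto intro!: in_S simp: norm_mult)
    qed (use er in auto)
    then have "continuous_on (ball z e) (pd v f)"
      by (rule continuous_on_eq) (rule cauchy_formula[OF f er(2) in_S, symmetric])
    then show "\<exists>T. open T \<and> z \<in> T \<and> Ck_on 0 T (\<lambda>x. pd v f x)"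
      using er by (intro exI[of _ "ball z e"]) simp
  qed
qed

text \<open>Cauchy's formula is differentiated in its centre. The derivative of the integrand is
  complex linear because that of \<open>f\<close> is, and integration preserves this. Iterating the
  result gives derivatives of all orders.\<close>

lemma holomorphic2_on_pd:
  assumes S: "open S" and f: "holomorphic2_on S f"
  shows "holomorphic2_on S (pd v f)"
  unfolding holomorphic2_on_def
proof
  fix z assume "z \<in> S"
  then obtain e r where er: "0 < e" "0 < r" and in_S: "\<And>x c. x \<in> ball z e \<Longrightarrow> cmod c \<le> r \<Longrightarrow> x + cscale c v \<in> S"
    using cauchy_radius[OF S] by blast
  define m where "m p = fst p + cscale (of_real r * cis (2 * pi * snd p)) v" for p :: "complex2 \<times> real"
  define k where "k t = cis (- (2 * pi * t)) / of_real r" for t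
  define H where "H p = cscale (k (snd p)) (f (m p))" for p
  define G where "G = {p. m p \<in> S}"
  have m: "smooth_on UNIV m" and k: "smooth_on UNIV (\<lambda>p. k (snd p))"
    unfolding m_def k_def divide_inverse
    by (intro smooth_intros smooth_on_bilinear[OF bounded_bilinear_cscale])+
  have G: "open G"
    unfolding G_def using open_vimage[OF S] smooth_on_imp_continuous_on[OF m] by (simp add: vimage_def)
  have BG: "ball z e \<times> cbox 0 1 \<subseteq> G"
    using er in_S by (auto simp: G_def m_def norm_mult)
  have H: "Ck_on (Suc 0) G H"
    unfolding H_def
  proof (intro Ck_on_bilinear[OF bounded_bilinear_cscale] Ck_on_compose[OF holomorphic2_on_Ck_1[OF S f]])
    show "Ck_on (Suc 0) G (\<lambda>p. k (snd p))" "Ck_on (Suc 0) G m"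
      using m k smooth_on_subset unfolding smooth_on_def by blast+
  qed (auto simp: G_def)
  define T where "T = (\<lambda>w. integral (cbox 0 1) (\<lambda>t. pd (w, 0) H (z, t)))"
  have "((\<lambda>x. integral (cbox 0 1) (\<lambda>t. H (x, t))) has_derivative T) (at z)"
    unfolding T_def using er by (intro Ck_on_one_has_derivative_integral[OF _ G BG H]) auto
  then have dT: "(pd v f has_derivative T) (at z)"
  proof (rule has_derivative_transform_within_open[of _ _ _ _ "ball z e"])
    fix x assume x: "x \<in> ball z e"
    show "integral (cbox 0 1) (\<lambda>t. H (x, t)) = pd v f x"
      unfolding H_def k_def m_def fst_conv snd_conv by (rule cauchy_formula[OF f er(2) in_S[OF x], symmetric])
  qed (use er in auto)
  note H_iff = Ck_on_Suc_iff[OF G, THEN iffD1, OF H, unfolded frechet_derivative_works Ck_on.simps]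
  have dH: "(H has_derivative (\<lambda>w. pd w H p)) (at p)" if "p \<in> G" for p
    using H_iff that unfolding pd_def by blast
  have cH: "continuous_on G (pd w H)" for w
    using H_iff unfolding pd_def by blast
  have pdH: "pd (w, 0) H (z, t) = cscale (k t) (pd w f (m (z, t)))" if t: "t \<in> cbox 0 1" for w t
  proof -
    have zt: "(z, t) \<in> G" by (rule subsetD[OF BG]) (use er t in auto)
    have "((\<lambda>y. (y, t)) has_derivative (\<lambda>v. (v, 0))) (at z)"
      by (intro has_derivative_Pair has_derivative_ident has_derivative_const)
    from has_derivative_compose[OF this dH[OF zt]]
    have 1: "((\<lambda>y. H (y, t)) has_derivative (\<lambda>w. pd (w, 0) H (z, t))) (at z)" .
    have "((\<lambda>y. m (y, t)) has_derivative (\<lambda>w. w)) (at z)"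
      unfolding m_def by (auto intro!: derivative_eq_intros)
    from has_derivative_compose[OF this holomorphic2_onD(1)[OF f]] zt
    have "((\<lambda>y. f (m (y, t))) has_derivative (\<lambda>w. pd w f (m (z, t)))) (at z)" by (simp add: G_def)
    from bounded_linear.has_derivative[OF bounded_bilinear.bounded_linear_right[OF bounded_bilinear_cscale] this]
    have "((\<lambda>y. H (y, t)) has_derivative (\<lambda>w. cscale (k t) (pd w f (m (z, t))))) (at z)"
      by (simp add: H_def)
    from has_derivative_unique[OF 1 this] show ?thesis by metis
  qed
  have "T (J w) = J (T w)" for w
  proof -
    have "continuous_on (cbox 0 1) (\<lambda>t. pd (w, 0) H (z, t))"
      by (rule continuous_on_compose2[OF cH]) (use BG er in \<open>auto intro!: continuous_intros\<close>)
    then have "J (T w) = integral (cbox 0 1) (\<lambda>t. J (pd (w, 0) H (z, t)))"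
      unfolding T_def J_eq_cscale
      using integral_linear[OF integrable_continuous bounded_bilinear.bounded_linear_right[OF bounded_bilinear_cscale]]
      by (metis (no_types, lifting) comp_def integral_cong)
    also have "\<dots> = T (J w)"
      unfolding T_def
    proof (rule integral_cong)
      fix t :: real assume t: "t \<in> cbox 0 1"
      have "(z, t) \<in> G" by (rule subsetD[OF BG]) (use er t in auto)
      then have "m (z, t) \<in> S" by (simp add: G_def)
      then show "J (pd (w, 0) H (z, t)) = pd (J w, 0) H (z, t)"
        unfolding pdH[OF t] J_eq_cscale holomorphic2_onD(2)[OF f]
        using holomorphic2_onD(2)[OF f] by (simp add: cscale_def mult_ac)
    qed
    finally show ?thesis by simp
  qed
  with dT show "\<exists>T. (pd v f has_derivative T) (at z) \<and> (\<forall>v. T (J v) = J (T v))" by blast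
qed

lemma holomorphic2_on_imp_smooth_on:
  assumes "open S" "holomorphic2_on S f"
  shows "smooth_on S f"
proof -
  have "Ck_on k S f" for k
    using assms(2)
  proof (induction k arbitrary: f)
    case 0
    then show ?case by (simp add: holomorphic2_on_imp_continuous_on)
  next
    case (Suc k)
    show ?case
      by (rule Ck_on_SucI, rule holomorphic2_onD(1)[OF Suc.prems], assumption)
        (intro Suc.IH holomorphic2_on_pd assms(1) Suc.prems)
  qed
  then show ?thesis by (simp add: smooth_on_def)
qed

section \<open>Pullback of Kaehler forms\<close>

lemma form11_has_derivative:
  assumes "(A has_derivative A') (at z)" "(D has_derivative D') (at z)" "(P has_derivative P') (at z)"
    "(Q has_derivative Q') (at z)" "(V has_derivative V') (at z)" "(W has_derivative W') (at z)"
  shows "((\<lambda>y. form11 (A y) (D y) (P y) (Q y) (V y) (W y)) has_derivative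
    (\<lambda>u. form11 (A' u) (D' u) (P' u) (Q' u) (V z) (W z)
       + (form11 (A z) (D z) (P z) (Q z) (V' u) (W z) + form11 (A z) (D z) (P z) (Q z) (V z) (W' u)))) (at z)"
  unfolding form11_def
  by (rule has_derivative_eq_rhs, (rule derivative_intros assms)+)
     (simp add: fun_eq_iff algebra_simps)

text \<open>In the exterior derivative the terms with second derivatives of \<open>f\<close> cancel
  in pairs, by symmetry of second derivatives and skew-symmetry of the form; the rest is
  \<open>form11_cocycle\<close> at the image vectors. Complex linearity of the differential gives
  type (1,1), and its injectivity gives positivity.\<close>

lemma kahler_on_pullback:
  assumes S: "open S" and f: "holomorphic2_on S f" and T: "open T" "f ` S \<subseteq> T"
    and k: "kahler_on T \<eta>" and inj: "\<And>z v. z \<in> S \<Longrightarrow> pd v f z = 0 \<Longrightarrow> v = 0"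
  shows "kahler_on S (\<lambda>z v w. \<eta> (f z) (pd v f z) (pd w f z))" (is "kahler_on S ?\<eta>")
proof -
  obtain A D P Q where c: "kahler_coeffs T A D P Q" and eq: "\<And>z. z \<in> T \<Longrightarrow> \<eta> z = form11 (A z) (D z) (P z) (Q z)"
    using kahler_on_coeffs[OF T(1) k] by blast
  have s: "smooth_on T A" "smooth_on T D" "smooth_on T P" "smooth_on T Q"
    using c unfolding kahler_coeffs_def by blast+
  have fs: "smooth_on S f" by (rule holomorphic2_on_imp_smooth_on[OF S f])
  have fT: "f z \<in> T" if "z \<in> S" for z using that T(2) by blast
  let ?F = "\<lambda>z. form11 (A (f z)) (D (f z)) (P (f z)) (Q (f z))"
  have eqF: "?\<eta> z v w = ?F z (pd v f z) (pd w f z)" if "z \<in> S" for z v w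
    by (simp only: eq[OF fT[OF that]])
  note J = holomorphic2_onD(2)[OF f, where c = \<i>, folded J_eq_cscale]
  have lin: "linear (\<lambda>v. pd v f z)" if "z \<in> S" for z by (rule linear_pd[OF S fs that])
  have sF: "smooth_on S (\<lambda>z. ?F z (pd v f z) (pd w f z))" for v w
    unfolding form11_def by (intro smooth_intros smooth_on_compose[OF _ fs T(2)] s S fs)
  show ?thesis
  proof (rule kahler_onI)
    show "smooth_on S (\<lambda>z. ?\<eta> z v w)" for v w
      by (rule smooth_on_cong[OF S sF eqF[symmetric]])
  next
    fix z v w u assume z: "z \<in> S"
    have b: "linear (\<lambda>y. \<eta> (f z) x y)" "linear (\<lambda>y. \<eta> (f z) y x)" for x
      using kahler_onD(2)[OF k fT[OF z]] unfolding bilinear_def by blast+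
    show "bilinear (?\<eta> z)"
      unfolding bilinear_def
      using linear_compose[OF lin[OF z] b(1), unfolded o_def] linear_compose[OF lin[OF z] b(2), unfolded o_def]
      by blast
    show "?\<eta> z v v = 0" by (rule kahler_onD(3)[OF k fT[OF z]])
    show "?\<eta> z (J v) (J w) = ?\<eta> z v w" unfolding J[OF z] by (rule kahler_onD(5)[OF k fT[OF z]])
    show "0 < ?\<eta> z v (J v)" if "v \<noteq> 0"
      unfolding J[OF z] using inj[OF z] that by (intro kahler_onD(6)[OF k fT[OF z]]) blast
    have fd: "frechet_derivative (\<lambda>y. ?\<eta> y v w) (at z) u =
        form11 (pd (pd u f z) A (f z)) (pd (pd u f z) D (f z)) (pd (pd u f z) P (f z)) (pd (pd u f z) Q (f z)) (pd v f z) (pd w f z)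
        + (?F z (pd u (pd v f) z) (pd w f z) + ?F z (pd v f z) (pd u (pd w f) z))" for u v w
    proof -
      have d: "((\<lambda>y. B (f y)) has_derivative (\<lambda>u. pd (pd u f z) B (f z))) (at z)" if "smooth_on T B" for B :: "complex2 \<Rightarrow> real"
        by (rule has_derivative_compose[OF has_derivative_pd[OF S fs z] has_derivative_pd[OF T(1) that fT[OF z]]])
      have "((\<lambda>y. ?F y (pd v f y) (pd w f y)) has_derivative (\<lambda>u.
        form11 (pd (pd u f z) A (f z)) (pd (pd u f z) D (f z)) (pd (pd u f z) P (f z)) (pd (pd u f z) Q (f z)) (pd v f z) (pd w f z)
        + (?F z (pd u (pd v f) z) (pd w f z) + ?F z (pd v f z) (pd u (pd w f) z)))) (at z)"
        by (intro form11_has_derivative d s has_derivative_pd[OF S _ z] smooth_on_pd[OF S fs])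
      then have "((\<lambda>y. ?\<eta> y v w) has_derivative (\<lambda>u.
        form11 (pd (pd u f z) A (f z)) (pd (pd u f z) D (f z)) (pd (pd u f z) P (f z)) (pd (pd u f z) Q (f z)) (pd v f z) (pd w f z)
        + (?F z (pd u (pd v f) z) (pd w f z) + ?F z (pd v f z) (pd u (pd w f) z)))) (at z)"
        by (rule has_derivative_transform_within_open[OF _ S z]) (rule eqF[symmetric])
      then show ?thesis by (rule pd_eqI[unfolded pd_def])
    qed
    have anti: "form11 a b c d v w = - form11 a b c d w v" for a b c d v w
      by (simp add: form11_def algebra_simps)
    show "ext_deriv ?\<eta> z u v w = 0"
      unfolding ext_deriv_def fd
      using form11_cocycle[OF T(1) c fT[OF z], of "pd u f z" "pd v f z" "pd w f z"]
        pd_commute[OF S fs z, of v u] pd_commute[OF S fs z, of w u] pd_commute[OF S fs z, of w v]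
        anti[of _ _ _ _ "pd u (pd v f) z" "pd w f z"]
        anti[of _ _ _ _ "pd u (pd w f) z" "pd v f z"] anti[of _ _ _ _ "pd v (pd w f) z" "pd u f z"]
      by simp
  qed
qed


section \<open>The glued surface\<close>

lemma pulls_backE:
  assumes "pulls_back M \<omega> f S M' \<omega>'" "(D, \<phi>) \<in> atlas M" "(D', \<phi>') \<in> atlas M'" "p \<in> D" "p \<in> S" "f p \<in> D'"
  obtains T where "((\<phi>' \<circ> f \<circ> inv_into D \<phi>) has_derivative T) (at (\<phi> p) within \<phi> ` {q \<in> D \<inter> S. f q \<in> D'})"
    "\<And>v w. \<omega> (D, \<phi>) (\<phi> p) v w = \<omega>' (D', \<phi>') (\<phi>' (f p)) (T v) (T w)"
proof -
  have "p \<in> D \<inter> S" using assms by blast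
  note bspec[OF bspec[OF assms(1)[unfolded pulls_back_def] assms(2), unfolded prod.case] assms(3), unfolded prod.case]
  from bspec[OF this \<open>p \<in> D \<inter> S\<close>, rule_format, OF assms(6)] show thesis using that by blast
qed

lemma kahler_form_onE:
  assumes "kahler_form_on M S \<omega>" "(D, \<phi>) \<in> atlas M"
  obtains Q \<eta> where "open Q" "\<phi> ` (D \<inter> S) \<subseteq> Q" "kahler_on Q \<eta>" "\<forall>z\<in>\<phi> ` (D \<inter> S). \<eta> z = \<omega> (D, \<phi>) z"
  using bspec[OF conjunct1[OF assms(1)[unfolded kahler_form_on_def]] assms(2), unfolded prod.case] that
  by (elim exE conjE)

context
  fixes M :: "'a surface" and N V :: "'a set" and U :: "complex2 set" and F :: "complex2 \<Rightarrow> 'a"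
    and \<omega> :: "'a chart \<Rightarrow> form2"
  assumes M: "complex_surface M" and F: "biholomorphic M U V F"
    and N: "openin (surf_top M) N" and \<omega>: "kahler_form_on M N \<omega>"
begin

lemma chart_facts:
  assumes "(D, \<phi>) \<in> atlas M"
  shows "openin (surf_top M) D" "inj_on \<phi> D"
proof -
  show D: "openin (surf_top M) D" using M assms unfolding complex_surface_def by blast
  have "homeomorphic_map (subtopology (surf_top M) D) (top_of_set (\<phi> ` D)) \<phi>"
    using M assms unfolding complex_surface_def by blast
  then have "inj_on \<phi> (topspace (subtopology (surf_top M) D))" by (rule homeomorphic_imp_injective_map)
  moreover have "topspace (subtopology (surf_top M) D) = D"
    using openin_subset[OF D] by (simp add: Int_absorb1)
  ultimately show "inj_on \<phi> D" by simp
qed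

lemma chart_at:
  assumes "p \<in> topspace (surf_top M)"
  obtains D \<phi> where "(D, \<phi>) \<in> atlas M" "p \<in> D"
  using M assms unfolding complex_surface_def by blast

lemma biholomorphic_facts:
  shows "open U" "inj_on F U" "F ` U = V" "V \<subseteq> topspace (surf_top M)"
    and "openin (surf_top M) E \<Longrightarrow> open {x \<in> U. F x \<in> E}"
proof -
  show U: "open U" and V: "V \<subseteq> topspace (surf_top M)"
    using F openin_subset unfolding biholomorphic_def by blast+
  have h: "homeomorphic_map (top_of_set U) (subtopology (surf_top M) V) F"
    using F unfolding biholomorphic_def by blast
  show "inj_on F U" using homeomorphic_imp_injective_map[OF h] by simp
  show "F ` U = V" using homeomorphic_imp_surjective_map[OF h] V by (simp add: Int_absorb1)
  assume E: "openin (surf_top M) E"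
  have "continuous_map (top_of_set U) (surf_top M) F"
    using homeomorphic_imp_continuous_map[OF h] continuous_map_in_subtopology by blast
  from openin_continuous_map_preimage[OF this E] show "open {x \<in> U. F x \<in> E}"
    using U by (simp add: openin_open_eq)
qed

text \<open>The chain rule for the inverse composed with the map yields a left inverse of the
  differential, which in finite dimension is two-sided. Both directions are needed: one for
  injectivity, the other for expressing \<omega> through the pulled back form.\<close>

lemma chart_F_derivative:
  assumes c: "(D, \<phi>) \<in> atlas M" and x: "x \<in> U" "F x \<in> D"
  shows "((\<phi> \<circ> F) has_derivative (\<lambda>v. pd v (\<phi> \<circ> F) x)) (at x)"
    and "\<exists>T. ((inv_into U F \<circ> inv_into D \<phi>) has_derivative T) (at (\<phi> (F x))) \<and>
      (\<forall>v. T (pd v (\<phi> \<circ> F) x) = v) \<and> (\<forall>v. pd (T v) (\<phi> \<circ> F) x = v)"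
proof -
  have h1: "holomorphic2_on {x \<in> U. F x \<in> D} (\<phi> \<circ> F)"
    and h2: "holomorphic2_on (\<phi> ` (D \<inter> V)) (inv_into U F \<circ> inv_into D \<phi>)"
    using F c unfolding biholomorphic_def by blast+
  show d1: "((\<phi> \<circ> F) has_derivative (\<lambda>v. pd v (\<phi> \<circ> F) x)) (at x)"
    by (rule holomorphic2_onD[OF h1]) (use x in simp)
  have "\<phi> (F x) \<in> \<phi> ` (D \<inter> V)" using x biholomorphic_facts(3) by blast
  then obtain T where T: "((inv_into U F \<circ> inv_into D \<phi>) has_derivative T) (at (\<phi> (F x)))"
    using h2 unfolding holomorphic2_on_def by blast
  have "((\<lambda>y. (inv_into U F \<circ> inv_into D \<phi>) ((\<phi> \<circ> F) y)) has_derivative (\<lambda>v. T (pd v (\<phi> \<circ> F) x))) (at x)"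
    by (rule has_derivative_compose[OF d1 T[folded comp_apply[of \<phi> F x]]])
  then have "((\<lambda>y. y) has_derivative (\<lambda>v. T (pd v (\<phi> \<circ> F) x))) (at x)"
  proof (rule has_derivative_transform_within_open)
    show "open {y \<in> U. F y \<in> D}" by (rule biholomorphic_facts(5)[OF chart_facts(1)[OF c]])
    show "(inv_into U F \<circ> inv_into D \<phi>) ((\<phi> \<circ> F) y) = y" if "y \<in> {y \<in> U. F y \<in> D}" for y
      using that by (simp add: inv_into_f_f[OF chart_facts(2)[OF c]] inv_into_f_f[OF biholomorphic_facts(2)])
  qed (use x in simp)
  from has_derivative_unique[OF this has_derivative_ident]
  have inv: "T (pd v (\<phi> \<circ> F) x) = v" for v by metis
  then have "T \<circ> (\<lambda>v. pd v (\<phi> \<circ> F) x) = id" by (simp add: fun_eq_iff)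
  then have "(\<lambda>v. pd v (\<phi> \<circ> F) x) \<circ> T = id"
    using linear_inverse_left[OF has_derivative_linear[OF T] has_derivative_linear[OF d1]] by blast
  then have "pd (T v) (\<phi> \<circ> F) x = v" for v by (rule pointfree_idE)
  with T inv show "\<exists>T. ((inv_into U F \<circ> inv_into D \<phi>) has_derivative T) (at (\<phi> (F x))) \<and>
      (\<forall>v. T (pd v (\<phi> \<circ> F) x) = v) \<and> (\<forall>v. pd (T v) (\<phi> \<circ> F) x = v)" by blast
qed

section \<open>The Kaehler form in the coordinates of the attaching map\<close>

text \<open>The choice of the chart is immaterial, by \<open>pulled_form_eq\<close>.\<close>

definition pulled_form :: form2 where
  "pulled_form x v w = (let c = (SOME c. c \<in> atlas M \<and> F x \<in> fst c) in
     \<omega> c (snd c (F x)) (pd v (snd c \<circ> F) x) (pd w (snd c \<circ> F) x))"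

text \<open>Compatibility of \<omega> under change of charts supplies the differential
  \<open>T\<close> of the transition map, and by the chain rule \<open>T\<close> carries the
  differential of \<open>\<phi>1 \<circ> F\<close> to that of
  \<open>\<phi> \<circ> F\<close>.\<close>

lemma pulled_form_eq:
  assumes c: "(D, \<phi>) \<in> atlas M" and x: "x \<in> U" "F x \<in> D" "F x \<in> N"
  shows "pulled_form x v w = \<omega> (D, \<phi>) (\<phi> (F x)) (pd v (\<phi> \<circ> F) x) (pd w (\<phi> \<circ> F) x)"
proof -
  define c1 where "c1 = (SOME c. c \<in> atlas M \<and> F x \<in> fst c)"
  have c1: "c1 \<in> atlas M \<and> F x \<in> fst c1"
    unfolding c1_def by (rule someI[of _ "(D, \<phi>)"]) (use c x in simp)
  obtain D1 \<phi>1 where c1_eq: "c1 = (D1, \<phi>1)" by (cases c1)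
  have c1: "(D1, \<phi>1) \<in> atlas M" "F x \<in> D1" using c1 by (auto simp: c1_eq)
  have "pulls_back M \<omega> id N M \<omega>" using \<omega> unfolding kahler_form_on_def by blast
  then obtain T where T: "((\<phi> \<circ> id \<circ> inv_into D1 \<phi>1) has_derivative T) (at (\<phi>1 (F x)) within \<phi>1 ` {q \<in> D1 \<inter> N. id q \<in> D})"
    "\<And>v w. \<omega> (D1, \<phi>1) (\<phi>1 (F x)) v w = \<omega> (D, \<phi>) (\<phi> (id (F x))) (T v) (T w)"
    by (rule pulls_backE[OF _ c1(1) c c1(2)]) (use x in simp_all)
  let ?O = "{y \<in> U. F y \<in> D1 \<inter> D \<inter> N}"
  have O: "open ?O"
    by (rule biholomorphic_facts(5)) (intro openin_Int chart_facts(1)[OF c] chart_facts(1)[OF c1(1)] N)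
  have xO: "x \<in> ?O" using x c1 by simp
  have "((\<phi> \<circ> id \<circ> inv_into D1 \<phi>1) has_derivative T) (at ((\<phi>1 \<circ> F) x) within (\<phi>1 \<circ> F) ` ?O)"
    unfolding comp_apply[of \<phi>1 F x] by (rule has_derivative_subset[OF T(1)]) auto
  from has_derivative_in_compose[OF has_derivative_at_withinI[OF chart_F_derivative(1)[OF c1(1) x(1) c1(2)]] this]
  have "((\<lambda>y. (\<phi> \<circ> id \<circ> inv_into D1 \<phi>1) ((\<phi>1 \<circ> F) y)) has_derivative (\<lambda>v. T (pd v (\<phi>1 \<circ> F) x))) (at x)"
    using at_within_open[OF xO O] by simp
  then have "((\<phi> \<circ> F) has_derivative (\<lambda>v. T (pd v (\<phi>1 \<circ> F) x))) (at x)"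
    by (rule has_derivative_transform_within_open[OF _ O xO])
       (simp add: inv_into_f_f[OF chart_facts(2)[OF c1(1)]])
  then have "pd v (\<phi> \<circ> F) x = T (pd v (\<phi>1 \<circ> F) x)" for v by (rule pd_eqI)
  moreover have "pulled_form x v w = \<omega> (D1, \<phi>1) (\<phi>1 (F x)) (pd v (\<phi>1 \<circ> F) x) (pd w (\<phi>1 \<circ> F) x)"
    unfolding pulled_form_def Let_def c1_def[symmetric] c1_eq by simp
  ultimately show ?thesis using T(2) by simp
qed

lemma open_pulled_domain: "open {x \<in> U. F x \<in> N}"
  by (rule biholomorphic_facts(5)[OF N])

text \<open>Near each point a fixed chart can be used, and there the form is the pullback of a
  Kaehler form under a holomorphic map with invertible differential.\<close>

lemma kahler_on_pulled_form: "kahler_on {x \<in> U. F x \<in> N} pulled_form"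
proof (rule kahler_on_local)
  fix x assume x: "x \<in> {x \<in> U. F x \<in> N}"
  then obtain D \<phi> where c: "(D, \<phi>) \<in> atlas M" "F x \<in> D"
    using chart_at[of "F x"] biholomorphic_facts(3,4) by blast
  let ?O = "{y \<in> U. F y \<in> D \<inter> N}"
  have O: "open ?O" by (rule biholomorphic_facts(5)) (intro openin_Int chart_facts(1)[OF c(1)] N)
  obtain Q \<eta> where Q: "open Q" "\<phi> ` (D \<inter> N) \<subseteq> Q" "kahler_on Q \<eta>" "\<forall>z\<in>\<phi> ` (D \<inter> N). \<eta> z = \<omega> (D, \<phi>) z"
    by (rule kahler_form_onE[OF \<omega> c(1)])
  have "kahler_on ?O (\<lambda>z v w. \<eta> ((\<phi> \<circ> F) z) (pd v (\<phi> \<circ> F) z) (pd w (\<phi> \<circ> F) z))"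
  proof (rule kahler_on_pullback[OF O _ Q(1) _ Q(3)])
    have "holomorphic2_on {x \<in> U. F x \<in> D} (\<phi> \<circ> F)" using F c unfolding biholomorphic_def by blast
    then show "holomorphic2_on ?O (\<phi> \<circ> F)" by (rule holomorphic2_on_subset) blast
    show "(\<phi> \<circ> F) ` ?O \<subseteq> Q" using Q(2) by auto
    fix z v assume z: "z \<in> ?O" and v: "pd v (\<phi> \<circ> F) z = 0"
    obtain T where T: "((inv_into U F \<circ> inv_into D \<phi>) has_derivative T) (at (\<phi> (F z)))" "T (pd v (\<phi> \<circ> F) z) = v"
      using chart_F_derivative(2)[OF c(1), of z] z by blast
    show "v = 0" using T(2) linear_0[OF has_derivative_linear[OF T(1)]] unfolding v by simp
  qed
  then have "kahler_on ?O pulled_form"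
  proof (rule kahler_on_cong[OF O])
    fix z assume z: "z \<in> ?O"
    then have "\<eta> (\<phi> (F z)) = \<omega> (D, \<phi>) (\<phi> (F z))" by (intro bspec[OF Q(4)]) auto
    then show "(\<lambda>v w. \<eta> ((\<phi> \<circ> F) z) (pd v (\<phi> \<circ> F) z) (pd w (\<phi> \<circ> F) z)) = pulled_form z"
      using pulled_form_eq[OF c(1), of z] z by (intro ext) simp
  qed
  then show "\<exists>T. open T \<and> x \<in> T \<and> kahler_on T pulled_form"
    using O x c(2) by blast
qed

text \<open>The new form is \<open>\<Omega>\<close> in the handle chart and \<omega> in the charts
  coming from \<open>M\<close>. These fit together because \<open>\<Omega>\<close> equals
  \<open>pulled_form\<close> over the gluing zone, that is, wherever the handle chart covers points
  of \<open>W\<close>.\<close>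

lemma kahler_form_attach_handle:
  assumes W: "W \<subseteq> N" and a: "1 \<le> a" and Q: "open Q" "concave_handle a \<subseteq> Q"
    "{x \<in> {x \<in> U. F x \<in> N}. 1 - 1 / a < cmod (fst x)} \<subseteq> Q"
    and \<Omega>: "kahler_on Q \<Omega>" "\<And>x. x \<in> {x \<in> U. F x \<in> N} \<Longrightarrow> 1 - 1 / a < cmod (fst x) \<Longrightarrow> \<Omega> x = pulled_form x"
  shows "\<exists>\<omega>'. kahler_form (attach_handle M W U F a) \<omega>' \<and> pulls_back M \<omega> Inl W (attach_handle M W U F a) \<omega>'"
proof -
  let ?H = "attach_handle M W U F a" and ?X = "topspace (surf_top (attach_handle M W U F a))"
  define E where "E = Inl ` (W \<inter> F ` near_attaching a U) \<union> handle_proj W U F a ` concave_handle a"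
  define \<psi> :: "'a + complex2 \<Rightarrow> complex2" where "\<psi> = case_sum (inv_into U F) id"
  have hc: "handle_chart W U F a = (E, \<psi>)" by (simp add: handle_chart_def E_def \<psi>_def)
  define emb :: "'a chart \<Rightarrow> ('a + complex2) chart"
    where "emb = (\<lambda>(D, \<phi>). (Inl ` (D \<inter> W - F ` glue_locus W U F a), \<phi> \<circ> projl))"
  have atlas: "atlas ?H = insert (E, \<psi>) (emb ` atlas M)"
    by (simp add: attach_handle_def hc emb_def)
  have inv_F: "inv_into U F (F x) = x" if "x \<in> U" for x
    using that biholomorphic_facts(2) by simp
  have inv_c: "inv_into D \<phi> (\<phi> p) = p" if "(D, \<phi>) \<in> atlas M" "p \<in> D" for D \<phi> p
    using that chart_facts(2) by simp

  have E_cases: "(\<exists>x\<in>U. q = Inl (F x) \<and> 1 - 1 / a < cmod (fst x) \<and> F x \<in> W \<and> \<psi> q = x)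
      \<or> (\<exists>x\<in>concave_handle a. q = Inr x \<and> x \<notin> glue_locus W U F a \<and> \<psi> q = x)" if "q \<in> E" for q
    using that unfolding E_def
  proof (elim UnE imageE)
    fix w assume "q = Inl w" "w \<in> W \<inter> F ` near_attaching a U"
    then show ?thesis by (auto simp: near_attaching_def \<psi>_def inv_F)
  next
    fix x assume x: "q = handle_proj W U F a x" "x \<in> concave_handle a"
    show ?thesis
    proof (cases "x \<in> glue_locus W U F a")
      case True
      then show ?thesis using x by (auto simp: handle_proj_def glue_locus_def near_attaching_def \<psi>_def inv_F)
    next
      case False
      then show ?thesis using x by (auto simp: handle_proj_def \<psi>_def)
    qed
  qed
  have E_Inl: "\<exists>x\<in>U. w = F x \<and> 1 - 1 / a < cmod (fst x) \<and> F x \<in> W \<and> \<psi> (Inl w) = x" if "Inl w \<in> E" for w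
    using E_cases[OF that] by auto
  \<comment> \<open>A point of \<open>W\<close> and an unidentified point of the handle cannot share
    a coordinate: it would belong to the handle, have modulus above the cut-off and be mapped into
    \<open>W\<close>, so it would lie in \<open>glue_locus\<close>.\<close>
  have \<psi>_inj: "inj_on \<psi> E"
  proof (rule inj_onI)
    fix q q' assume q: "q \<in> E" "q' \<in> E" "\<psi> q = \<psi> q'"
    show "q = q'"
      using E_cases[OF q(1)] E_cases[OF q(2)] q(3)
      by (auto simp: glue_locus_def near_attaching_def)
  qed
  have \<psi>_Q: "\<psi> ` E \<subseteq> Q"
  proof
    fix z assume "z \<in> \<psi> ` E"
    then obtain q where "q \<in> E" "z = \<psi> q" by blast
    then show "z \<in> Q" using E_cases[of q] Q(2,3) W by auto
  qed
  have Inr0: "Inr 0 \<in> E"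
  proof -
    have "0 \<in> concave_handle a" using a by (simp add: concave_handle_def zero_prod_def)
    moreover have "0 \<notin> glue_locus W U F a" using a by (simp add: glue_locus_def near_attaching_def)
    ultimately show ?thesis unfolding E_def by (force simp: handle_proj_def)
  qed

  \<comment> \<open>Distinct charts of \<open>M\<close> may induce the same chart of the glued surface; since \<open>\<omega>\<close> is compatible
    with changes of charts, any choice will do.\<close>
  define sel where "sel c = (SOME m. m \<in> atlas M \<and> c = emb m)" for c
  define \<omega>' where "\<omega>' c = (if c = (E, \<psi>) then \<Omega> else \<omega> (sel c))" for c
  have \<omega>'_handle: "\<omega>' (E, \<psi>) = \<Omega>" by (simp add: \<omega>'_def)
  have charts: "\<exists>D \<phi>. (D, \<phi>) \<in> atlas M \<and> D' = Inl ` (D \<inter> W - F ` glue_locus W U F a) \<and> \<phi>' = \<phi> \<circ> projl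
      \<and> \<omega>' (D', \<phi>') = \<omega> (D, \<phi>)" if "(D', \<phi>') \<in> atlas ?H" "(D', \<phi>') \<noteq> (E, \<psi>)" for D' \<phi>'
  proof -
    have "(D', \<phi>') \<in> emb ` atlas M" using that unfolding atlas by blast
    then obtain m where m: "m \<in> atlas M \<and> (D', \<phi>') = emb m" by blast
    have sel: "sel (D', \<phi>') \<in> atlas M \<and> (D', \<phi>') = emb (sel (D', \<phi>'))"
      unfolding sel_def by (rule someI[of "\<lambda>m. m \<in> atlas M \<and> (D', \<phi>') = emb m", OF m])
    obtain D \<phi> where D: "sel (D', \<phi>') = (D, \<phi>)" by (rule prod.exhaust)
    have "\<omega>' (D', \<phi>') = \<omega> (D, \<phi>)" unfolding \<omega>'_def D using that(2) by (rule if_not_P)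
    moreover have "(D', \<phi>') = (Inl ` (D \<inter> W - F ` glue_locus W U F a), \<phi> \<circ> projl)"
      using conjunct2[OF sel] unfolding D unfolding emb_def prod.case .
    moreover have "(D, \<phi>) \<in> atlas M" using conjunct1[OF sel] unfolding D .
    ultimately show ?thesis by blast
  qed

  \<comment> \<open>Towards the handle chart the inclusion reads as the inverse of \<open>F\<close>,
    and \<open>T\<close> inverts the differential through which \<open>pulled_form\<close> is
    expressed. Towards any other chart it is a change of charts of \<open>M\<close>.\<close>
  have pb: "pulls_back M \<omega> Inl W ?H \<omega>'"
    unfolding pulls_back_def
  proof (clarify)
    fix D \<phi> D' \<phi>' p
    assume c: "(D, \<phi>) \<in> atlas M" and c': "(D', \<phi>') \<in> atlas ?H" and p: "p \<in> D" "p \<in> W" "Inl p \<in> D'"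
    show "\<exists>T. (\<phi>' \<circ> Inl \<circ> inv_into D \<phi> has_derivative T) (at (\<phi> p) within \<phi> ` {q \<in> D \<inter> W. Inl q \<in> D'}) \<and>
      (\<forall>v w. \<omega> (D, \<phi>) (\<phi> p) v w = \<omega>' (D', \<phi>') (\<phi>' (Inl p)) (T v) (T w))"
    proof (cases "(D', \<phi>') = (E, \<psi>)")
      case True
      then obtain x where x: "x \<in> U" "p = F x" "1 - 1 / a < cmod (fst x)" "\<psi> (Inl p) = x"
        using E_Inl p by blast
      obtain T where T: "((inv_into U F \<circ> inv_into D \<phi>) has_derivative T) (at (\<phi> p))"
          "\<And>v. pd (T v) (\<phi> \<circ> F) x = v"
        using chart_F_derivative(2)[OF c x(1)] p x(2) by blast
      have "\<psi> \<circ> Inl \<circ> inv_into D \<phi> = inv_into U F \<circ> inv_into D \<phi>" by (simp add: \<psi>_def fun_eq_iff)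
      then have dT: "((\<psi> \<circ> Inl \<circ> inv_into D \<phi>) has_derivative T) (at (\<phi> p) within Z)" for Z
        using T(1) unfolding x(2) by (simp only: has_derivative_at_withinI)
      have Fx: "F x \<in> D" "F x \<in> N" using x p W by auto
      have "\<Omega> x = pulled_form x" using x Fx by (intro \<Omega>(2)) auto
      then have eq: "\<omega> (D, \<phi>) (\<phi> p) v w = \<Omega> (\<psi> (Inl p)) (T v) (T w)" for v w
        by (simp only: x(4) pulled_form_eq[OF c x(1) Fx] T(2)) (simp only: x(2))
      have "D' = E" "\<phi>' = \<psi>" using True by simp_all
      then show ?thesis using dT eq by (intro exI[of _ T]) (simp only: \<omega>'_handle simp_thms)
    next
      case False
      obtain D0 \<phi>0 where c0: "(D0, \<phi>0) \<in> atlas M" and D': "D' = Inl ` (D0 \<inter> W - F ` glue_locus W U F a)"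
        and \<phi>': "\<phi>' = \<phi>0 \<circ> projl" and \<omega>0: "\<omega>' (D', \<phi>') = \<omega> (D0, \<phi>0)"
        using charts[OF c' False] by blast
      have p0: "p \<in> D0" "p \<in> N" using p W by (auto simp: D')
      have "pulls_back M \<omega> id N M \<omega>" "id p \<in> D0"
        using \<omega> p0 unfolding kahler_form_on_def by simp_all
      then obtain T where T: "((\<phi>0 \<circ> id \<circ> inv_into D \<phi>) has_derivative T) (at (\<phi> p) within \<phi> ` {q \<in> D \<inter> N. id q \<in> D0})"
        "\<forall>v w. \<omega> (D, \<phi>) (\<phi> p) v w = \<omega> (D0, \<phi>0) (\<phi>0 (id p)) (T v) (T w)"
        using pulls_backE[OF _ c c0 p(1) p0(2)] by blast
      have comp: "\<phi>' \<circ> Inl \<circ> inv_into D \<phi> = \<phi>0 \<circ> id \<circ> inv_into D \<phi>" by (simp add: \<phi>' fun_eq_iff)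
      have sub: "\<phi> ` {q \<in> D \<inter> W. Inl q \<in> D'} \<subseteq> \<phi> ` {q \<in> D \<inter> N. id q \<in> D0}"
        using W by (auto simp: D')
      have pt: "\<phi>' (Inl p) = \<phi>0 (id p)" by (simp add: \<phi>')
      show ?thesis
        unfolding \<omega>0 comp pt
        by (intro exI[of _ T] conjI has_derivative_subset[OF T(1) sub] T(2))
    qed
  qed

  have "kahler_form ?H \<omega>'"
    unfolding kahler_form_def kahler_form_on_def
  proof (intro conjI)
    show "\<forall>(D', \<phi>')\<in>atlas ?H. \<exists>Q \<eta>. open Q \<and> \<phi>' ` (D' \<inter> ?X) \<subseteq> Q \<and> kahler_on Q \<eta> \<and>
        (\<forall>z\<in>\<phi>' ` (D' \<inter> ?X). \<eta> z = \<omega>' (D', \<phi>') z)"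
    proof (clarify)
      fix D' \<phi>' assume c': "(D', \<phi>') \<in> atlas ?H"
      show "\<exists>Q \<eta>. open Q \<and> \<phi>' ` (D' \<inter> ?X) \<subseteq> Q \<and> kahler_on Q \<eta> \<and> (\<forall>z\<in>\<phi>' ` (D' \<inter> ?X). \<eta> z = \<omega>' (D', \<phi>') z)"
      proof (cases "(D', \<phi>') = (E, \<psi>)")
        case True
        then show ?thesis using Q(1) \<psi>_Q \<Omega>(1) \<omega>'_handle by (intro exI[of _ Q] exI[of _ \<Omega>]) auto
      next
        case False
        obtain D0 \<phi>0 where c0: "(D0, \<phi>0) \<in> atlas M" and D': "D' = Inl ` (D0 \<inter> W - F ` glue_locus W U F a)"
          and \<phi>': "\<phi>' = \<phi>0 \<circ> projl" and \<omega>0: "\<omega>' (D', \<phi>') = \<omega> (D0, \<phi>0)"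
          using charts[OF c' False] by blast
        obtain Q \<eta> where Q\<eta>: "open Q" "\<phi>0 ` (D0 \<inter> N) \<subseteq> Q" "kahler_on Q \<eta>" "\<forall>z\<in>\<phi>0 ` (D0 \<inter> N). \<eta> z = \<omega> (D0, \<phi>0) z"
          by (rule kahler_form_onE[OF \<omega> c0])
        have sub: "\<phi>' ` (D' \<inter> ?X) \<subseteq> \<phi>0 ` (D0 \<inter> N)" using W by (auto simp: D' \<phi>')
        show ?thesis
          unfolding \<omega>0 using Q\<eta>(1,3) order_trans[OF sub Q\<eta>(2)] subsetD[OF sub, THEN bspec[OF Q\<eta>(4)]]
          by (intro exI[of _ Q] exI[of _ \<eta>] conjI ballI)
      qed
    qed
    \<comment> \<open>If the first chart comes from \<open>M\<close>, this is \<open>pb\<close>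
      restricted to a smaller set. If it is the handle chart, the change of coordinates is the
      identity or \<open>\<phi>0 \<circ> F\<close>.\<close>
    show "pulls_back ?H \<omega>' id ?X ?H \<omega>'"
      unfolding pulls_back_def
    proof (clarify)
      fix D1 \<phi>1 D' \<phi>' q
      assume c1: "(D1, \<phi>1) \<in> atlas ?H" and c': "(D', \<phi>') \<in> atlas ?H" and q: "q \<in> D1" "q \<in> ?X" "id q \<in> D'"
      show "\<exists>T. (\<phi>' \<circ> id \<circ> inv_into D1 \<phi>1 has_derivative T) (at (\<phi>1 q) within \<phi>1 ` {q \<in> D1 \<inter> ?X. id q \<in> D'}) \<and>
        (\<forall>v w. \<omega>' (D1, \<phi>1) (\<phi>1 q) v w = \<omega>' (D', \<phi>') (\<phi>' (id q)) (T v) (T w))"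
      proof (cases "(D1, \<phi>1) = (E, \<psi>)")
        case False
        obtain D \<phi> where c: "(D, \<phi>) \<in> atlas M" and D1: "D1 = Inl ` (D \<inter> W - F ` glue_locus W U F a)"
          and \<phi>1: "\<phi>1 = \<phi> \<circ> projl" and \<omega>1: "\<omega>' (D1, \<phi>1) = \<omega> (D, \<phi>)"
          using charts[OF c1 False] by blast
        obtain p where p: "q = Inl p" "p \<in> D" "p \<in> W" using q(1) by (auto simp: D1)
        have "Inl p \<in> D'" using p q by simp
        then obtain T where T: "((\<phi>' \<circ> Inl \<circ> inv_into D \<phi>) has_derivative T) (at (\<phi> p) within \<phi> ` {q \<in> D \<inter> W. Inl q \<in> D'})"
          "\<forall>v w. \<omega> (D, \<phi>) (\<phi> p) v w = \<omega>' (D', \<phi>') (\<phi>' (Inl p)) (T v) (T w)"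
          using pulls_backE[OF pb c c' p(2,3)] by blast
        let ?Z = "\<phi>1 ` {q \<in> D1 \<inter> ?X. id q \<in> D'}"
        have Z: "?Z \<subseteq> \<phi> ` {q \<in> D \<inter> W. Inl q \<in> D'}" by (auto simp: D1 \<phi>1)
        have inj1: "inj_on \<phi>1 D1" using chart_facts(2)[OF c] by (auto simp: D1 \<phi>1 inj_on_def)
        have eq: "(\<phi>' \<circ> id \<circ> inv_into D1 \<phi>1) z = (\<phi>' \<circ> Inl \<circ> inv_into D \<phi>) z" if "z \<in> ?Z" for z
        proof -
          obtain r where r: "r \<in> D1" "z = \<phi>1 r" using \<open>z \<in> ?Z\<close> by blast
          then obtain s where s: "r = Inl s" "s \<in> D" by (auto simp: D1)
          then have "z = \<phi> s" using r by (simp add: \<phi>1)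
          then show ?thesis using inv_into_f_f[OF inj1 r(1)] inv_c[OF c s(2)] r(2) s(1) by simp
        qed
        have pt: "\<phi>1 q = \<phi> p" by (simp add: \<phi>1 p)
        have "\<phi>1 q \<in> ?Z" using q by auto
        have "((\<phi>' \<circ> id \<circ> inv_into D1 \<phi>1) has_derivative T) (at (\<phi>1 q) within ?Z)"
        proof (rule has_derivative_transform[OF \<open>\<phi>1 q \<in> ?Z\<close> eq])
          show "((\<phi>' \<circ> Inl \<circ> inv_into D \<phi>) has_derivative T) (at (\<phi>1 q) within ?Z)"
            unfolding pt by (rule has_derivative_subset[OF T(1) Z])
        qed
        moreover have "id q = Inl p" using p(1) by simp
        then have "\<forall>v w. \<omega>' (D1, \<phi>1) (\<phi>1 q) v w = \<omega>' (D', \<phi>') (\<phi>' (id q)) (T v) (T w)"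
          using T(2) by (simp only: \<omega>1 pt simp_thms)
        ultimately show ?thesis by (intro exI[of _ T] conjI)
      next
        case True
        then have D1: "D1 = E" "\<phi>1 = \<psi>" by auto
        let ?Z = "\<psi> ` {q \<in> E \<inter> ?X. id q \<in> D'}"
        have qZ: "\<psi> q \<in> ?Z" using q D1 by auto
        have inv_E: "inv_into E \<psi> (\<psi> r) = r" if "r \<in> E" for r using \<psi>_inj that by simp
        show ?thesis
        proof (cases "(D', \<phi>') = (E, \<psi>)")
          case True
          have "((\<psi> \<circ> id \<circ> inv_into E \<psi>) has_derivative (\<lambda>v. v)) (at (\<psi> q) within ?Z)"
            by (rule has_derivative_transform[OF qZ _ has_derivative_ident]) (auto simp: inv_E)
          then show ?thesis using True unfolding D1 by (intro exI[of _ "\<lambda>v. v"]) auto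
        next
          case False
          obtain D0 \<phi>0 where c0: "(D0, \<phi>0) \<in> atlas M" and D': "D' = Inl ` (D0 \<inter> W - F ` glue_locus W U F a)"
            and \<phi>': "\<phi>' = \<phi>0 \<circ> projl" and \<omega>0: "\<omega>' (D', \<phi>') = \<omega> (D0, \<phi>0)"
            using charts[OF c' False] by blast
          have Inl: "\<exists>x\<in>U. r = Inl (F x) \<and> 1 - 1 / a < cmod (fst x) \<and> F x \<in> W \<and> F x \<in> D0 \<and> \<psi> r = x"
            if r: "r \<in> E" "r \<in> D'" for r
          proof -
            obtain w where w: "r = Inl w" "w \<in> D0" using r(2) by (auto simp: D')
            then show ?thesis using E_Inl[of w] r(1) by auto
          qed
          obtain x where x: "x \<in> U" "q = Inl (F x)" "1 - 1 / a < cmod (fst x)" "F x \<in> W" "F x \<in> D0" "\<psi> q = x"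
          proof -
            have "q \<in> E" "q \<in> D'" using q D1(1) by simp_all
            from Inl[OF this] show thesis using that by blast
          qed
          have xN: "F x \<in> N" using x W by blast
          have "((\<phi>' \<circ> id \<circ> inv_into E \<psi>) has_derivative (\<lambda>v. pd v (\<phi>0 \<circ> F) x)) (at (\<psi> q) within ?Z)"
          proof (rule has_derivative_transform[OF qZ])
            show "(\<phi>0 \<circ> F has_derivative (\<lambda>v. pd v (\<phi>0 \<circ> F) x)) (at (\<psi> q) within ?Z)"
              unfolding x(6) by (rule has_derivative_at_withinI[OF chart_F_derivative(1)[OF c0 x(1,5)]])
            fix z assume "z \<in> ?Z"
            then obtain r where r: "r \<in> E" "r \<in> D'" "z = \<psi> r" by auto
            obtain y where "r = Inl (F y)" "\<psi> r = y" using Inl[OF r(1,2)] by blast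
            then show "(\<phi>' \<circ> id \<circ> inv_into E \<psi>) z = (\<phi>0 \<circ> F) z"
              using inv_E[OF r(1)] r(3) by (simp add: \<phi>')
          qed
          moreover have "\<Omega> x v w = \<omega> (D0, \<phi>0) (\<phi>0 (F x)) (pd v (\<phi>0 \<circ> F) x) (pd w (\<phi>0 \<circ> F) x)" for v w
            using \<Omega>(2)[of x] x(1,3) xN pulled_form_eq[OF c0 x(1,5) xN] by simp
          then have "\<forall>v w. \<Omega> (\<psi> q) v w = \<omega> (D0, \<phi>0) (\<phi>' (id q)) (pd v (\<phi>0 \<circ> F) x) (pd w (\<phi>0 \<circ> F) x)"
            unfolding x(6) by (simp add: x(2) \<phi>')
          ultimately show ?thesis
            unfolding D1 \<omega>0 \<omega>'_handle by (intro exI conjI)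
        qed
      qed
    qed
  qed
  with pb show ?thesis by blast
qed

end

theorem lemma4p2:
  fixes M :: "'a surface" and W L B W1 L1 V :: "'a set" and U :: "complex2 set"
    and F :: "complex2 \<Rightarrow> 'a" and \<omega> :: "'a chart \<Rightarrow> form2"
  assumes "complex_surface M"
    and "strongly_pseudoconcave M W"
    and "kahler_domain M W \<omega>"
    and "holomorphic_attaching M W L B W1 L1 U V F"
  shows "\<forall>\<^sub>F a in at_top. \<exists>\<omega>'.
           kahler_form (attach_handle M W1 U F a) \<omega>' \<and>
           pulls_back M \<omega> Inl W1 (attach_handle M W1 U F a) \<omega>'"
proof -
  obtain N where N: "openin (surf_top M) N" "W \<subseteq> N" "kahler_form_on M N \<omega>"
    using assms(3) unfolding kahler_domain_def by blast
  note att = assms(4)[unfolded holomorphic_attaching_def]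
  have F: "biholomorphic M U V F" and W1: "W1 \<subseteq> N" using att N(2) by blast+
  \<comment> \<open>A closed set contains its frontier, so the knot lies in \<open>W1\<close> and
    \<open>F\<close> carries the attaching circle into \<open>N\<close>.\<close>
  have "closedin (surf_top M) W1" "L1 \<subseteq> bdry M W1"
    using att unfolding strongly_pseudoconcave_def transverse_knot_def by blast+
  then have "L1 \<subseteq> N" using frontier_of_subset_closedin W1 by blast
  then have FN: "F ` attaching_circle \<subseteq> N" using att by blast
  have "\<forall>\<^sub>F a in at_top. attaching_region a \<subseteq> U" using att by blast
  then have "\<forall>\<^sub>F a in at_top. attaching_region a \<subseteq> U \<and> 0 < a"
    using eventually_gt_at_top[of 0] by (rule eventually_conj)
  \<comment> \<open>The attaching circle does not depend on \<open>a\<close>, so a single large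
    value is enough to place it in \<open>U\<close>.\<close>
  then obtain a where a: "attaching_region a \<subseteq> U" "0 < a"
    using eventually_happens'[OF trivial_limit_at_top_linorder] by blast
  have "attaching_circle \<subseteq> attaching_region a"
    using a(2) by (auto simp: attaching_circle_def attaching_region_def concave_handle_def)
  then have circle: "attaching_circle \<subseteq> {x \<in> U. F x \<in> N}" using a(1) FN by blast
  note ctx = assms(1) F N(1,3)
  show ?thesis
    by (rule eventually_mono[OF kahler_extend_over_handle[OF open_pulled_domain[OF ctx] circle kahler_on_pulled_form[OF ctx]]])
       (use kahler_form_attach_handle[OF ctx W1] in blast)
qed

end
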